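(* Let $\mathcal{A}=(\mathcal{H},Act,\{\mathcal{E}_\alpha\}_{\alpha\in Act},\sigma_0)$ be a quantum automaton with $|Act|>1$ and rational data, and let $\phi=\bigvee_{i=1}^t p_i$ with each $p_i$ a subspace (projection) of $\mathcal{H}$. Then it is decidable whether $\lozenge\square\phi$ is valid, i.e. whether for every infinite word $\alpha_1\alpha_2\cdots\in Act^\omega$ there exists $i\ge0$ such that the induced sequence satisfies $\sigma_j\models\phi$ for all $j\ge i$.
   Context: A quantum automaton consists of a $d$-dimensional Hilbert space $\mathcal{H}$, a finite set $Act$ of actions, a trace-preserving super-operator $\mathcal{E}_\alpha$ on $\mathcal{H}$ for each $\alpha\in Act$, and an initial state $\sigma_0$; all entries are rational. Each word $\alpha_1\alpha_2\cdots\in Act^\omega$ induces the admissible sequence $\sigma_0\sigma_1\cdots$ with $\sigma_i=\mathcal{E}_{\alpha_i}(\sigma_{i-1})$. For a state $\sigma$ and subspace $p$, $\sigma\models p$ iff $\mathrm{supp}(\sigma)\subseteq p$; for a finite union $\phi=\bigvee_i p_i$ of subspaces, $\sigma\models\phi$ iff $\sigma\models p_i$ for some $i$. *)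

theory Defs
  imports
    "HOL-Library.Nat_Bijection"
    "Jordan_Normal_Form.Schur_Decomposition"
    "Jordan_Normal_Form.VS_Connect"
begin

section \<open>Decidability\<close>

text \<open>Total (general) recursive functions of arity \<open>n\<close>, acting on argument lists of length \<open>n\<close>:
  zero, successor and projections, closed under composition, primitive recursion and
  minimization of regular functions. The values on lists of another length are irrelevant.\<close>

inductive recursive :: "nat \<Rightarrow> (nat list \<Rightarrow> nat) \<Rightarrow> bool" where
  zero: "recursive n (\<lambda>xs. 0)"
| succ: "recursive 1 (\<lambda>xs. Suc (hd xs))"
| proj: "i < n \<Longrightarrow> recursive n (\<lambda>xs. xs ! i)"
| comp: "recursive (length gs) f \<Longrightarrow> (\<forall>g \<in> set gs. recursive n g) \<Longrightarrow>
    recursive n (\<lambda>xs. f (map (\<lambda>g. g xs) gs))"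
| prim_rec: "recursive n f \<Longrightarrow> recursive (n + 2) g \<Longrightarrow>
    recursive (n + 1)
      (\<lambda>xs. rec_nat (f (tl xs)) (\<lambda>k r. g (k # r # tl xs)) (hd xs))"
| minimize: "recursive (n + 1) f \<Longrightarrow>
    (\<forall>xs. length xs = n \<longrightarrow> (\<exists>y. f (y # xs) = 0)) \<Longrightarrow>
    recursive n (\<lambda>xs. LEAST y. f (y # xs) = 0)"

text \<open>The decision problem with instance set \<open>I\<close>, instance encoding \<open>enc\<close> and question \<open>P\<close>:
  one total recursive function answers the question correctly on the code of every instance.\<close>

definition decidable_problem :: "'a set \<Rightarrow> ('a \<Rightarrow> nat) \<Rightarrow> ('a \<Rightarrow> bool) \<Rightarrow> bool" where
  "decidable_problem I enc P \<longleftrightarrow>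
    (\<exists>f. recursive 1 f \<and> (\<forall>x \<in> I. f [enc x] = (if P x then 1 else 0)))"

section \<open>States, super-operators and subspaces of $\mathbb{C}^d$\<close>

definition trace_mat :: "complex mat \<Rightarrow> complex" where
  "trace_mat A = (\<Sum>i < dim_row A. A $$ (i, i))"

text \<open>The order on \<^typ>\<open>complex\<close> is the one for which \<open>0 \<le> z\<close> means that \<open>z\<close> is real and nonnegative.\<close>

definition positive_mat :: "nat \<Rightarrow> complex mat \<Rightarrow> bool" where
  "positive_mat n A \<longleftrightarrow>
    A \<in> carrier_mat n n \<and> (\<forall>v \<in> carrier_vec n. 0 \<le> (A *\<^sub>v v) \<bullet>c v)"

definition density_mat :: "nat \<Rightarrow> complex mat \<Rightarrow> bool" where
  "density_mat d \<sigma> \<longleftrightarrow> positive_mat d \<sigma> \<and> trace_mat \<sigma> = 1"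

definition linear_mat_map :: "nat \<Rightarrow> (complex mat \<Rightarrow> complex mat) \<Rightarrow> bool" where
  "linear_mat_map d \<E> \<longleftrightarrow>
    (\<forall>X \<in> carrier_mat d d. \<E> X \<in> carrier_mat d d) \<and>
    (\<forall>X \<in> carrier_mat d d. \<forall>Y \<in> carrier_mat d d. \<E> (X + Y) = \<E> X + \<E> Y) \<and>
    (\<forall>c. \<forall>X \<in> carrier_mat d d. \<E> (c \<cdot>\<^sub>m X) = c \<cdot>\<^sub>m \<E> X)"

text \<open>\<open>ampliate k d \<E>\<close> is the map \<open>id\<^sub>k \<otimes> \<E>\<close> on \<open>(k * d)\<close>-dimensional matrices: it applies \<open>\<E>\<close> to
  each of the \<open>k * k\<close> blocks of size \<open>d * d\<close>.\<close>

definition block :: "nat \<Rightarrow> complex mat \<Rightarrow> nat \<Rightarrow> nat \<Rightarrow> complex mat" where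
  "block d X a b = mat d d (\<lambda>(i, j). X $$ (a * d + i, b * d + j))"

definition ampliate ::
    "nat \<Rightarrow> nat \<Rightarrow> (complex mat \<Rightarrow> complex mat) \<Rightarrow> complex mat \<Rightarrow> complex mat" where
  "ampliate k d \<E> X =
    mat (k * d) (k * d)
      (\<lambda>(r, c). \<E> (block d X (r div d) (c div d)) $$ (r mod d, c mod d))"

definition completely_positive :: "nat \<Rightarrow> (complex mat \<Rightarrow> complex mat) \<Rightarrow> bool" where
  "completely_positive d \<E> \<longleftrightarrow>
    (\<forall>k X. positive_mat (k * d) X \<longrightarrow> positive_mat (k * d) (ampliate k d \<E> X))"

definition trace_preserving :: "nat \<Rightarrow> (complex mat \<Rightarrow> complex mat) \<Rightarrow> bool" where
  "trace_preserving d \<E> \<longleftrightarrow> (\<forall>X \<in> carrier_mat d d. trace_mat (\<E> X) = trace_mat X)"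

definition tp_super_operator :: "nat \<Rightarrow> (complex mat \<Rightarrow> complex mat) \<Rightarrow> bool" where
  "tp_super_operator d \<E> \<longleftrightarrow>
    linear_mat_map d \<E> \<and> completely_positive d \<E> \<and> trace_preserving d \<E>"

definition projection_mat :: "nat \<Rightarrow> complex mat \<Rightarrow> bool" where
  "projection_mat d P \<longleftrightarrow> P \<in> carrier_mat d d \<and> P * P = P \<and> mat_adjoint P = P"

definition proj_space :: "complex mat \<Rightarrow> complex vec set" where
  "proj_space P = {P *\<^sub>v v | v. v \<in> carrier_vec (dim_col P)}"

definition supp :: "complex mat \<Rightarrow> complex vec set" where
  "supp \<sigma> = LinearCombinations.module.span class_ring (module_vec TYPE(complex) (dim_row \<sigma>))
    {v. \<exists>k. k \<noteq> 0 \<and> eigenvector \<sigma> v k}"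

text \<open>A finite union of subspaces is given by the list of the corresponding projections.\<close>

definition satisfies :: "complex mat \<Rightarrow> complex mat list \<Rightarrow> bool" where
  "satisfies \<sigma> \<phi> \<longleftrightarrow> (\<exists>P \<in> set \<phi>. supp \<sigma> \<subseteq> proj_space P)"

section \<open>Quantum automata\<close>

record qautomaton =
  qdim :: nat
  qact :: "nat set"
  qop :: "nat \<Rightarrow> complex mat \<Rightarrow> complex mat"
  qinit :: "complex mat"

definition quantum_automaton :: "qautomaton \<Rightarrow> bool" where
  "quantum_automaton \<A> \<longleftrightarrow>
    finite (qact \<A>) \<and>
    (\<forall>\<alpha> \<in> qact \<A>. tp_super_operator (qdim \<A>) (qop \<A> \<alpha>)) \<and>
    density_mat (qdim \<A>) (qinit \<A>)"

text \<open>In a word \<open>w\<close> the letter \<open>w i\<close> leads from the \<open>i\<close>-th to the \<open>(i + 1)\<close>-st state.\<close>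

definition infinite_words :: "qautomaton \<Rightarrow> (nat \<Rightarrow> nat) set" where
  "infinite_words \<A> = {w. \<forall>i. w i \<in> qact \<A>}"

primrec admissible_seq :: "qautomaton \<Rightarrow> (nat \<Rightarrow> nat) \<Rightarrow> nat \<Rightarrow> complex mat" where
  "admissible_seq \<A> w 0 = qinit \<A>"
| "admissible_seq \<A> w (Suc i) = qop \<A> (w i) (admissible_seq \<A> w i)"

definition eventually_always_valid :: "qautomaton \<Rightarrow> complex mat list \<Rightarrow> bool" where
  "eventually_always_valid \<A> \<phi> \<longleftrightarrow>
    (\<forall>w \<in> infinite_words \<A>. \<exists>i. \<forall>j \<ge> i. satisfies (admissible_seq \<A> w j) \<phi>)"

section \<open>Rational data and their encoding\<close>

text \<open>Rationality of a complex entry means rational real and imaginary part. The entries of a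
  super-operator are those of its matrix with respect to the basis of matrix units.\<close>

definition rational_complex :: "complex \<Rightarrow> bool" where
  "rational_complex z \<longleftrightarrow> Re z \<in> \<rat> \<and> Im z \<in> \<rat>"

definition rational_mat :: "complex mat \<Rightarrow> bool" where
  "rational_mat A \<longleftrightarrow> (\<forall>i < dim_row A. \<forall>j < dim_col A. rational_complex (A $$ (i, j)))"

definition matrix_unit :: "nat \<Rightarrow> nat \<Rightarrow> nat \<Rightarrow> complex mat" where
  "matrix_unit d k l = mat d d (\<lambda>(i, j). if i = k \<and> j = l then 1 else 0)"

definition rational_super_operator :: "nat \<Rightarrow> (complex mat \<Rightarrow> complex mat) \<Rightarrow> bool" where
  "rational_super_operator d \<E> \<longleftrightarrow> (\<forall>k < d. \<forall>l < d. rational_mat (\<E> (matrix_unit d k l)))"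

definition rational_automaton :: "qautomaton \<Rightarrow> bool" where
  "rational_automaton \<A> \<longleftrightarrow>
    (\<forall>\<alpha> \<in> qact \<A>. rational_super_operator (qdim \<A>) (qop \<A> \<alpha>)) \<and> rational_mat (qinit \<A>)"

definition rat_encode :: "rat \<Rightarrow> nat" where
  "rat_encode q = (case quotient_of q of (a, b) \<Rightarrow> prod_encode (int_encode a, int_encode b))"

definition complex_encode :: "complex \<Rightarrow> nat" where
  "complex_encode z =
    prod_encode (rat_encode (the_inv of_rat (Re z)), rat_encode (the_inv of_rat (Im z)))"

definition mat_encode :: "complex mat \<Rightarrow> nat" where
  "mat_encode A = list_encode (map (\<lambda>row. list_encode (map complex_encode row)) (mat_to_list A))"

definition super_operator_encode :: "nat \<Rightarrow> (complex mat \<Rightarrow> complex mat) \<Rightarrow> nat" where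
  "super_operator_encode d \<E> =
    list_encode [mat_encode (\<E> (matrix_unit d k l)). k \<leftarrow> [0..<d], l \<leftarrow> [0..<d]]"

definition automaton_encode :: "qautomaton \<Rightarrow> nat" where
  "automaton_encode \<A> =
    list_encode
      [qdim \<A>,
       list_encode [prod_encode (\<alpha>, super_operator_encode (qdim \<A>) (qop \<A> \<alpha>)).
         \<alpha> \<leftarrow> sorted_list_of_set (qact \<A>)],
       mat_encode (qinit \<A>)]"

definition instance_encode :: "qautomaton \<times> complex mat list \<Rightarrow> nat" where
  "instance_encode = (\<lambda>(\<A>, \<phi>).
    prod_encode (automaton_encode \<A>, list_encode (map mat_encode \<phi>)))"

end

theory Submission
  imports Defs
begin

text \<open>Flattened to vectors of length \<open>n = d\<^sup>2\<close>, the states evolve linearly, and a state violates \<open>\<phi>\<close>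
  (is bad) iff \<open>P \<sigma> \<noteq> \<sigma>\<close> for every disjunct \<open>P\<close>, i.e. iff some product of \<open>t\<close> linear forms does not vanish
  at it. So the formula is invalid iff some infinite word visits the complement of a finite union of
  subspaces infinitely often.

  If a word has sufficiently many bad positions, then by Jacob's lemma the product \<open>v\<close> of the maps between
  two of them satisfies \<open>im v = im v\<^sup>2\<close>. On \<open>im v\<close> the map \<open>v\<close> is invertible, so a product of linear forms
  that does not vanish at \<open>v x\<close> does not vanish at infinitely many \<open>v\<^sup>k x\<close>, and repeating \<open>v\<close> forever gives
  infinitely many bad positions. Hence invalidity means that some word has at least \<open>N\<close> bad positions,
  for an explicit \<open>N\<close>. In a shortest such word consecutive bad positions are close together: homogeneous
  forms of a fixed degree are linear in a tensor power, so among too many intermediate states one is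
  dispensable. This bounds the length of the words that have to be tried.\<close>

section \<open>Homogeneous forms in finitely many coordinates\<close>

text \<open>All three repetition arguments use one fact, \<open>form_dependence\<close>: among more
  than \<open>n ^ T\<close> vectors in a row there is a position \<open>k0\<close>, fixed before the
  form, such that any form of degree \<open>T\<close> that is nonzero at \<open>k0\<close> is
  nonzero at a later position. The order of these quantifiers matters, because each time the form is
  built from \<open>k0\<close>: in Jacob's lemma it is a determinant with the map that follows
  \<open>k0\<close>, in the recurrence it is composed with a power of \<open>v\<close> depending on
  \<open>k0\<close>, and in the shortening of words with the letters read after \<open>k0\<close>.
  Badness is a union of nonvanishing conditions, not a single one, since a disjunct can fail in
  several entries. A product of linear forms is therefore chosen separately for each bad state. The
  program contains no rational arithmetic. Every number occurring in the instance is at most the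
  code of the instance, so the factorial of the code is a common multiple of all denominators, and a
  nonzero factor does not affect the vanishing of a form.\<close>

definition index_words :: "nat \<Rightarrow> nat \<Rightarrow> nat list set" where
  "index_words n T = {f. set f \<subseteq> {..<n} \<and> length f = T}"

definition linear_form :: "nat \<Rightarrow> ((nat \<Rightarrow> 'a::field) \<Rightarrow> 'a) \<Rightarrow> bool" where
  "linear_form n l \<longleftrightarrow> (\<exists>a. \<forall>x. l x = (\<Sum>b<n. a b * x b))"

text \<open>Coefficients are indexed by words, not by multisets: a form of degree \<open>T\<close>
  is a linear functional of the \<open>T\<close>-th tensor power, whose dimension is
  \<open>n ^ T\<close>.\<close>

definition form :: "nat \<Rightarrow> nat \<Rightarrow> ((nat \<Rightarrow> 'a::field) \<Rightarrow> 'a) \<Rightarrow> bool" where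
  "form n T g \<longleftrightarrow> (\<exists>\<kappa>. \<forall>x. g x = (\<Sum>f\<in>index_words n T. \<kappa> f * prod_list (map x f)))"

text \<open>Inputs are read from the first \<open>n\<close> coordinates only, whereas outputs exist
  in all of them. Hence the identity is not a \<open>linear_endo\<close>, and products have to be
  nonempty; this is the reason for \<open>Suc l\<close> and \<open>ws \<noteq> []\<close>
  below.\<close>

definition linear_endo :: "nat \<Rightarrow> ((nat \<Rightarrow> 'a::field) \<Rightarrow> nat \<Rightarrow> 'a) \<Rightarrow> bool" where
  "linear_endo n A \<longleftrightarrow> (\<exists>M. \<forall>x a. A x a = (\<Sum>b<n. M a b * x b))"

lemma finite_index_words [simp]: "finite (index_words n T)"
  unfolding index_words_def by (rule finite_lists_length_eq) simp

lemma card_index_words: "card (index_words n T) = n ^ T"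
  unfolding index_words_def by (subst card_lists_length_eq) auto

lemma index_words_0: "index_words n 0 = {[]}"
  unfolding index_words_def by auto

lemma index_words_Suc:
  "index_words n (Suc T) = (\<lambda>(b, f). b # f) ` ({..<n} \<times> index_words n T)"
  unfolding index_words_def by (auto simp: length_Suc_conv image_iff)

text \<open>Row-major indexing: \<open>k * r + l\<close> runs through column \<open>l\<close> of an
  \<open>n\<close> by \<open>r\<close> array. It serves the entries of \<open>G\<close> in
  \<open>form_det_core_mat\<close> and the matrix product in \<open>bad_flat_iff\<close>.\<close>

lemma sum_residue_class:
  fixes f :: "nat \<Rightarrow> 'a::comm_monoid_add"
  assumes "l < r"
  shows "(\<Sum>a<n * r. if a mod r = l then f a else 0) = (\<Sum>k<n. f (k * r + l))"
proof -
  have inj: "inj_on (\<lambda>k. k * r + l) {..<n}" using assms by (auto simp: inj_on_def)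
  have "{a \<in> {..<n * r}. a mod r = l} = (\<lambda>k. k * r + l) ` {..<n}"
  proof (intro equalityI subsetI)
    fix a assume a: "a \<in> {a \<in> {..<n * r}. a mod r = l}"
    then have "a div r < n" by (simp add: less_mult_imp_div_less)
    moreover have "a = a div r * r + l" using a div_mult_mod_eq[of a r] by simp
    ultimately show "a \<in> (\<lambda>k. k * r + l) ` {..<n}" by blast
  next
    fix a assume "a \<in> (\<lambda>k. k * r + l) ` {..<n}"
    then obtain k where k: "k < n" "a = k * r + l" by auto
    then have "a < Suc k * r" using assms by simp
    also have "\<dots> \<le> n * r" using k by (intro mult_right_mono) auto
    finally show "a \<in> {a \<in> {..<n * r}. a mod r = l}" using k assms by simp
  qed
  then have "(\<Sum>a<n * r. if a mod r = l then f a else 0) = (\<Sum>a\<in>(\<lambda>k. k * r + l) ` {..<n}. f a)"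
    by (subst sum.inter_filter[symmetric]) auto
  also have "\<dots> = (\<Sum>k<n. f (k * r + l))" by (subst sum.reindex[OF inj]) simp
  finally show ?thesis .
qed

text \<open>Gaussian elimination, one equation per induction step: an unknown \<open>k0\<close> that
  really occurs in equation \<open>s\<close> is eliminated from the other equations.\<close>

lemma homogeneous_system_solution:
  fixes u :: "'k \<Rightarrow> 's \<Rightarrow> 'a::field"
  assumes "finite S" "finite K" "card S < card K"
  shows "\<exists>c. (\<exists>k\<in>K. c k \<noteq> 0) \<and> (\<forall>s\<in>S. (\<Sum>k\<in>K. c k * u k s) = 0)"
  using assms
proof (induction S arbitrary: K u rule: finite_induct)
  case empty
  then have "K \<noteq> {}" by auto
  then show ?case by (intro exI[of _ "\<lambda>_. 1"]) auto
next
  case (insert s S)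
  show ?case
  proof (cases "\<forall>k\<in>K. u k s = 0")
    case True
    from insert have "card S < card K" by simp
    with insert.IH[OF insert.prems(1), of u] obtain c
      where "\<exists>k\<in>K. c k \<noteq> 0" "\<forall>s\<in>S. (\<Sum>k\<in>K. c k * u k s) = 0" by blast
    with True show ?thesis by (intro exI[of _ c]) auto
  next
    case False
    then obtain k0 where k0: "k0 \<in> K" "u k0 s \<noteq> 0" by auto
    let ?K = "K - {k0}"
    let ?u = "\<lambda>k s'. u k s' - u k s / u k0 s * u k0 s'"
    have "card S < card ?K" using insert k0 by auto
    with insert.IH[of ?K ?u] insert.prems obtain c
      where c: "\<exists>k\<in>?K. c k \<noteq> 0" "\<forall>s\<in>S. (\<Sum>k\<in>?K. c k * ?u k s) = 0" by auto
    \<comment> \<open>The value of the unknown \<open>k0\<close> that makes equation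
      \<open>s\<close> hold.\<close>
    define q where "q = - (\<Sum>k\<in>?K. c k * u k s) / u k0 s"
    let ?c = "c(k0 := q)"
    have split: "(\<Sum>k\<in>K. ?c k * u k s') = q * u k0 s' + (\<Sum>k\<in>?K. c k * u k s')" for s'
    proof -
      have "(\<Sum>k\<in>K. ?c k * u k s') = ?c k0 * u k0 s' + (\<Sum>k\<in>?K. ?c k * u k s')"
        by (rule sum.remove) (use insert.prems k0 in auto)
      moreover have "(\<Sum>k\<in>?K. ?c k * u k s') = (\<Sum>k\<in>?K. c k * u k s')"
        by (intro sum.cong) auto
      ultimately show ?thesis by simp
    qed
    have "(\<Sum>k\<in>K. ?c k * u k s) = 0" by (subst split) (simp add: q_def k0)
    moreover have "(\<Sum>k\<in>K. ?c k * u k s') = 0" if "s' \<in> S" for s'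
    proof -
      have "0 = (\<Sum>k\<in>?K. c k * ?u k s')" using c that by auto
      also have "\<dots> = (\<Sum>k\<in>?K. c k * u k s') - (\<Sum>k\<in>?K. c k * u k s) / u k0 s * u k0 s'"
        by (simp add: right_diff_distrib sum_subtractf sum_distrib_right sum_divide_distrib mult.assoc)
      finally show ?thesis by (subst split) (simp add: q_def)
    qed
    ultimately have "\<forall>s'\<in>insert s S. (\<Sum>k\<in>K. ?c k * u k s') = 0" by auto
    moreover have "\<exists>k\<in>K. ?c k \<noteq> 0" using c(1) by auto
    ultimately show ?thesis by blast
  qed
qed

text \<open>The tensor powers of \<open>M + 1\<close> vectors in dimension \<open>n ^ T\<close>
  satisfy a nontrivial relation. With \<open>k0\<close> the first index of a nonzero coefficient,
  the power at \<open>k0\<close> is a combination of later ones, so a form vanishing at all of these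
  vanishes at \<open>k0\<close>.\<close>

lemma form_dependence:
  fixes y :: "nat \<Rightarrow> nat \<Rightarrow> 'a::field"
  assumes "n ^ T \<le> M"
  obtains k0 where "k0 \<le> M"
    "\<And>g. form n T g \<Longrightarrow> g (y k0) \<noteq> 0 \<Longrightarrow> \<exists>k. k0 < k \<and> k \<le> M \<and> g (y k) \<noteq> 0"
proof -
  from homogeneous_system_solution[of "index_words n T" "{..M}" "\<lambda>k f. prod_list (map (y k) f)"]
  obtain c where c: "\<exists>k\<in>{..M}. c k \<noteq> 0"
    "\<forall>f\<in>index_words n T. (\<Sum>k\<le>M. c k * prod_list (map (y k) f)) = 0"
    using assms by (auto simp: card_index_words)
  define k0 where "k0 = (LEAST k. k \<le> M \<and> c k \<noteq> 0)"
  have k0: "k0 \<le> M" "c k0 \<noteq> 0"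
    using LeastI_ex[of "\<lambda>k. k \<le> M \<and> c k \<noteq> 0"] c(1) unfolding k0_def by auto
  have low: "c k = 0" if "k < k0" for k
    using not_less_Least[of k "\<lambda>k. k \<le> M \<and> c k \<noteq> 0"] that k0(1) unfolding k0_def by force
  show thesis
  proof (rule that[OF k0(1)], rule ccontr)
    fix g :: "(nat \<Rightarrow> 'a) \<Rightarrow> 'a"
    assume g: "form n T g" and nz: "g (y k0) \<noteq> 0"
      and "\<not> (\<exists>k. k0 < k \<and> k \<le> M \<and> g (y k) \<noteq> 0)"
    then have high: "g (y k) = 0" if "k0 < k" "k \<le> M" for k using that by blast
    from g obtain \<kappa> where \<kappa>: "\<And>x. g x = (\<Sum>f\<in>index_words n T. \<kappa> f * prod_list (map x f))"
      unfolding form_def by blast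
    \<comment> \<open>A form is linear in the tensor power, so its values inherit the
      relation.\<close>
    have "(\<Sum>k\<le>M. c k * g (y k)) =
        (\<Sum>f\<in>index_words n T. \<kappa> f * (\<Sum>k\<le>M. c k * prod_list (map (y k) f)))"
      unfolding \<kappa> sum_distrib_left by (subst sum.swap) (simp add: mult_ac)
    also have "\<dots> = 0" using c(2) by (intro sum.neutral) auto
    finally have "(\<Sum>k\<le>M. c k * g (y k)) = 0" .
    moreover have "(\<Sum>k\<le>M. c k * g (y k)) = (\<Sum>k\<in>{k0}. c k * g (y k))"
    proof (rule sum.mono_neutral_right)
      show "\<forall>i\<in>{..M} - {k0}. c i * g (y i) = 0"
      proof
        fix i assume "i \<in> {..M} - {k0}"
        then show "c i * g (y i) = 0" using low[of i] high[of i] by (cases "i < k0") auto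
      qed
    qed (use k0 in auto)
    ultimately show False using nz k0 by simp
  qed
qed

lemma form_const: "form n 0 (\<lambda>x. c)"
  unfolding form_def index_words_0 by (intro exI[of _ "\<lambda>_. c"]) simp

lemma form_mult_linear:
  assumes "linear_form n l" "form n T g"
  shows "form n (Suc T) (\<lambda>x. l x * g x)"
proof -
  from assms obtain a \<kappa> where a: "\<And>x. l x = (\<Sum>b<n. a b * x b)"
    and \<kappa>: "\<And>x. g x = (\<Sum>f\<in>index_words n T. \<kappa> f * prod_list (map x f))"
    unfolding form_def linear_form_def by blast
  have inj: "inj_on (\<lambda>(b, f). b # f) ({..<n} \<times> index_words n T)"
    by (auto simp: inj_on_def)
  show ?thesis unfolding form_def
  proof (intro exI allI)
    fix x
    show "l x * g x = (\<Sum>f\<in>index_words n (Suc T). (a (hd f) * \<kappa> (tl f)) * prod_list (map x f))"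
      unfolding index_words_Suc sum.reindex[OF inj] a \<kappa> sum_product
      by (simp add: sum.cartesian_product case_prod_unfold mult_ac)
  qed
qed

lemma form_sum:
  assumes "\<And>p. p \<in> P \<Longrightarrow> form n T (g p)"
  shows "form n T (\<lambda>x. \<Sum>p\<in>P. g p x)"
proof -
  from assms have "\<forall>p\<in>P. \<exists>\<kappa>. \<forall>x. g p x = (\<Sum>f\<in>index_words n T. \<kappa> f * prod_list (map x f))"
    unfolding form_def by blast
  then obtain \<kappa> where
    \<kappa>: "\<And>p x. p \<in> P \<Longrightarrow> g p x = (\<Sum>f\<in>index_words n T. \<kappa> p f * prod_list (map x f))"
    by metis
  show ?thesis unfolding form_def
  proof (intro exI allI)
    fix x
    show "(\<Sum>p\<in>P. g p x) = (\<Sum>f\<in>index_words n T. (\<Sum>p\<in>P. \<kappa> p f) * prod_list (map x f))"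
      unfolding sum_distrib_right by (subst sum.swap) (intro sum.cong refl \<kappa>)
  qed
qed

lemma form_cmult:
  assumes "form n T g"
  shows "form n T (\<lambda>x. c * g x)"
proof -
  from assms obtain \<kappa> where
    "\<And>x. g x = (\<Sum>f\<in>index_words n T. \<kappa> f * prod_list (map x f))"
    unfolding form_def by blast
  then show ?thesis unfolding form_def
    by (intro exI[of _ "\<lambda>f. c * \<kappa> f"]) (simp add: sum_distrib_left mult.assoc)
qed

lemma form_prod_mult:
  assumes "\<And>i. i < t \<Longrightarrow> linear_form n (l i)" "form n T g"
  shows "form n (t + T) (\<lambda>x. (\<Prod>i<t. l i x) * g x)"
  using assms
proof (induction t)
  case (Suc t)
  then have "form n (Suc (t + T)) (\<lambda>x. l t x * ((\<Prod>i<t. l i x) * g x))"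
    by (intro form_mult_linear) auto
  then show ?case by (simp add: mult_ac)
qed auto

lemma form_prod:
  assumes "\<And>i. i < t \<Longrightarrow> linear_form n (l i)"
  shows "form n t (\<lambda>x. \<Prod>i<t. l i x)"
  using form_prod_mult[OF assms form_const[of n 1]] by simp

lemma linear_form_coord: "linear_endo n A \<Longrightarrow> linear_form n (\<lambda>x. A x a)"
  unfolding linear_endo_def linear_form_def by blast

lemma linear_form_comp:
  assumes "linear_form n l" "linear_endo n A"
  shows "linear_form n (\<lambda>x. l (A x))"
proof -
  from assms obtain c M where c: "\<And>x. l x = (\<Sum>b<n. c b * x b)"
    and M: "\<And>x a. A x a = (\<Sum>b<n. M a b * x b)"
    unfolding linear_form_def linear_endo_def by blast
  show ?thesis unfolding linear_form_def
  proof (intro exI allI)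
    fix x
    show "l (A x) = (\<Sum>b<n. (\<Sum>a<n. c a * M a b) * x b)"
      unfolding c M sum_distrib_left sum_distrib_right by (subst sum.swap) (simp add: mult_ac)
  qed
qed

lemma linear_endo_comp:
  assumes "linear_endo n A" "linear_endo n B"
  shows "linear_endo n (A \<circ> B)"
proof -
  have "\<forall>a. \<exists>M. \<forall>x. A (B x) a = (\<Sum>b<n. M b * x b)"
    using linear_form_comp[OF linear_form_coord[OF assms(1)] assms(2)]
    unfolding linear_form_def by blast
  then obtain M where "\<And>a x. A (B x) a = (\<Sum>b<n. M a b * x b)" by metis
  then show ?thesis unfolding linear_endo_def by auto
qed

lemma form_comp:
  assumes "form n T g" "linear_endo n A"
  shows "form n T (\<lambda>x. g (A x))"
proof -
  from assms(1) obtain \<kappa> where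
    \<kappa>: "\<And>x. g x = (\<Sum>f\<in>index_words n T. \<kappa> f * prod_list (map x f))"
    unfolding form_def by blast
  have word: "form n (length f) (\<lambda>x. prod_list (map (A x) f))" for f
  proof (induction f)
    case Nil
    then show ?case using form_const[of n 1] by simp
  next
    case (Cons a f)
    then show ?case using form_mult_linear[OF linear_form_coord[OF assms(2)]] by simp
  qed
  have "form n T (\<lambda>x. prod_list (map (A x) f))" if "f \<in> index_words n T" for f
    using word[of f] that by (simp add: index_words_def)
  then show ?thesis unfolding \<kappa> by (intro form_sum form_cmult)
qed

section \<open>Regular factors of long products\<close>

text \<open>A rank factorization \<open>B = G F\<close> through \<open>r\<close> coordinates:
  \<open>F\<close> gives the inner coordinates, \<open>G\<close> the outer ones, and
  \<open>core_mat\<close> is the \<open>r\<close> by \<open>r\<close> matrix \<open>F G\<close> that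
  arises between two neighbouring factors of a product.\<close>

definition inner_coords :: "nat \<Rightarrow> nat \<Rightarrow> (nat \<Rightarrow> nat \<Rightarrow> 'a::field) \<Rightarrow> (nat \<Rightarrow> 'a) \<Rightarrow> 'a vec" where
  "inner_coords n r F x = vec r (\<lambda>k. \<Sum>b<n. F k b * x b)"

definition outer_coords :: "nat \<Rightarrow> (nat \<Rightarrow> nat \<Rightarrow> 'a::field) \<Rightarrow> 'a vec \<Rightarrow> nat \<Rightarrow> 'a" where
  "outer_coords r G u = (\<lambda>a. \<Sum>k<r. G a k * u $ k)"

definition core_mat ::
    "nat \<Rightarrow> nat \<Rightarrow> (nat \<Rightarrow> nat \<Rightarrow> 'a::field) \<Rightarrow> (nat \<Rightarrow> nat \<Rightarrow> 'a) \<Rightarrow> 'a mat" where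
  "core_mat n r F G = mat r r (\<lambda>(k, l). \<Sum>b<n. F k b * G b l)"

definition factors_through ::
    "nat \<Rightarrow> nat \<Rightarrow> ((nat \<Rightarrow> 'a::field) \<Rightarrow> nat \<Rightarrow> 'a) \<Rightarrow> bool" where
  "factors_through n r B \<longleftrightarrow> (\<exists>G F. \<forall>x. B x = outer_coords r G (inner_coords n r F x))"

text \<open>The nontrivial half of the equality of the images of \<open>v\<close> and
  \<open>v \<circ> v\<close>.\<close>

definition regular :: "('b \<Rightarrow> 'b) \<Rightarrow> bool" where
  "regular v \<longleftrightarrow> (\<forall>x. \<exists>y. v x = v (v y))"

primrec compose_seq :: "(nat \<Rightarrow> 'b \<Rightarrow> 'b) \<Rightarrow> nat \<Rightarrow> nat \<Rightarrow> 'b \<Rightarrow> 'b" where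
  "compose_seq B i 0 = id"
| "compose_seq B i (Suc l) = B (i + l) \<circ> compose_seq B i l"

lemma compose_seq_add:
  "compose_seq B i (l + l') = compose_seq B (i + l) l' \<circ> compose_seq B i l"
  by (induction l') (auto simp: fun_eq_iff add.assoc)

text \<open>Translates a factor found among blocks of \<open>m\<close> maps back into a factor of
  the original sequence.\<close>

lemma compose_seq_group:
  "compose_seq (\<lambda>q. compose_seq B (q * m) m) i l = compose_seq B (i * m) (l * m)"
proof (induction l)
  case (Suc l)
  have "Suc l * m = l * m + m" by simp
  then show ?case unfolding compose_seq.simps Suc.IH
    by (metis add_mult_distrib compose_seq_add)
qed simp

lemma mult_mat_vec_index:
  "A \<in> carrier_mat r c \<Longrightarrow> u \<in> carrier_vec c \<Longrightarrow> k < r \<Longrightarrow>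
    (A *\<^sub>v u) $ k = (\<Sum>l<c. A $$ (k, l) * u $ l)"
  by (auto simp: scalar_prod_def atLeast0LessThan intro!: sum.cong)

lemma inner_coords_carrier [simp]: "inner_coords n r F x \<in> carrier_vec r"
  by (simp add: inner_coords_def)

lemma core_mat_carrier [simp]: "core_mat n r F G \<in> carrier_mat r r"
  by (simp add: core_mat_def)

lemma inner_outer_coords:
  assumes "u \<in> carrier_vec r"
  shows "inner_coords n r F (outer_coords r G u) = core_mat n r F G *\<^sub>v u"
proof (rule eq_vecI)
  fix k assume "k < dim_vec (core_mat n r F G *\<^sub>v u)"
  then have k: "k < r" by (simp add: core_mat_def)
  have "(\<Sum>b<n. F k b * (\<Sum>l<r. G b l * u $ l)) = (\<Sum>l<r. (\<Sum>b<n. F k b * G b l) * u $ l)"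
    unfolding sum_distrib_left sum_distrib_right by (subst sum.swap) (simp add: mult_ac)
  then show "inner_coords n r F (outer_coords r G u) $ k = (core_mat n r F G *\<^sub>v u) $ k"
    using k assms
    by (simp add: inner_coords_def outer_coords_def core_mat_def scalar_prod_def atLeast0LessThan)
qed (simp add: inner_coords_def core_mat_def)

lemma factors_through_linear:
  assumes "factors_through n r B"
  shows "linear_endo n B"
proof -
  from assms obtain G F where B: "\<And>x. B x = outer_coords r G (inner_coords n r F x)"
    unfolding factors_through_def by blast
  show ?thesis unfolding linear_endo_def
  proof (intro exI allI)
    fix x a
    have "B x a = (\<Sum>k<r. G a k * (\<Sum>b<n. F k b * x b))"
      unfolding B outer_coords_def inner_coords_def by (intro sum.cong) auto
    also have "\<dots> = (\<Sum>b<n. (\<Sum>k<r. G a k * F k b) * x b)"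
      unfolding sum_distrib_left sum_distrib_right by (subst sum.swap) (simp add: mult_ac)
    finally show "B x a = (\<Sum>b<n. (\<Sum>k<r. G a k * F k b) * x b)" .
  qed
qed

lemma linear_factors_through:
  assumes "linear_endo n A"
  shows "factors_through n n A"
proof -
  from assms obtain M where M: "\<And>x a. A x a = (\<Sum>b<n. M a b * x b)"
    unfolding linear_endo_def by blast
  have "A x = outer_coords n M (inner_coords n n (\<lambda>k b. if b = k then 1 else 0) x)" for x
    unfolding outer_coords_def inner_coords_def fun_eq_iff M
    by (auto intro!: sum.cong simp: if_distrib[where f = "\<lambda>c. c * _"] cong: if_cong)
  then show ?thesis unfolding factors_through_def by blast
qed

lemma factors_through_comp_left:
  assumes "linear_endo n A" "factors_through n r B"
  shows "factors_through n r (A \<circ> B)"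
proof -
  from assms obtain M G F where M: "\<And>x a. A x a = (\<Sum>b<n. M a b * x b)"
    and B: "\<And>x. B x = outer_coords r G (inner_coords n r F x)"
    unfolding linear_endo_def factors_through_def by blast
  have "A (outer_coords r G u) a = outer_coords r (\<lambda>a k. \<Sum>b<n. M a b * G b k) u a" for u a
    unfolding M outer_coords_def sum_distrib_left sum_distrib_right
    by (subst sum.swap) (simp add: mult_ac)
  then have "A (B x) = outer_coords r (\<lambda>a k. \<Sum>b<n. M a b * G b k) (inner_coords n r F x)" for x
    unfolding B by blast
  then show ?thesis unfolding factors_through_def comp_def by blast
qed

lemma factors_through_comp_right:
  assumes "linear_endo n A" "factors_through n r B"
  shows "factors_through n r (B \<circ> A)"
proof -
  from assms obtain M G F where M: "\<And>x a. A x a = (\<Sum>b<n. M a b * x b)"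
    and B: "\<And>x. B x = outer_coords r G (inner_coords n r F x)"
    unfolding linear_endo_def factors_through_def by blast
  have "(\<Sum>b<n. F k b * A x b) = (\<Sum>c<n. (\<Sum>b<n. F k b * M b c) * x c)" for k x
    unfolding M sum_distrib_left sum_distrib_right by (subst sum.swap) (simp add: mult_ac)
  then have "inner_coords n r F (A x) = inner_coords n r (\<lambda>k c. \<Sum>b<n. F k b * M b c) x" for x
    unfolding inner_coords_def by simp
  then have "B (A x) = outer_coords r G (inner_coords n r (\<lambda>k c. \<Sum>b<n. F k b * M b c) x)" for x
    unfolding B by simp
  then show ?thesis unfolding factors_through_def comp_def by blast
qed

lemma linear_compose_seq:
  assumes "\<And>q. i \<le> q \<Longrightarrow> q < i + Suc l \<Longrightarrow> linear_endo n (B q)"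
  shows "linear_endo n (compose_seq B i (Suc l))"
  using assms
proof (induction l)
  case (Suc l)
  have "linear_endo n (compose_seq B i (Suc l))"
    by (rule Suc.IH) (use Suc.prems in auto)
  moreover have "linear_endo n (B (i + Suc l))" using Suc.prems by auto
  ultimately have "linear_endo n (B (i + Suc l) \<circ> compose_seq B i (Suc l))"
    by (intro linear_endo_comp)
  then show ?case unfolding compose_seq.simps(2)[of B i "Suc l"] .
qed simp

text \<open>A kernel vector \<open>v\<close> with nonzero entry \<open>k\<close> expresses column
  \<open>k\<close> through the others, so the remaining \<open>r\<close> columns form
  \<open>X\<close> and \<open>Y\<close> holds the coefficients.\<close>

lemma singular_mat_factorization:
  fixes C :: "'a::field mat"
  assumes C: "C \<in> carrier_mat (Suc r) (Suc r)" and det: "det C = 0"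
  shows "\<exists>X Y. \<forall>a<Suc r. \<forall>l<Suc r. C $$ (a, l) = (\<Sum>j<r. X a j * Y j l)"
proof -
  from det_0_iff_vec_prod_zero[OF C] det obtain v where v: "v \<in> carrier_vec (Suc r)"
    "v \<noteq> 0\<^sub>v (Suc r)" "C *\<^sub>v v = 0\<^sub>v (Suc r)" by blast
  then obtain k where k: "k < Suc r" "v $ k \<noteq> 0"
    by (metis carrier_vecD eq_vecI index_zero_vec(1) index_zero_vec(2))
  \<comment> \<open>\<open>s\<close> enumerates the \<open>r\<close> indices other than
    \<open>k\<close>.\<close>
  define s where "s = (\<lambda>j. if j < k then j else Suc j)"
  have bij: "bij_betw s {..<r} ({..<Suc r} - {k})"
  proof (rule bij_betwI')
    show "\<And>x y. x \<in> {..<r} \<Longrightarrow> y \<in> {..<r} \<Longrightarrow> (s x = s y) = (x = y)"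
      by (auto simp: s_def split: if_splits)
    show "\<And>x. x \<in> {..<r} \<Longrightarrow> s x \<in> {..<Suc r} - {k}" using k by (auto simp: s_def)
    show "\<exists>x\<in>{..<r}. y = s x" if "y \<in> {..<Suc r} - {k}" for y
    proof (cases "y < k")
      case True then show ?thesis using k that by (intro bexI[of _ y]) (auto simp: s_def)
    next
      case False then show ?thesis using k that by (intro bexI[of _ "y - 1"]) (auto simp: s_def)
    qed
  qed
  define Y where "Y = (\<lambda>j l. if l = k then - v $ (s j) / v $ k else if l = s j then 1 else 0)"
  have "C $$ (a, l) = (\<Sum>j<r. C $$ (a, s j) * Y j l)" if a: "a < Suc r" and l: "l < Suc r" for a l
  proof (cases "l = k")
    case True
    have "0 = (C *\<^sub>v v) $ a" using v(3) a by simp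
    also have "\<dots> = (\<Sum>j<Suc r. C $$ (a, j) * v $ j)"
      by (rule mult_mat_vec_index[OF C v(1) a])
    also have "\<dots> = C $$ (a, k) * v $ k + (\<Sum>j\<in>{..<Suc r} - {k}. C $$ (a, j) * v $ j)"
      by (rule sum.remove) (use k in auto)
    also have "(\<Sum>j\<in>{..<Suc r} - {k}. C $$ (a, j) * v $ j) = (\<Sum>j<r. C $$ (a, s j) * v $ s j)"
      by (rule sum.reindex_bij_betw[OF bij, symmetric])
    finally have "C $$ (a, k) = - (\<Sum>j<r. C $$ (a, s j) * v $ s j) / v $ k"
      using k(2) by (simp add: field_simps add_eq_0_iff)
    then show ?thesis unfolding True Y_def by (simp add: sum_divide_distrib sum_negf)
  next
    case False
    have "(\<Sum>j<r. C $$ (a, s j) * Y j l) =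
        (\<Sum>j\<in>{..<Suc r} - {k}. C $$ (a, j) * (if l = j then 1 else 0))"
      unfolding Y_def using False
      by (subst sum.reindex_bij_betw[OF bij, symmetric]) simp
    also have "\<dots> = C $$ (a, l)" using False l by (simp add: if_distrib cong: if_cong)
    finally show ?thesis by simp
  qed
  then show ?thesis by (intro exI[of _ "\<lambda>a j. C $$ (a, s j)"] exI[of _ Y]) simp
qed

text \<open>In \<open>B2 B1 = G2 (F2 G1) F1\<close> the middle factor is singular, hence passes
  through one coordinate less, and so does the whole product.\<close>

lemma singular_core_factors_through:
  assumes B1: "\<And>x. B1 x = outer_coords (Suc r) G1 (inner_coords n (Suc r) F1 x)"
    and B2: "\<And>x. B2 x = outer_coords (Suc r) G2 (inner_coords n (Suc r) F2 x)"
    and det: "det (core_mat n (Suc r) F2 G1) = 0"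
  shows "factors_through n r (B2 \<circ> B1)"
proof -
  from singular_mat_factorization[OF core_mat_carrier det] obtain X Y where
    XY: "\<And>a l. a < Suc r \<Longrightarrow> l < Suc r \<Longrightarrow>
      core_mat n (Suc r) F2 G1 $$ (a, l) = (\<Sum>j<r. X a j * Y j l)" by blast
  let ?G = "\<lambda>a j. \<Sum>k<Suc r. G2 a k * X k j"
  let ?F = "\<lambda>j b. \<Sum>l<Suc r. Y j l * F1 l b"
  have "B2 (B1 x) = outer_coords r ?G (inner_coords n r ?F x)" for x
  proof
    fix a
    define u where "u = inner_coords n (Suc r) F1 x"
    have u: "u $ l = (\<Sum>b<n. F1 l b * x b)" if "l < Suc r" for l
      using that by (simp add: u_def inner_coords_def)
    have "B2 (B1 x) = outer_coords (Suc r) G2 (core_mat n (Suc r) F2 G1 *\<^sub>v u)"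
      unfolding B1 B2 u_def by (subst inner_outer_coords) auto
    then have "B2 (B1 x) a = (\<Sum>k<Suc r. G2 a k * (core_mat n (Suc r) F2 G1 *\<^sub>v u) $ k)"
      by (simp add: outer_coords_def)
    also have "\<dots> = (\<Sum>k<Suc r. G2 a k * (\<Sum>l<Suc r. (\<Sum>j<r. X k j * Y j l) * u $ l))"
    proof (intro sum.cong refl arg_cong2[of _ _ _ _ "(*)"])
      fix k assume "k \<in> {..<Suc r}"
      then have k: "k < Suc r" by simp
      have "(core_mat n (Suc r) F2 G1 *\<^sub>v u) $ k
          = (\<Sum>l<Suc r. core_mat n (Suc r) F2 G1 $$ (k, l) * u $ l)"
        by (rule mult_mat_vec_index[OF core_mat_carrier _ k]) (simp add: u_def)
      also have "\<dots> = (\<Sum>l<Suc r. (\<Sum>j<r. X k j * Y j l) * u $ l)"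
        using XY k by (intro sum.cong) auto
      finally show "(core_mat n (Suc r) F2 G1 *\<^sub>v u) $ k =
        (\<Sum>l<Suc r. (\<Sum>j<r. X k j * Y j l) * u $ l)" .
    qed
    also have "\<dots> = (\<Sum>k<Suc r. \<Sum>j<r. G2 a k * X k j * (\<Sum>l<Suc r. Y j l * u $ l))"
      unfolding sum_distrib_left sum_distrib_right
      by (subst (2) sum.swap) (simp add: mult_ac)
    also have "\<dots> = (\<Sum>j<r. ?G a j * (\<Sum>l<Suc r. Y j l * u $ l))"
      unfolding sum_distrib_right by (subst sum.swap) simp
    also have "\<dots> = (\<Sum>j<r. ?G a j * (\<Sum>b<n. ?F j b * x b))"
    proof (rule sum.cong[OF refl])
      fix j
      have "(\<Sum>l<Suc r. Y j l * u $ l) = (\<Sum>l<Suc r. Y j l * (\<Sum>b<n. F1 l b * x b))"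
        using u by (intro sum.cong) auto
      also have "\<dots> = (\<Sum>b<n. ?F j b * x b)"
        unfolding sum_distrib_left sum_distrib_right by (subst sum.swap) (simp add: mult_ac)
      finally show "?G a j * (\<Sum>l<Suc r. Y j l * u $ l) = ?G a j * (\<Sum>b<n. ?F j b * x b)"
        by (rule arg_cong)
    qed
    also have "\<dots> = outer_coords r ?G (inner_coords n r ?F x) a"
      unfolding outer_coords_def inner_coords_def by (intro sum.cong) auto
    finally show "B2 (B1 x) a = outer_coords r ?G (inner_coords n r ?F x) a" .
  qed
  then show ?thesis unfolding factors_through_def comp_def by blast
qed

text \<open>Each neighbouring pair contributes an invertible core, and \<open>H\<close> is the
  product of these cores; only the first \<open>F\<close> and the last \<open>G\<close> remain
  outside.\<close>

lemma compose_seq_core: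
  assumes "\<And>q x. i \<le> q \<Longrightarrow> q \<le> i + l \<Longrightarrow> B q x = outer_coords r (G q) (inner_coords n r (F q) x)"
    and "\<And>q. i \<le> q \<Longrightarrow> q < i + l \<Longrightarrow> det (core_mat n r (F (Suc q)) (G q)) \<noteq> 0"
  shows "\<exists>H\<in>carrier_mat r r. det H \<noteq> 0 \<and>
    (\<forall>x. compose_seq B i (Suc l) x = outer_coords r (G (i + l)) (H *\<^sub>v inner_coords n r (F i) x))"
  using assms
proof (induction l)
  case 0
  then show ?case by (intro bexI[of _ "1\<^sub>m r"]) auto
next
  case (Suc l)
  then obtain H where H: "H \<in> carrier_mat r r" "det H \<noteq> 0"
    "\<And>x. compose_seq B i (Suc l) x = outer_coords r (G (i + l)) (H *\<^sub>v inner_coords n r (F i) x)"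
    by force
  let ?C = "core_mat n r (F (Suc (i + l))) (G (i + l))"
  have C: "det ?C \<noteq> 0" using Suc.prems(2)[of "i + l"] by simp
  have "compose_seq B i (Suc (Suc l)) x
      = outer_coords r (G (i + Suc l)) ((?C * H) *\<^sub>v inner_coords n r (F i) x)" for x
  proof -
    have "compose_seq B i (Suc (Suc l)) x = B (i + Suc l) (compose_seq B i (Suc l) x)" by simp
    also have "\<dots> = outer_coords r (G (i + Suc l)) (inner_coords n r (F (i + Suc l))
        (outer_coords r (G (i + l)) (H *\<^sub>v inner_coords n r (F i) x)))"
      unfolding H(3) by (rule Suc.prems(1)) auto
    also have "\<dots> = outer_coords r (G (i + Suc l)) (?C *\<^sub>v (H *\<^sub>v inner_coords n r (F i) x))"
      using H(1) by (subst inner_outer_coords) auto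
    also have "\<dots> = outer_coords r (G (i + Suc l)) ((?C * H) *\<^sub>v inner_coords n r (F i) x)"
      using H(1) by (subst assoc_mult_mat_vec[of _ r r _ r]) auto
    finally show ?thesis .
  qed
  moreover have "det (?C * H) \<noteq> 0" using C H(1,2) by (subst det_mult[of _ r]) auto
  ultimately show ?case
    using mult_carrier_mat[OF core_mat_carrier H(1)] by (intro bexI[of _ "?C * H"] conjI allI)
qed

text \<open>With \<open>v = G H F\<close> and the wrap-around core \<open>C = F G\<close>, the
  square is \<open>G H C H F\<close>. If \<open>C\<close> is invertible as well, nothing of the
  image is lost between the two passes.\<close>

lemma regular_compose_seq:
  assumes B: "\<And>q x. i \<le> q \<Longrightarrow> q \<le> i + l \<Longrightarrow> B q x = outer_coords r (G q) (inner_coords n r (F q) x)"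
    and step: "\<And>q. i \<le> q \<Longrightarrow> q < i + l \<Longrightarrow> det (core_mat n r (F (Suc q)) (G q)) \<noteq> 0"
    and wrap: "det (core_mat n r (F i) (G (i + l))) \<noteq> 0"
  shows "regular (compose_seq B i (Suc l))"
  unfolding regular_def
proof
  fix x
  from compose_seq_core[of i l B r G n F, OF B step] obtain H where
    H: "H \<in> carrier_mat r r" "det H \<noteq> 0" and
    v: "\<And>x. compose_seq B i (Suc l) x = outer_coords r (G (i + l)) (H *\<^sub>v inner_coords n r (F i) x)"
    by auto
  let ?C = "core_mat n r (F i) (G (i + l))"
  \<comment> \<open>A preimage is sought in the form \<open>y = G z\<close>. Then
    \<open>v (v y) = G H (C H C z)\<close>, so the equation to solve is
    \<open>C H C z = F x\<close>.\<close>
  let ?D = "?C * (H * ?C)"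
  have HC: "H * ?C \<in> carrier_mat r r" by (rule mult_carrier_mat[OF H(1) core_mat_carrier])
  have D: "?D \<in> carrier_mat r r" by (rule mult_carrier_mat[OF core_mat_carrier HC])
  have "det ?D \<noteq> 0"
    using H wrap by (simp add: det_mult[OF core_mat_carrier HC] det_mult[OF H(1) core_mat_carrier])
  from det_non_zero_imp_unit[OF D this, of "()"] obtain E where
    E: "E \<in> carrier_mat r r" "?D * E = 1\<^sub>m r"
    unfolding Units_def by (auto simp: ring_mat_def)
  let ?z = "E *\<^sub>v inner_coords n r (F i) x"
  have z: "?z \<in> carrier_vec r" using E by auto
  let ?y = "outer_coords r (G (i + l)) ?z"
  have "?C *\<^sub>v (H *\<^sub>v (?C *\<^sub>v ?z)) = ?D *\<^sub>v ?z"
    by (simp only: assoc_mult_mat_vec[OF H(1) core_mat_carrier z]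
        assoc_mult_mat_vec[OF core_mat_carrier HC z])
  also have "\<dots> = (?D * E) *\<^sub>v inner_coords n r (F i) x"
    by (rule assoc_mult_mat_vec[OF D E(1) inner_coords_carrier, symmetric])
  also have "\<dots> = inner_coords n r (F i) x" unfolding E(2) by (rule one_mult_mat_vec) simp
  finally have C: "?C *\<^sub>v (H *\<^sub>v (?C *\<^sub>v ?z)) = inner_coords n r (F i) x" .
  have "H *\<^sub>v (?C *\<^sub>v ?z) \<in> carrier_vec r"
    by (rule mult_mat_vec_carrier[OF H(1) mult_mat_vec_carrier[OF core_mat_carrier z]])
  then have "compose_seq B i (Suc l) (compose_seq B i (Suc l) ?y) = compose_seq B i (Suc l) x"
    unfolding v by (simp add: inner_outer_coords[OF z] inner_outer_coords C)
  then show "\<exists>y. compose_seq B i (Suc l) x = compose_seq B i (Suc l) (compose_seq B i (Suc l) y)"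
    by metis
qed

text \<open>The determinant of \<^term>\<open>core_mat n r F G\<close> is a form of degree \<open>r\<close> in the \<open>n * r\<close> entries
  of \<open>G\<close>; this replaces the exterior powers in the skew version of Bollobas' theorem.\<close>

lemma form_det_core_mat:
  "form (n * r) r (\<lambda>y. det (core_mat n r F (\<lambda>b l. y (b * r + l))))"
proof -
  have lin: "linear_form (n * r) (\<lambda>y. \<Sum>b<n. F k b * y (b * r + l))" if "l < r" for k l
    unfolding linear_form_def
  proof (intro exI allI)
    fix y :: "nat \<Rightarrow> 'a"
    show "(\<Sum>b<n. F k b * y (b * r + l)) =
      (\<Sum>a<n * r. (if a mod r = l then F k (a div r) else 0) * y a)"
      using sum_residue_class[OF that, of "\<lambda>a. F k (a div r) * y a" n] that
      by (simp add: if_distrib[where f = "\<lambda>c. c * _"] cong: if_cong)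
  qed
  have det: "det (core_mat n r F G) =
      (\<Sum>p\<in>{p. p permutes {0..<r}}. signof p * (\<Prod>k<r. \<Sum>b<n. F k b * G b (p k)))" for G
    unfolding det_def'[OF core_mat_carrier]
  proof (intro sum.cong refl arg_cong2[of _ _ _ _ "(*)"])
    fix p assume "p \<in> {p. p permutes {0..<r}}"
    then have "p k < r" if "k < r" for k using that permutes_in_image[of p "{0..<r}" k] by auto
    then show "(\<Prod>k = 0..<r. core_mat n r F G $$ (k, p k)) = (\<Prod>k<r. \<Sum>b<n. F k b * G b (p k))"
      by (simp add: core_mat_def atLeast0LessThan)
  qed
  show ?thesis unfolding det
  proof (intro form_sum form_cmult form_prod lin)
    fix p k assume "p \<in> {p. p permutes {0..<r}}" "k < r"
    then show "p k < r" using permutes_in_image[of p "{0..<r}" k] by auto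
  qed
qed

text \<open>Only a nonsingular wrap-around core is missing. The vectors of
  \<open>form_dependence\<close> are the flattened matrices \<open>G\<close>; the determinant with
  \<open>F (Suc (s + k0))\<close> is nonzero at \<open>k0\<close>, because these two maps are
  neighbours, hence also at a later \<open>k\<close>. The maps from \<open>Suc (s + k0)\<close> to
  \<open>s + k\<close> then close up.\<close>

lemma regular_factor_of_nonsingular_cores:
  assumes B: "\<And>q x. s \<le> q \<Longrightarrow> q \<le> Suc (s + M) \<Longrightarrow>
      B q x = outer_coords r (G q) (inner_coords n r (F q) x)"
    and step: "\<And>q. s \<le> q \<Longrightarrow> q \<le> s + M \<Longrightarrow> det (core_mat n r (F (Suc q)) (G q)) \<noteq> 0"
    and M: "(n * r) ^ r \<le> M"
  shows "\<exists>i l. s \<le> i \<and> i + l \<le> s + M \<and> regular (compose_seq B i (Suc l))"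
proof -
  have core: "core_mat n r F' (\<lambda>b l. (\<lambda>a. G' (a div r) (a mod r)) (b * r + l)) = core_mat n r F' G'"
    for F' G' :: "nat \<Rightarrow> nat \<Rightarrow> 'a"
    unfolding core_mat_def by (intro eq_matI) auto
  from form_dependence[OF M, of "\<lambda>k a. G (s + k) (a div r) (a mod r)"] obtain k0 where
    k0: "k0 \<le> M" and dep: "\<And>g. form (n * r) r g \<Longrightarrow> g (\<lambda>a. G (s + k0) (a div r) (a mod r)) \<noteq> 0 \<Longrightarrow>
      \<exists>k. k0 < k \<and> k \<le> M \<and> g (\<lambda>a. G (s + k) (a div r) (a mod r)) \<noteq> 0"
    by blast
  let ?i = "Suc (s + k0)"
  have "det (core_mat n r (F ?i) (G (s + k0))) \<noteq> 0" using step[of "s + k0"] k0 by simp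
  then obtain k where k: "k0 < k" "k \<le> M" "det (core_mat n r (F ?i) (G (s + k))) \<noteq> 0"
    using dep[OF form_det_core_mat[of n r "F ?i"]] unfolding core by blast
  have "regular (compose_seq B ?i (Suc (k - Suc k0)))"
  proof (rule regular_compose_seq)
    show "B q x = outer_coords r (G q) (inner_coords n r (F q) x)"
      if "?i \<le> q" "q \<le> ?i + (k - Suc k0)" for q x using that k by (intro B) auto
    show "det (core_mat n r (F (Suc q)) (G q)) \<noteq> 0"
      if "?i \<le> q" "q < ?i + (k - Suc k0)" for q using that k by (intro step) auto
    show "det (core_mat n r (F ?i) (G (?i + (k - Suc k0)))) \<noteq> 0" using k by simp
  qed
  then show ?thesis using k by (intro exI[of _ ?i] exI[of _ "k - Suc k0"]) auto
qed

section \<open>Jacob's lemma, by induction on the rank\<close>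

text \<open>A block of this many maps, all of rank at most \<open>r \<le> n\<close>, has
  \<open>M + 1\<close> neighbouring pairs for an \<open>M\<close> of at least
  \<open>(n * r) ^ r\<close>; this explains the summand 2. The power is taken at
  \<open>r = n\<close> so as to serve all ranks.\<close>

definition factor_bound :: "nat \<Rightarrow> nat" where
  "factor_bound n = (n * n) ^ n + 2"

lemma power_le_factor_bound: "r \<le> n \<Longrightarrow> (n * r) ^ r + 2 \<le> factor_bound n"
proof (cases "n = 0")
  case False
  assume "r \<le> n"
  then have "(n * r) ^ r \<le> (n * n) ^ r" by (intro power_mono) auto
  also have "\<dots> \<le> (n * n) ^ n" using \<open>r \<le> n\<close> False by (intro power_increasing) auto
  finally show ?thesis by (simp add: factor_bound_def)
qed (auto simp: factor_bound_def)

text \<open>A dichotomy for \<open>m ^ Suc r\<close> maps cut into \<open>m ^ r\<close> blocks of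
  length \<open>m\<close>. Either some block has only nonsingular neighbouring cores and contains a
  regular factor, or every block contains a singular core. In that case all block products have rank
  at most \<open>r\<close>, and the induction hypothesis applies to them.\<close>

lemma regular_factor_exists:
  assumes "r \<le> n" "\<And>q. q < factor_bound n ^ r \<Longrightarrow> factors_through n r (B q)"
  shows "\<exists>i l. i + l < factor_bound n ^ r \<and> regular (compose_seq B i (Suc l))"
  using assms
proof (induction r arbitrary: B)
  case 0
  then have "factors_through n 0 (B 0)" by simp
  \<comment> \<open>Rank zero: the map is zero, and a constant map is regular.\<close>
  then have "B 0 x = (\<lambda>a. 0)" for x
    unfolding factors_through_def outer_coords_def by auto
  then have "regular (compose_seq B 0 (Suc 0))" unfolding regular_def by simp
  then show ?case by (intro exI[of _ 0]) auto
next
  case (Suc r)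
  let ?m = "factor_bound n"
  have "\<forall>q<?m ^ Suc r. \<exists>G F. \<forall>x. B q x = outer_coords (Suc r) G (inner_coords n (Suc r) F x)"
    using Suc.prems(2) unfolding factors_through_def by blast
  then obtain G F where B: "\<And>q x. q < ?m ^ Suc r \<Longrightarrow>
      B q x = outer_coords (Suc r) (G q) (inner_coords n (Suc r) (F q) x)" by metis
  have m2: "(n * Suc r) ^ Suc r + 2 \<le> ?m" using power_le_factor_bound Suc.prems(1) by blast
  have group: "Suc g * ?m \<le> ?m ^ Suc r" if "g < ?m ^ r" for g
    using mult_right_mono[of "Suc g" "?m ^ r" ?m] that by (simp add: mult.commute)
  show ?case
  proof (cases "\<exists>g<?m ^ r. \<forall>q. g * ?m \<le> q \<and> Suc q < Suc g * ?m \<longrightarrow>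
      det (core_mat n (Suc r) (F (Suc q)) (G q)) \<noteq> 0")
    case True
    then obtain g where g: "g < ?m ^ r" and det: "\<And>q. g * ?m \<le> q \<Longrightarrow> Suc q < Suc g * ?m \<Longrightarrow>
      det (core_mat n (Suc r) (F (Suc q)) (G q)) \<noteq> 0" by blast
    have "\<exists>i l. g * ?m \<le> i \<and> i + l \<le> g * ?m + (?m - 2) \<and> regular (compose_seq B i (Suc l))"
    proof (rule regular_factor_of_nonsingular_cores)
      show "B q x = outer_coords (Suc r) (G q) (inner_coords n (Suc r) (F q) x)"
        if "g * ?m \<le> q" "q \<le> Suc (g * ?m + (?m - 2))" for q x
        using that m2 group[OF g] by (intro B) auto
      show "det (core_mat n (Suc r) (F (Suc q)) (G q)) \<noteq> 0"
        if "g * ?m \<le> q" "q \<le> g * ?m + (?m - 2)" for q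
        using that m2 by (intro det) auto
      show "(n * Suc r) ^ Suc r \<le> ?m - 2" using m2 by simp
    qed
    then obtain i l where "i + l \<le> g * ?m + (?m - 2)" "regular (compose_seq B i (Suc l))" by blast
    moreover from this(1) have "i + l < ?m ^ Suc r" using group[OF g] m2 by auto
    ultimately show ?thesis by blast
  next
    case False
    let ?B = "\<lambda>g. compose_seq B (g * ?m) ?m"
    have lin: "linear_endo n (B q)" if "q < ?m ^ Suc r" for q
      using that Suc.prems(2) factors_through_linear by blast
    have "factors_through n r (?B g)" if g: "g < ?m ^ r" for g
    proof -
      from False g obtain q where q: "g * ?m \<le> q" "Suc q < Suc g * ?m"
        "det (core_mat n (Suc r) (F (Suc q)) (G q)) = 0" by blast
      have "factors_through n r (B (Suc q) \<circ> B q)"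
        using q group[OF g] by (intro singular_core_factors_through[OF B B]) auto
      moreover have "compose_seq B q 2 = B (Suc q) \<circ> B q"
        by (simp add: numeral_2_eq_2)
      ultimately have f2: "factors_through n r (compose_seq B q 2)" by simp
      \<comment> \<open>In its block the singular pair has \<open>a\<close> maps before it and
        \<open>b\<close> maps after it. Either side may be empty, and an empty product is not a
        \<open>linear_endo\<close>, hence the case distinctions.\<close>
      define a where "a = q - g * ?m"
      define b where "b = ?m - a - 2"
      have q_a: "q = g * ?m + a" using q by (simp add: a_def)
      have m_ab: "?m = a + 2 + b" using q by (simp add: a_def b_def)
      have fa: "factors_through n r (compose_seq B (g * ?m) (a + 2))"
      proof (cases a)
        case 0
        then show ?thesis using f2 q_a by (simp add: numeral_2_eq_2)
      next
        case (Suc a')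
        have "linear_endo n (compose_seq B (g * ?m) (Suc a'))"
        proof (rule linear_compose_seq)
          show "linear_endo n (B k)" if "g * ?m \<le> k" "k < g * ?m + Suc a'" for k
            using that Suc q_a q group[OF g] by (intro lin) linarith
        qed
        from factors_through_comp_right[OF this f2] show ?thesis
          unfolding compose_seq_add q_a Suc .
      qed
      show ?thesis
      proof (cases b)
        case 0
        then show ?thesis using fa m_ab by simp
      next
        case (Suc b')
        have "linear_endo n (compose_seq B (g * ?m + (a + 2)) (Suc b'))"
        proof (rule linear_compose_seq)
          show "linear_endo n (B k)"
            if "g * ?m + (a + 2) \<le> k" "k < g * ?m + (a + 2) + Suc b'" for k
            using that Suc m_ab group[OF g] by (intro lin) auto
        qed
        from factors_through_comp_left[OF this fa]
        have "factors_through n r (compose_seq B (g * ?m) (a + 2 + b))"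
          unfolding Suc compose_seq_add[of B "g * ?m" "a + 2" "Suc b'"] .
        then show ?thesis using m_ab by metis
      qed
    qed
    with Suc.prems(1) have "\<exists>i l. i + l < ?m ^ r \<and> regular (compose_seq ?B i (Suc l))"
      by (intro Suc.IH) auto
    then obtain i l where il: "i + l < ?m ^ r" "regular (compose_seq ?B i (Suc l))" by blast
    have "0 < ?m" by (simp add: factor_bound_def)
    then obtain l' where l': "Suc l * ?m = Suc l'" by (metis Suc_pred nat_0_less_mult_iff zero_less_Suc)
    have "regular (compose_seq B (i * ?m) (Suc l'))"
      using il(2) unfolding compose_seq_group l' .
    moreover have "i * ?m + l' < ?m ^ Suc r"
    proof -
      have "i * ?m + Suc l' = Suc (i + l) * ?m" using l' by (simp add: algebra_simps)
      also have "\<dots> \<le> ?m ^ Suc r" using group il(1) by blast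
      finally show ?thesis by simp
    qed
    ultimately show ?thesis by blast
  qed
qed

section \<open>Infinitely many bad states\<close>

lemma form_comp_funpow:
  assumes "form n T g" "linear_endo n v"
  shows "form n T (\<lambda>x. g ((v ^^ e) x))"
  using assms(1)
proof (induction e arbitrary: g)
  case (Suc e)
  from Suc.IH[OF form_comp[OF Suc.prems assms(2)]] show ?case by simp
qed simp

text \<open>Stands in for the invertibility of \<open>v\<close> on its image: orbits in the image
  extend backwards as far as desired.\<close>

lemma regular_funpow_preimage:
  assumes "regular v"
  shows "\<exists>z. v x = (v ^^ Suc k) z"
proof (induction k)
  case (Suc k)
  then obtain z where "v x = (v ^^ Suc k) z" by blast
  moreover obtain z' where "v z = v (v z')" using assms unfolding regular_def by blast
  ultimately have "v x = (v ^^ Suc (Suc k)) z'" by (simp add: funpow_swap1)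
  then show ?case by blast
qed (intro exI[of _ x], simp)

text \<open>The relation between the tensor powers of the first \<open>D + 1\<close> iterates is
  carried along by \<open>v\<close>, so nonvanishing at step \<open>k\<close> forces nonvanishing at
  a later step, provided that \<open>k \<ge> k0\<close>. Regularity supplies the room: it provides a
  starting point \<open>z\<close> that lies \<open>D\<close> steps before
  \<open>v x\<close>.\<close>

lemma regular_form_nonzero_recurs:
  fixes v :: "(nat \<Rightarrow> 'a::field) \<Rightarrow> nat \<Rightarrow> 'a"
  assumes v: "linear_endo n v" "regular v" and g: "form n T g" and nz: "g (v x) \<noteq> 0"
  shows "\<exists>k\<ge>K. g ((v ^^ k) x) \<noteq> 0"
proof -
  define D where "D = n ^ T"
  from regular_funpow_preimage[OF v(2), of x D] obtain z0 where "v x = (v ^^ Suc D) z0" by blast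
  then obtain z where z: "v x = (v ^^ D) z" by (metis comp_apply funpow_Suc_right)
  from form_dependence[of n T D "\<lambda>k. (v ^^ k) z"] obtain k0 where k0: "k0 \<le> D"
    and dep: "\<And>g. form n T g \<Longrightarrow> g ((v ^^ k0) z) \<noteq> 0 \<Longrightarrow> \<exists>k. k0 < k \<and> k \<le> D \<and> g ((v ^^ k) z) \<noteq> 0"
    unfolding D_def by blast
  have "\<exists>k\<ge>D + K. g ((v ^^ k) z) \<noteq> 0"
  proof (induction K)
    case 0
    then show ?case using nz z by (intro exI[of _ D]) simp
  next
    case (Suc K)
    then obtain k where k: "k \<ge> D + K" "g ((v ^^ k) z) \<noteq> 0" by blast
    \<comment> \<open>The relation that starts at \<open>k0\<close> is shifted by \<open>e\<close>
      so that it starts at \<open>k\<close>; on the side of the form this is composition with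
      \<open>v ^^ e\<close>.\<close>
    define e where "e = k - k0"
    have e: "k = e + k0" using k k0 by (simp add: e_def)
    have "g ((v ^^ e) ((v ^^ k0) z)) \<noteq> 0" using k(2) unfolding e funpow_add by simp
    from dep[OF form_comp_funpow[OF g v(1), of e] this] obtain k' where
      "k0 < k'" "g ((v ^^ e) ((v ^^ k') z)) \<noteq> 0" by blast
    then show ?case using e k(1) by (intro exI[of _ "e + k'"]) (simp add: funpow_add)
  qed
  then obtain k where k: "k \<ge> D + K" "g ((v ^^ k) z) \<noteq> 0" by blast
  have "(v ^^ k) z = (v ^^ (k - D)) ((v ^^ D) z)"
    using k(1) by (metis add_leD1 comp_apply funpow_add le_add_diff_inverse2)
  also have "\<dots> = (v ^^ Suc (k - D)) x" unfolding z[symmetric] by (simp add: funpow_swap1)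
  finally show ?thesis using k by (intro exI[of _ "Suc (k - D)"]) auto
qed

section \<open>Many bad states against infinitely many in a linear system\<close>

text \<open>\<open>n\<close> is the dimension, \<open>m\<close> the number of letters,
  \<open>t\<close> the number of disjuncts and \<open>s\<close> the number of linear equations that
  define one disjunct.\<close>

locale linear_system =
  fixes n m t s :: nat
    and A :: "nat \<Rightarrow> (nat \<Rightarrow> 'a::field) \<Rightarrow> nat \<Rightarrow> 'a"
    and test :: "nat \<Rightarrow> nat \<Rightarrow> (nat \<Rightarrow> 'a) \<Rightarrow> 'a"
    and x0 :: "nat \<Rightarrow> 'a"
  assumes linear_step: "\<And>a. a < m \<Longrightarrow> linear_endo n (A a)"
    and linear_test: "\<And>i q. linear_form n (test i q)"
begin

definition bad :: "(nat \<Rightarrow> 'a) \<Rightarrow> bool" where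
  "bad x \<longleftrightarrow> (\<forall>i<t. \<exists>q<s. test i q x \<noteq> 0)"

primrec state :: "(nat \<Rightarrow> nat) \<Rightarrow> nat \<Rightarrow> nat \<Rightarrow> 'a" where
  "state w 0 = x0"
| "state w (Suc j) = A (w j) (state w j)"

text \<open>Asserts future visits without fixing the words beyond the next one, so that segments can
  be shortened one at a time.\<close>

primrec reach :: "nat \<Rightarrow> (nat \<Rightarrow> 'a) \<Rightarrow> bool" where
  "reach 0 x \<longleftrightarrow> True"
| "reach (Suc k) x \<longleftrightarrow>
    (\<exists>ws. ws \<noteq> [] \<and> set ws \<subseteq> {..<m} \<and> bad (fold A ws x) \<and> reach k (fold A ws x))"

primrec reach_short :: "nat \<Rightarrow> nat \<Rightarrow> (nat \<Rightarrow> 'a) \<Rightarrow> bool" where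
  "reach_short K 0 x \<longleftrightarrow> True"
| "reach_short K (Suc k) x \<longleftrightarrow> (\<exists>ws. ws \<noteq> [] \<and> length ws \<le> K \<and> set ws \<subseteq> {..<m} \<and>
    bad (fold A ws x) \<and> reach_short K k (fold A ws x))"

lemma linear_fold:
  assumes "ws \<noteq> []" "set ws \<subseteq> {..<m}"
  shows "linear_endo n (fold A ws)"
  using assms
proof (induction ws)
  case (Cons a ws)
  then have a: "linear_endo n (A a)" using linear_step by auto
  show ?case
  proof (cases ws)
    case Nil
    then show ?thesis using a by simp
  next
    case (Cons b us)
    then have "linear_endo n (fold A ws)" by (intro Cons.IH) (use Cons.prems in auto)
    from linear_endo_comp[OF this a] show ?thesis by (simp only: fold.simps)
  qed
qed simp

lemma form_fold:
  assumes "form n T g" "set ws \<subseteq> {..<m}"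
  shows "form n T (\<lambda>x. g (fold A ws x))"
  using assms form_comp[OF assms(1) linear_fold[of ws]] by (cases "ws = []") auto

text \<open>Each disjunct is refuted at \<open>y\<close> by some test; the product of these
  \<open>t\<close> tests certifies badness near and far, though the choice depends on
  \<open>y\<close>. The factor \<open>h\<close> lets a certificate for the further future ride
  along.\<close>

lemma bad_form:
  assumes "bad y" "form n T h"
  obtains g where "form n (t + T) g" "g y = 0 \<longleftrightarrow> h y = 0"
    "\<And>z. g z \<noteq> 0 \<Longrightarrow> bad z \<and> h z \<noteq> 0"
proof -
  from assms(1) obtain q where q: "\<And>i. i < t \<Longrightarrow> q i < s \<and> test i (q i) y \<noteq> 0"
    unfolding bad_def by metis
  show thesis
  proof (rule that[of "\<lambda>x. (\<Prod>i<t. test i (q i) x) * h x"])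
    show "form n (t + T) (\<lambda>x. (\<Prod>i<t. test i (q i) x) * h x)"
      by (intro form_prod_mult linear_test assms(2))
    show "(\<Prod>i<t. test i (q i) y) * h y = 0 \<longleftrightarrow> h y = 0" using q by simp
    show "bad z \<and> h z \<noteq> 0" if "(\<Prod>i<t. test i (q i) z) * h z \<noteq> 0" for z
      using that q unfolding bad_def by auto
  qed
qed

text \<open>Certificates are pulled back along segments and multiplied. The pull-back keeps the
  degree, and every visit adds \<open>t\<close> to it.\<close>

lemma reach_form:
  assumes "reach k x"
  shows "\<exists>g. form n (t * k) g \<and> g x \<noteq> 0 \<and> (\<forall>z. g z \<noteq> 0 \<longrightarrow> reach k z)"
  using assms
proof (induction k arbitrary: x)
  case 0
  then show ?case using form_const[of n 1] by auto
next
  case (Suc k)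
  then obtain ws where ws: "ws \<noteq> []" "set ws \<subseteq> {..<m}" "bad (fold A ws x)" "reach k (fold A ws x)"
    by auto
  from Suc.IH[OF ws(4)] obtain h where h: "form n (t * k) h" "h (fold A ws x) \<noteq> 0"
    "\<And>z. h z \<noteq> 0 \<Longrightarrow> reach k z" by blast
  from bad_form[OF ws(3) h(1)] obtain g where g: "form n (t + t * k) g"
    "g (fold A ws x) = 0 \<longleftrightarrow> h (fold A ws x) = 0" "\<And>z. g z \<noteq> 0 \<Longrightarrow> bad z \<and> h z \<noteq> 0" by blast
  have "form n (t * Suc k) (\<lambda>x. g (fold A ws x))" using form_fold[OF g(1) ws(2)] by simp
  moreover have "reach (Suc k) z" if "g (fold A ws z) \<noteq> 0" for z
    using g(3)[OF that] h(3) ws(1,2) by auto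
  ultimately show ?case using g(2) h(2) by (intro exI[of _ "\<lambda>x. g (fold A ws x)"]) auto
qed

text \<open>In a shortest segment that is longer than \<open>K\<close>, the states after the first
  letter are more than \<open>n ^ (t * Suc k)\<close> in number. One of them can be replaced by an
  earlier one while the certificate of badness and of \<open>reach k\<close> at the end stays
  nonzero, which yields a shorter segment.\<close>

lemma short_segment:
  assumes x: "reach (Suc k) x" and K: "n ^ (t * Suc k) \<le> K"
  shows "\<exists>ws. ws \<noteq> [] \<and> length ws \<le> K \<and> set ws \<subseteq> {..<m} \<and> bad (fold A ws x) \<and> reach k (fold A ws x)"
proof -
  define S where "S = (\<lambda>ws. ws \<noteq> [] \<and> set ws \<subseteq> {..<m} \<and> bad (fold A ws x) \<and> reach k (fold A ws x))"
  from x have "\<exists>ws. S ws" unfolding S_def by simp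
  then obtain ws where ws: "S ws" and min: "\<And>us. S us \<Longrightarrow> length ws \<le> length us"
    by (metis arg_min_natI arg_min_nat_le)
  have "length ws \<le> K"
  proof (rule ccontr)
    assume long: "\<not> length ws \<le> K"
    then obtain a us where ws_eq: "ws = a # us" by (cases ws) auto
    define M where "M = length us"
    have M: "n ^ (t * Suc k) \<le> M" using long K by (simp add: ws_eq M_def)
    have us: "set us \<subseteq> {..<m}" and a: "a < m" using ws by (auto simp: S_def ws_eq)
    have y: "bad (fold A ws x)" "reach k (fold A ws x)" using ws by (auto simp: S_def)
    from reach_form[OF y(2)] obtain h where h: "form n (t * k) h" "h (fold A ws x) \<noteq> 0"
      "\<And>z. h z \<noteq> 0 \<Longrightarrow> reach k z" by blast
    from bad_form[OF y(1) h(1)] obtain g where g: "form n (t + t * k) g"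
      "g (fold A ws x) = 0 \<longleftrightarrow> h (fold A ws x) = 0" "\<And>z. g z \<noteq> 0 \<Longrightarrow> bad z \<and> h z \<noteq> 0" by blast
    \<comment> \<open>Prefixes are listed by decreasing length, so a later index means an earlier
      state. The first letter is kept out of the list, hence the shortened word is nonempty.\<close>
    from form_dependence[OF M, of "\<lambda>j. fold A (take (M - j) us) (A a x)"] obtain k0 where
      k0: "k0 \<le> M" and dep: "\<And>g. form n (t * Suc k) g \<Longrightarrow>
        g (fold A (take (M - k0) us) (A a x)) \<noteq> 0 \<Longrightarrow>
        \<exists>j. k0 < j \<and> j \<le> M \<and> g (fold A (take (M - j) us) (A a x)) \<noteq> 0" by blast
    let ?d = "drop (M - k0) us"
    have d: "set ?d \<subseteq> {..<m}" using us set_drop_subset[of "M - k0" us] by blast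
    have "form n (t * Suc k) (\<lambda>x. g (fold A ?d x))" using form_fold[OF g(1) d] by simp
    moreover have "g (fold A ?d (fold A (take (M - k0) us) (A a x))) \<noteq> 0"
    proof -
      have "fold A ?d (fold A (take (M - k0) us) (A a x)) = fold A (take (M - k0) us @ ?d) (A a x)"
        by (simp only: fold_append comp_apply)
      then show ?thesis using g(2) h(2) by (simp add: ws_eq)
    qed
    ultimately obtain j where j: "k0 < j" "j \<le> M"
      "g (fold A ?d (fold A (take (M - j) us) (A a x))) \<noteq> 0" using dep by blast
    let ?us = "a # take (M - j) us @ ?d"
    have "g (fold A ?us x) \<noteq> 0" using j(3) by simp
    moreover have "set ?us \<subseteq> {..<m}" using a d us set_take_subset[of "M - j" us] by auto
    ultimately have "S ?us" using g(3) h(3) unfolding S_def by blast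
    from min[OF this] j k0 show False by (simp add: ws_eq M_def)
  qed
  then show ?thesis using ws unfolding S_def by blast
qed

text \<open>The base \<open>Suc n\<close> makes the bound monotone in the exponent for
  \<open>n = 0\<close> too, where \<open>0 ^ 0 = 1\<close> would exceed higher powers.\<close>

lemma reach_imp_reach_short:
  assumes "reach k x" "k \<le> N"
  shows "reach_short (Suc n ^ (t * N)) k x"
  using assms
proof (induction k arbitrary: x)
  case (Suc k)
  have "n ^ (t * Suc k) \<le> Suc n ^ (t * Suc k)" by (intro power_mono) auto
  also have "\<dots> \<le> Suc n ^ (t * N)" using Suc.prems(2) by (intro power_increasing mult_left_mono) auto
  finally obtain ws where "ws \<noteq> []" "length ws \<le> Suc n ^ (t * N)" "set ws \<subseteq> {..<m}"
    "bad (fold A ws x)" "reach k (fold A ws x)" using short_segment[OF Suc.prems(1)] by blast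
  then show ?case using Suc by auto
qed simp

lemma reach_short_word:
  assumes "reach_short K k x"
  shows "\<exists>ws. set ws \<subseteq> {..<m} \<and> length ws \<le> k * K \<and>
    k \<le> card {j. 0 < j \<and> j \<le> length ws \<and> bad (fold A (take j ws) x)}"
  using assms
proof (induction k arbitrary: x)
  case 0
  then show ?case by (intro exI[of _ "[]"]) auto
next
  case (Suc k)
  then obtain ws where ws: "ws \<noteq> []" "length ws \<le> K" "set ws \<subseteq> {..<m}" "bad (fold A ws x)"
    "reach_short K k (fold A ws x)" by auto
  let ?y = "fold A ws x"
  from Suc.IH[OF ws(5)] obtain us where us: "set us \<subseteq> {..<m}" "length us \<le> k * K"
    "k \<le> card {j. 0 < j \<and> j \<le> length us \<and> bad (fold A (take j us) ?y)}" by blast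
  let ?S = "{j. 0 < j \<and> j \<le> length us \<and> bad (fold A (take j us) ?y)}"
  let ?T = "{j. 0 < j \<and> j \<le> length (ws @ us) \<and> bad (fold A (take j (ws @ us)) x)}"
  have fin: "finite ?S" by (rule finite_subset[of _ "{..length us}"]) auto
  \<comment> \<open>Positions are counted from 1, so the end of the first segment differs from all
    shifted positions.\<close>
  have sub: "insert (length ws) ((+) (length ws) ` ?S) \<subseteq> ?T" using ws by auto
  have "Suc (card ?S) = card (insert (length ws) ((+) (length ws) ` ?S))"
    using fin by (subst card_insert_disjoint) (auto simp: card_image)
  also have "\<dots> \<le> card ?T"
    by (rule card_mono[OF _ sub], rule finite_subset[of _ "{..length (ws @ us)}"]) auto
  finally show ?case using us ws by (intro exI[of _ "ws @ us"]) auto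
qed

lemma state_fold: "j \<le> j' \<Longrightarrow> state w j' = fold A (map w [j..<j']) (state w j)"
  by (induction rule: dec_induct) auto

lemma state_cong:
  "(\<And>i. i < j \<Longrightarrow> w i = w' i) \<Longrightarrow> state w j = state w' j"
  by (induction j) auto

lemma infinitely_bad_imp_reach:
  assumes w: "\<And>i. w i < m" and inf: "\<And>J. \<exists>j\<ge>J. bad (state w j)"
  shows "reach k (state w j)"
proof (induction k arbitrary: j)
  case (Suc k)
  from inf[of "Suc j"] obtain j' where j': "j' > j" "bad (state w j')" by (auto simp: Suc_le_eq)
  have "fold A (map w [j..<j']) (state w j) = state w j'" using state_fold[of j j' w] j'(1) by simp
  then show ?case using w j' Suc[of j']
    unfolding reach.simps by (intro exI[of _ "map w [j..<j']"]) auto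
qed simp

text \<open>\<open>N + 1\<close> bad positions enclose \<open>N\<close> maps, to which Jacob's lemma
  applies with the trivial rank bound \<open>n\<close>. The regular factor ends in a bad state, and
  a certificate of its badness is nonzero at infinitely many further powers.\<close>

lemma many_bad_imp_infinitely_bad:
  assumes w: "\<And>i. w i < m"
    and many: "factor_bound n ^ n + 1 \<le> card {j. 0 < j \<and> j \<le> L \<and> bad (state w j)}"
  shows "\<exists>w'. (\<forall>i. w' i < m) \<and> (\<forall>J. \<exists>j\<ge>J. bad (state w' j))"
proof -
  let ?N = "factor_bound n ^ n"
  let ?S = "{j. 0 < j \<and> j \<le> L \<and> bad (state w j)}"
  have fin: "finite ?S" by (rule finite_subset[of _ "{..L}"]) auto
  define p where "p = (\<lambda>q. sorted_list_of_set ?S ! q)"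
  have len: "length (sorted_list_of_set ?S) = card ?S" by simp
  have p_bad: "bad (state w (p q))" if "q \<le> ?N" for q
  proof -
    have "p q \<in> set (sorted_list_of_set ?S)" unfolding p_def using that many len by (intro nth_mem) linarith
    then show ?thesis using fin by simp
  qed
  have p_less: "p q < p q'" if "q < q'" "q' \<le> ?N" for q q'
  proof -
    have "sorted_wrt (<) (sorted_list_of_set ?S)" by (rule strict_sorted_list_of_set)
    from sorted_wrt_nth_less[OF this that(1)] show ?thesis
      unfolding p_def using that(2) many len by linarith
  qed
  define B where "B = (\<lambda>q. fold A (map w [p q..<p (Suc q)]))"
  have "factors_through n n (B q)" if "q < ?N" for q
    unfolding B_def using p_less[of q "Suc q"] that w
    by (intro linear_factors_through linear_fold) auto
  then obtain i l where il: "i + l < ?N" "regular (compose_seq B i (Suc l))"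
    using regular_factor_exists[of n n B] by auto
  have comp: "compose_seq B i l' = fold A (map w [p i..<p (i + l')])" if "i + l' \<le> ?N" for l'
    using that
  proof (induction l')
    case 0
    then show ?case by (simp add: fun_eq_iff)
  next
    case (Suc l')
    have le: "p i \<le> p (i + l')" using p_less[of i "i + l'"] Suc.prems by (cases l') auto
    have less: "p (i + l') < p (i + Suc l')" using p_less Suc.prems by simp
    have "[p i..<p (i + Suc l')] = [p i..<p (i + l')] @ [p (i + l')..<p (i + Suc l')]"
      using upt_add_eq_append[OF le, of "p (i + Suc l') - p (i + l')"] less by simp
    then show ?case using Suc by (simp add: B_def)
  qed
  define a where "a = p i"
  define b where "b = p (i + Suc l)"
  have ab: "a < b" unfolding a_def b_def using il p_less by simp
  define v where "v = fold A (map w [a..<b])"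
  have "compose_seq B i (Suc l) = v" unfolding v_def a_def b_def using comp[of "Suc l"] il(1) by simp
  then have reg: "regular v" using il(2) by simp
  have lin: "linear_endo n v" unfolding v_def using ab w by (intro linear_fold) auto
  have "v (state w a) = state w b" unfolding v_def using state_fold[of a b w] ab by simp
  moreover have "bad (state w b)" unfolding b_def using p_bad il by simp
  ultimately have "bad (v (state w a))" by simp
  from bad_form[OF this form_const[of n 1]] obtain g where g: "form n (t + 0) g"
    "g (v (state w a)) \<noteq> 0" "\<And>z. g z \<noteq> 0 \<Longrightarrow> bad z" by auto
  \<comment> \<open>Ultimately periodic word: up to \<open>a\<close> as before, afterwards the
    letters of \<open>v\<close> forever.\<close>
  define w' where "w' = (\<lambda>j. if j < a then w j else w (a + (j - a) mod (b - a)))"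
  have st_a: "state w' j = state w j" if "j \<le> a" for j
    using that by (induction j) (auto simp: w'_def)
  have st: "state w' (a + k * (b - a)) = (v ^^ k) (state w a)" for k
  proof (induction k)
    case 0
    then show ?case using st_a by simp
  next
    case (Suc k)
    let ?c = "a + k * (b - a)"
    have "map w' [?c..<?c + (b - a)] = map w [a..<b]"
    proof (rule nth_equalityI)
      fix j assume "j < length (map w' [?c..<?c + (b - a)])"
      then have "j < b - a" by simp
      then show "map w' [?c..<?c + (b - a)] ! j = map w [a..<b] ! j" by (simp add: w'_def)
    qed simp
    then have "state w' (?c + (b - a)) = v (state w' ?c)"
      using state_fold[of ?c "?c + (b - a)" w'] by (simp add: v_def)
    moreover have "?c + (b - a) = a + Suc k * (b - a)" by simp
    ultimately show ?case using Suc by simp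
  qed
  have "\<exists>j\<ge>J. bad (state w' j)" for J
  proof -
    from regular_form_nonzero_recurs[OF lin reg g(1,2), of J] obtain k
      where k: "k \<ge> J" "g ((v ^^ k) (state w a)) \<noteq> 0" by blast
    have "k * 1 \<le> k * (b - a)" using ab by (intro mult_left_mono) auto
    then have "J \<le> a + k * (b - a)" using k(1) by linarith
    then show ?thesis using g(3)[OF k(2)] st by metis
  qed
  moreover have "w' i < m" for i using w by (simp add: w'_def)
  ultimately show ?thesis by blast
qed

definition bad_count_bound :: nat where
  "bad_count_bound = factor_bound n ^ n + 1"

text \<open>Number of segments times their length; the certificates involved have degree at most
  \<open>t * bad_count_bound\<close>.\<close>

definition word_length_bound :: nat where
  "word_length_bound = bad_count_bound * Suc n ^ (t * bad_count_bound)"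

theorem infinitely_bad_iff:
  "(\<exists>w. (\<forall>i. w i < m) \<and> (\<forall>J. \<exists>j\<ge>J. bad (state w j))) \<longleftrightarrow>
   (\<exists>w. (\<forall>i. w i < m) \<and>
     bad_count_bound \<le> card {j. 0 < j \<and> j \<le> word_length_bound \<and> bad (state w j)})"
proof
  assume "\<exists>w. (\<forall>i. w i < m) \<and> (\<forall>J. \<exists>j\<ge>J. bad (state w j))"
  then obtain w where w: "\<And>i. w i < m" and inf: "\<And>J. \<exists>j\<ge>J. bad (state w j)" by blast
  let ?N = bad_count_bound
  have "reach ?N x0" using infinitely_bad_imp_reach[of w ?N 0, OF w inf] by simp
  from reach_short_word[OF reach_imp_reach_short[OF this order_refl]] obtain ws where
    ws: "set ws \<subseteq> {..<m}" "length ws \<le> word_length_bound"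
      "?N \<le> card {j. 0 < j \<and> j \<le> length ws \<and> bad (fold A (take j ws) x0)}"
    unfolding word_length_bound_def by blast
  \<comment> \<open>Words are infinite, but letters after \<open>ws\<close> do not influence the
    count on \<open>ws\<close>; they are borrowed from \<open>w\<close>.\<close>
  define u where "u = (\<lambda>j. if j < length ws then ws ! j else w j)"
  have "ws ! i \<in> {..<m}" if "i < length ws" for i using ws(1) nth_mem[OF that] by blast
  then have u: "u i < m" for i using w by (simp add: u_def)
  have st: "state u j = fold A (take j ws) x0" if "j \<le> length ws" for j
  proof -
    have "map u [0..<j] = take j ws" using that by (intro nth_equalityI) (auto simp: u_def)
    then show ?thesis using state_fold[of 0 j u] by simp
  qed
  have "card {j. 0 < j \<and> j \<le> length ws \<and> bad (fold A (take j ws) x0)}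
      \<le> card {j. 0 < j \<and> j \<le> word_length_bound \<and> bad (state u j)}"
    by (rule card_mono) (use st ws(2) in auto)
  then show "\<exists>w. (\<forall>i. w i < m) \<and>
      ?N \<le> card {j. 0 < j \<and> j \<le> word_length_bound \<and> bad (state w j)}"
    using u ws(3) by (intro exI[of _ u]) auto
next
  assume "\<exists>w. (\<forall>i. w i < m) \<and>
     bad_count_bound \<le> card {j. 0 < j \<and> j \<le> word_length_bound \<and> bad (state w j)}"
  then show "\<exists>w. (\<forall>i. w i < m) \<and> (\<forall>J. \<exists>j\<ge>J. bad (state w j))"
    using many_bad_imp_infinitely_bad unfolding bad_count_bound_def by blast
qed

end

section \<open>Supports of positive matrices\<close>

definition hermitian :: "nat \<Rightarrow> complex mat \<Rightarrow> bool" where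
  "hermitian d A \<longleftrightarrow> A \<in> carrier_mat d d \<and> (\<forall>i<d. \<forall>j<d. A $$ (i, j) = cnj (A $$ (j, i)))"

lemma cscalar_prod_sum:
  "w \<in> carrier_vec d \<Longrightarrow> v \<bullet>c w = (\<Sum>i<d. v $ i * cnj (w $ i))"
  by (auto simp: scalar_prod_def atLeast0LessThan conjugate_complex_def intro!: sum.cong)

lemma hermitian_entry: "hermitian d A \<Longrightarrow> i < d \<Longrightarrow> j < d \<Longrightarrow> A $$ (i, j) = cnj (A $$ (j, i))"
  unfolding hermitian_def by blast

lemma mult_mat_unit_vec_index:
  fixes A :: "complex mat"
  assumes "A \<in> carrier_mat d d" "i < d" "j < d"
  shows "(A *\<^sub>v unit_vec d j) $ i = A $$ (i, j)"
proof -
  have "(A *\<^sub>v unit_vec d j) $ i = (\<Sum>l<d. A $$ (i, l) * unit_vec d j $ l)"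
    by (rule mult_mat_vec_index[OF assms(1) unit_vec_carrier assms(2)])
  also have "\<dots> = (\<Sum>l<d. if l = j then A $$ (i, l) else 0)"
    using assms(3) by (intro sum.cong) auto
  finally show ?thesis using assms(3) by simp
qed

text \<open>Polarization: the quadratic form is real at \<open>e_i + \<beta> e_j\<close>. The value
  0 for \<open>\<beta>\<close> gives real diagonal entries; then 1 compares the imaginary parts of
  two opposite entries, and \<open>\<i>\<close> their real parts.\<close>

lemma positive_mat_hermitian:
  assumes "positive_mat d A"
  shows "hermitian d A"
proof -
  have A: "A \<in> carrier_mat d d"
    and real: "\<And>v. v \<in> carrier_vec d \<Longrightarrow> Im ((A *\<^sub>v v) \<bullet>c v) = 0"
    using assms unfolding positive_mat_def by (auto simp: less_eq_complex_def)
  have q: "Im (A $$ (i, i) + \<beta> * A $$ (i, j) + cnj \<beta> * (A $$ (j, i) + \<beta> * A $$ (j, j))) = 0"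
    if i: "i < d" and j: "j < d" for i j \<beta>
  proof -
    define v where "v = vec d (\<lambda>k. (if k = i then 1 else 0) + (if k = j then \<beta> else 0))"
    have v: "v \<in> carrier_vec d" by (simp add: v_def)
    have Av: "(A *\<^sub>v v) $ k = A $$ (k, i) + \<beta> * A $$ (k, j)" if "k < d" for k
    proof -
      have "(A *\<^sub>v v) $ k = (\<Sum>l<d. A $$ (k, l) * v $ l)"
        by (rule mult_mat_vec_index[OF A v that])
      also have "\<dots> = (\<Sum>l<d. (if l = i then A $$ (k, l) else 0) + (if l = j then \<beta> * A $$ (k, l) else 0))"
        by (intro sum.cong) (auto simp: v_def algebra_simps)
      also have "\<dots> = A $$ (k, i) + \<beta> * A $$ (k, j)" using i j by (simp add: sum.distrib)
      finally show ?thesis .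
    qed
    have "(A *\<^sub>v v) \<bullet>c v = (\<Sum>k<d. (A $$ (k, i) + \<beta> * A $$ (k, j)) * cnj (v $ k))"
      unfolding cscalar_prod_sum[OF v] using Av by (intro sum.cong) auto
    also have "\<dots> = (\<Sum>k<d. (if k = i then A $$ (k, i) + \<beta> * A $$ (k, j) else 0)
        + (if k = j then cnj \<beta> * (A $$ (k, i) + \<beta> * A $$ (k, j)) else 0))"
      by (intro sum.cong) (auto simp: v_def algebra_simps)
    also have "\<dots> = A $$ (i, i) + \<beta> * A $$ (i, j) + cnj \<beta> * (A $$ (j, i) + \<beta> * A $$ (j, j))"
      using i j by (simp add: sum.distrib)
    finally show ?thesis using real[OF v] by simp
  qed
  have "A $$ (i, j) = cnj (A $$ (j, i))" if "i < d" "j < d" for i j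
    using q[OF that, of 1] q[OF that, of \<i>] q[OF that, of 0] q[OF that(2,1), of 0]
    by (simp add: complex_eq_iff)
  then show ?thesis using A unfolding hermitian_def by blast
qed

lemma projection_mat_hermitian:
  assumes "projection_mat d P"
  shows "hermitian d P"
proof -
  have P: "P \<in> carrier_mat d d" and adj: "mat_adjoint P = P"
    using assms unfolding projection_mat_def by auto
  have "P $$ (i, j) = cnj (P $$ (j, i))" if "i < d" "j < d" for i j
  proof -
    have "P $$ (i, j) = mat_adjoint P $$ (i, j)" using adj by simp
    also have "\<dots> = cnj (P $$ (j, i))"
      using that P by (simp add: mat_adjoint_def mat_of_rows_index conjugate_complex_def)
    finally show ?thesis .
  qed
  then show ?thesis using P unfolding hermitian_def by blast
qed

lemma hermitian_cscalar_prod: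
  assumes "hermitian d A" "x \<in> carrier_vec d" "y \<in> carrier_vec d"
  shows "(A *\<^sub>v x) \<bullet>c y = x \<bullet>c (A *\<^sub>v y)"
proof -
  have A: "A \<in> carrier_mat d d" using assms unfolding hermitian_def by blast
  have Ay: "A *\<^sub>v y \<in> carrier_vec d" by (rule mult_mat_vec_carrier[OF A assms(3)])
  have "(A *\<^sub>v x) \<bullet>c y = (\<Sum>i<d. (\<Sum>j<d. A $$ (i, j) * x $ j) * cnj (y $ i))"
    unfolding cscalar_prod_sum[OF assms(3)] using mult_mat_vec_index[OF A assms(2)]
    by (intro sum.cong) auto
  also have "\<dots> = (\<Sum>j<d. \<Sum>i<d. A $$ (i, j) * x $ j * cnj (y $ i))"
    unfolding sum_distrib_right by (rule sum.swap)
  also have "\<dots> = (\<Sum>j<d. x $ j * cnj (\<Sum>i<d. A $$ (j, i) * y $ i))"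
  proof (intro sum.cong refl)
    fix j assume j: "j \<in> {..<d}"
    have "A $$ (i, j) * x $ j * cnj (y $ i) = x $ j * cnj (A $$ (j, i) * y $ i)" if "i < d" for i
      using hermitian_entry[OF assms(1) that, of j] j by simp
    then show "(\<Sum>i<d. A $$ (i, j) * x $ j * cnj (y $ i)) = x $ j * cnj (\<Sum>i<d. A $$ (j, i) * y $ i)"
      unfolding cnj_sum sum_distrib_left by (intro sum.cong) auto
  qed
  also have "\<dots> = x \<bullet>c (A *\<^sub>v y)"
    unfolding cscalar_prod_sum[OF Ay] using mult_mat_vec_index[OF A assms(3)]
    by (intro sum.cong) auto
  finally show ?thesis .
qed

text \<open>The Krylov space of \<open>w\<close> contains an eigenvector, namely \<open>q(A) w\<close> for a minimal annihilating
  polynomial \<open>(X - z) q\<close> of \<open>w\<close>.\<close>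

lemma krylov_eigenvector:
  fixes A :: "complex mat"
  assumes A: "A \<in> carrier_mat d d" and w: "w \<in> carrier_vec d" "w \<noteq> 0\<^sub>v d"
  obtains Z z c D where "Z \<in> carrier_vec d" "Z \<noteq> 0\<^sub>v d" "A *\<^sub>v Z = z \<cdot>\<^sub>v Z"
    "\<And>s. s < d \<Longrightarrow> Z $ s = (\<Sum>i\<le>D. c i * (((*\<^sub>v) A ^^ i) w) $ s)"
proof -
  define y where "y = (\<lambda>i. ((*\<^sub>v) A ^^ i) w)"
  have y: "y i \<in> carrier_vec d" for i unfolding y_def using A w by (induction i) auto
  have Ay: "A *\<^sub>v y i = y (Suc i)" for i by (simp add: y_def)
  define ev where "ev = (\<lambda>p :: complex poly. vec d (\<lambda>s. \<Sum>i\<le>d. coeff p i * y i $ s))"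
  define S where "S = (\<lambda>p. p \<noteq> 0 \<and> degree p \<le> d \<and> ev p = 0\<^sub>v d)"
  from homogeneous_system_solution[of "{..<d}" "{..d}" "\<lambda>i s. y i $ s"] obtain c where
    c: "\<exists>i\<in>{..d}. c i \<noteq> 0" "\<forall>s\<in>{..<d}. (\<Sum>i\<le>d. c i * y i $ s) = 0" by auto
  have "S (Poly (map c [0..<Suc d]))"
  proof -
    let ?p = "Poly (map c [0..<Suc d])"
    have co: "coeff ?p i = c i" if "i \<le> d" for i
      using that by (simp add: coeff_Poly nth_default_def del: upt_Suc)
    have "?p \<noteq> 0" using c(1) co by (metis atMost_iff coeff_0)
    moreover have "degree ?p \<le> d"
      by (rule degree_le) (simp add: coeff_Poly nth_default_def del: upt_Suc)
    moreover have "ev ?p = 0\<^sub>v d" unfolding ev_def using c(2) co by (intro eq_vecI) auto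
    ultimately show ?thesis unfolding S_def by blast
  qed
  then obtain p where p: "S p" and min: "\<And>q. S q \<Longrightarrow> degree p \<le> degree q"
    by (metis arg_min_natI arg_min_nat_le)
  have "degree p \<noteq> 0"
  proof
    assume "degree p = 0"
    then obtain a where a: "p = [:a:]" by (rule degree_eq_zeroE)
    then have a0: "a \<noteq> 0" using p by (auto simp: S_def)
    have "w $ s = 0" if "s < d" for s
    proof -
      have "0 = ev p $ s" using p that by (simp add: S_def)
      also have "\<dots> = (\<Sum>i\<le>d. coeff p i * y i $ s)" unfolding ev_def using that by simp
      also have "\<dots> = (\<Sum>i\<in>{0}. coeff p i * y i $ s)"
        by (rule sum.mono_neutral_right) (auto simp: a coeff_pCons split: nat.splits)
      finally show ?thesis using a0 by (simp add: a y_def)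
    qed
    then have "w = 0\<^sub>v d" using w by (intro eq_vecI) auto
    then show False using w by simp
  qed
  then have "\<not> constant (poly p)" by (simp add: constant_degree)
  from fundamental_theorem_of_algebra[OF this] obtain z where "poly p z = 0" by blast
  then obtain q where q: "p = [:- z, 1:] * q" by (auto simp: poly_eq_0_iff_dvd elim: dvdE)
  have q0: "q \<noteq> 0" using p by (auto simp: S_def q)
  have deg: "degree p = Suc (degree q)" unfolding q using q0 by (subst degree_mult_eq) auto
  have "\<not> S q" using min[of q] deg by auto
  moreover have dq: "degree q < d" using deg p by (simp add: S_def)
  ultimately have nz: "ev q \<noteq> 0\<^sub>v d" using q0 by (simp add: S_def)
  have Aev: "A *\<^sub>v ev q = z \<cdot>\<^sub>v ev q"
  proof (rule eq_vecI)
    fix s assume "s < dim_vec (z \<cdot>\<^sub>v ev q)"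
    then have s: "s < d" by (simp add: ev_def)
    have ev_c: "ev q \<in> carrier_vec d" by (simp add: ev_def)
    have "(A *\<^sub>v ev q) $ s = (\<Sum>l<d. A $$ (s, l) * ev q $ l)"
      by (rule mult_mat_vec_index[OF A ev_c s])
    also have "\<dots> = (\<Sum>l<d. \<Sum>i\<le>d. coeff q i * (A $$ (s, l) * y i $ l))"
      by (intro sum.cong) (auto simp: ev_def sum_distrib_left mult_ac)
    also have "\<dots> = (\<Sum>i\<le>d. coeff q i * (\<Sum>l<d. A $$ (s, l) * y i $ l))"
      unfolding sum_distrib_left by (rule sum.swap)
    also have "\<dots> = (\<Sum>i\<le>d. coeff q i * y (Suc i) $ s)"
      unfolding Ay[symmetric] mult_mat_vec_index[OF A y s] ..
    finally have 1: "(A *\<^sub>v ev q) $ s = (\<Sum>i\<le>d. coeff q i * y (Suc i) $ s)" .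
    \<comment> \<open>Multiplication by \<open>X\<close> shifts the coefficients; the term at
      \<open>d\<close> may be added because \<open>degree q < d\<close>.\<close>
    have "(\<Sum>i\<le>d. coeff (pCons 0 q) i * y i $ s) = (\<Sum>i<d. coeff q i * y (Suc i) $ s)"
      by (simp add: lessThan_Suc_atMost[symmetric] sum.lessThan_Suc_shift del: sum.lessThan_Suc)
    also have "\<dots> = (\<Sum>i\<le>d. coeff q i * y (Suc i) $ s)"
      using dq by (simp add: lessThan_Suc_atMost[symmetric] coeff_eq_0)
    finally have 2: "(\<Sum>i\<le>d. coeff (pCons 0 q) i * y i $ s) = (A *\<^sub>v ev q) $ s" using 1 by simp
    have "0 = ev p $ s" using p s by (simp add: S_def)
    also have "\<dots> = (\<Sum>i\<le>d. coeff (pCons 0 q) i * y i $ s - z * (coeff q i * y i $ s))"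
      unfolding ev_def q using s by (auto intro!: sum.cong simp: algebra_simps)
    also have "\<dots> = (A *\<^sub>v ev q) $ s - z * ev q $ s"
      unfolding sum_subtractf 2 sum_distrib_left[symmetric] using s by (simp add: ev_def)
    finally show "(A *\<^sub>v ev q) $ s = (z \<cdot>\<^sub>v ev q) $ s" using s by (simp add: ev_def)
  qed (use A in \<open>simp add: ev_def\<close>)
  show thesis
    by (rule that[of "ev q" z "coeff q" d]) (use nz Aev in \<open>auto simp: ev_def y_def\<close>)
qed

text \<open>If \<open>\<sigma> u\<close> were nonzero, its Krylov space would contain an eigenvector
  \<open>Z\<close>, a combination of the vectors \<open>\<sigma> ^ (i + 1) u\<close>. The product of
  \<open>Z\<close> with such a vector is \<open>z ^ (i + 1)\<close> times that of \<open>Z\<close>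
  and \<open>u\<close>, hence zero, either because \<open>z = 0\<close> or by orthogonality. So
  \<open>Z\<close> would be orthogonal to itself.\<close>

lemma hermitian_orthogonal_to_support:
  assumes \<sigma>: "hermitian d \<sigma>" and u: "u \<in> carrier_vec d"
    and orth: "\<And>v k. eigenvector \<sigma> v k \<Longrightarrow> k \<noteq> 0 \<Longrightarrow> v \<bullet>c u = 0"
  shows "\<sigma> *\<^sub>v u = 0\<^sub>v d"
proof (rule ccontr)
  assume nz: "\<sigma> *\<^sub>v u \<noteq> 0\<^sub>v d"
  have \<sigma>c: "\<sigma> \<in> carrier_mat d d" using \<sigma> unfolding hermitian_def by blast
  have w: "\<sigma> *\<^sub>v u \<in> carrier_vec d" by (rule mult_mat_vec_carrier[OF \<sigma>c u])
  from krylov_eigenvector[OF \<sigma>c w nz] obtain Z z c D where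
    Z: "Z \<in> carrier_vec d" "Z \<noteq> 0\<^sub>v d" "\<sigma> *\<^sub>v Z = z \<cdot>\<^sub>v Z"
    "\<And>s. s < d \<Longrightarrow> Z $ s = (\<Sum>i\<le>D. c i * (((*\<^sub>v) \<sigma> ^^ i) (\<sigma> *\<^sub>v u)) $ s)" by blast
  define y where "y = (\<lambda>i. ((*\<^sub>v) \<sigma> ^^ i) u)"
  have y: "y i \<in> carrier_vec d" for i unfolding y_def using \<sigma>c u by (induction i) auto
  have Zy: "Z \<bullet>c y i = z ^ i * (Z \<bullet>c u)" for i
  proof (induction i)
    case (Suc i)
    have "Z \<bullet>c y (Suc i) = (\<sigma> *\<^sub>v Z) \<bullet>c y i"
      using hermitian_cscalar_prod[OF \<sigma> Z(1) y[of i]] by (simp add: y_def)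
    also have "\<dots> = z * (Z \<bullet>c y i)"
      unfolding Z(3) using Z(1) y[of i] by (simp add: smult_scalar_prod_distrib[of _ d])
    finally show ?case using Suc by simp
  qed (simp add: y_def)
  have zero: "Z \<bullet>c y (Suc i) = 0" for i
  proof (cases "z = 0")
    case False
    have "eigenvector \<sigma> Z z" unfolding eigenvector_def using \<sigma>c Z by auto
    then show ?thesis using orth[OF _ False] Zy by simp
  qed (simp add: Zy)
  have "Z \<bullet>c Z = (\<Sum>s<d. Z $ s * cnj (\<Sum>i\<le>D. c i * y (Suc i) $ s))"
    unfolding cscalar_prod_sum[OF Z(1)]
    by (intro sum.cong refl) (auto simp: Z(4)[symmetric] y_def funpow_swap1)
  also have "\<dots> = (\<Sum>s<d. \<Sum>i\<le>D. cnj (c i) * (Z $ s * cnj (y (Suc i) $ s)))"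
    by (intro sum.cong refl) (simp add: cnj_sum sum_distrib_left mult_ac)
  also have "\<dots> = (\<Sum>i\<le>D. cnj (c i) * (\<Sum>s<d. Z $ s * cnj (y (Suc i) $ s)))"
    unfolding sum_distrib_left by (rule sum.swap)
  also have "\<dots> = (\<Sum>i\<le>D. cnj (c i) * (Z \<bullet>c y (Suc i)))"
    unfolding cscalar_prod_sum[OF y] ..
  also have "\<dots> = 0" unfolding zero by simp
  finally show False using Z(1,2) by (simp add: conjugate_square_eq_0_vec[of Z d])
qed

text \<open>Turns supports into linear equations. Forward: \<open>x - P x\<close> is orthogonal to
  the eigenvectors in question, as \<open>P\<close> fixes them, so \<open>\<sigma>\<close>
  annihilates it; thus \<open>\<sigma> P = \<sigma>\<close>, and adjoints are taken. Backward:
  \<open>k v = \<sigma> v = P \<sigma> v\<close> shows that \<open>P\<close> fixes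
  \<open>v\<close>.\<close>

lemma supp_subset_iff:
  assumes \<sigma>: "hermitian d \<sigma>" and P: "projection_mat d P"
  shows "supp \<sigma> \<subseteq> proj_space P \<longleftrightarrow> P * \<sigma> = \<sigma>"
proof
  have \<sigma>c: "\<sigma> \<in> carrier_mat d d" using \<sigma> unfolding hermitian_def by blast
  have Pc: "P \<in> carrier_mat d d" and PP: "P * P = P" using P unfolding projection_mat_def by auto
  have Ph: "hermitian d P" by (rule projection_mat_hermitian[OF P])
  interpret vec_space "TYPE(complex)" d .
  have supp: "supp \<sigma> = span {v. \<exists>k. k \<noteq> 0 \<and> eigenvector \<sigma> v k}"
    unfolding supp_def using \<sigma>c by simp
  have eig_c: "v \<in> carrier_vec d" if "eigenvector \<sigma> v k" for v k
    using that \<sigma>c unfolding eigenvector_def by auto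
  have PPv: "P *\<^sub>v (P *\<^sub>v v) = P *\<^sub>v v" if "v \<in> carrier_vec d" for v
    using assoc_mult_mat_vec[OF Pc Pc that] PP by simp
  have space: "proj_space P = {v \<in> carrier_vec d. P *\<^sub>v v = v}"
    unfolding proj_space_def using Pc PPv by (auto intro: exI[of _ "_ :: complex vec"]) metis+
  show "P * \<sigma> = \<sigma>" if sub: "supp \<sigma> \<subseteq> proj_space P"
  proof -
    have fix_eig: "P *\<^sub>v v = v" if "eigenvector \<sigma> v k" "k \<noteq> 0" for v k
    proof -
      have "v \<in> span {v. \<exists>k. k \<noteq> 0 \<and> eigenvector \<sigma> v k}"
        using in_own_span[of "{v. \<exists>k. k \<noteq> 0 \<and> eigenvector \<sigma> v k}"] eig_c that by blast
      then show ?thesis using sub supp space by auto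
    qed
    have ker: "\<sigma> *\<^sub>v (x - P *\<^sub>v x) = 0\<^sub>v d" if x: "x \<in> carrier_vec d" for x
    proof (rule hermitian_orthogonal_to_support[OF \<sigma>])
      have Px: "P *\<^sub>v x \<in> carrier_vec d" by (rule mult_mat_vec_carrier[OF Pc x])
      show u: "x - P *\<^sub>v x \<in> carrier_vec d" using x Px by auto
      fix v k assume v: "eigenvector \<sigma> v k" "k \<noteq> 0"
      have "v \<bullet>c (x - P *\<^sub>v x) = (P *\<^sub>v v) \<bullet>c (x - P *\<^sub>v x)" using fix_eig[OF v] by simp
      also have "\<dots> = v \<bullet>c (P *\<^sub>v (x - P *\<^sub>v x))"
        by (rule hermitian_cscalar_prod[OF Ph eig_c[OF v(1)] u])
      also have "P *\<^sub>v (x - P *\<^sub>v x) = 0\<^sub>v d"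
        using mult_minus_distrib_mat_vec[OF Pc x Px] PPv[OF x] Px by simp
      finally show "v \<bullet>c (x - P *\<^sub>v x) = 0" using eig_c[OF v(1)] by simp
    qed
    have \<sigma>P: "\<sigma> * P = \<sigma>"
    proof (rule eq_matI)
      fix i j assume "i < dim_row \<sigma>" "j < dim_col \<sigma>"
      then have i: "i < d" and j: "j < d" using \<sigma>c by auto
      have e: "unit_vec d j \<in> carrier_vec d" by simp
      have Pe: "P *\<^sub>v unit_vec d j \<in> carrier_vec d" by (rule mult_mat_vec_carrier[OF Pc e])
      have "\<sigma> *\<^sub>v unit_vec d j - \<sigma> *\<^sub>v (P *\<^sub>v unit_vec d j) = 0\<^sub>v d"
        using ker[OF e] mult_minus_distrib_mat_vec[OF \<sigma>c e Pe] by simp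
      then have "(\<sigma> *\<^sub>v unit_vec d j) $ i = (\<sigma> *\<^sub>v (P *\<^sub>v unit_vec d j)) $ i"
        using i \<sigma>c by (metis eq_iff_diff_eq_0 index_minus_vec(1) index_zero_vec(1) mult_mat_vec_carrier Pe carrier_vecD)
      also have "\<sigma> *\<^sub>v (P *\<^sub>v unit_vec d j) = (\<sigma> * P) *\<^sub>v unit_vec d j"
        using assoc_mult_mat_vec[OF \<sigma>c Pc e] by simp
      finally show "(\<sigma> * P) $$ (i, j) = \<sigma> $$ (i, j)"
        by (simp only: mult_mat_unit_vec_index[OF \<sigma>c i j]
            mult_mat_unit_vec_index[OF mult_carrier_mat[OF \<sigma>c Pc] i j])
    qed (use \<sigma>c Pc in auto)
    show ?thesis
    proof (rule eq_matI)
      fix i j assume "i < dim_row \<sigma>" "j < dim_col \<sigma>"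
      then have i: "i < d" and j: "j < d" using \<sigma>c by auto
      have "(P * \<sigma>) $$ (i, j) = (\<Sum>k<d. P $$ (i, k) * \<sigma> $$ (k, j))"
        using i j Pc \<sigma>c by (simp add: scalar_prod_def atLeast0LessThan)
      also have "\<dots> = (\<Sum>k<d. cnj (\<sigma> $$ (j, k) * P $$ (k, i)))"
      proof (intro sum.cong refl)
        fix k assume "k \<in> {..<d}"
        then have "P $$ (i, k) = cnj (P $$ (k, i))" "\<sigma> $$ (k, j) = cnj (\<sigma> $$ (j, k))"
          using hermitian_entry[OF Ph i] hermitian_entry[OF \<sigma> _ j] by blast+
        then show "P $$ (i, k) * \<sigma> $$ (k, j) = cnj (\<sigma> $$ (j, k) * P $$ (k, i))" by simp
      qed
      also have "\<dots> = cnj ((\<sigma> * P) $$ (j, i))"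
        using i j Pc \<sigma>c by (simp add: scalar_prod_def atLeast0LessThan)
      also have "\<dots> = \<sigma> $$ (i, j)" unfolding \<sigma>P by (rule hermitian_entry[OF \<sigma> i j, symmetric])
      finally show "(P * \<sigma>) $$ (i, j) = \<sigma> $$ (i, j)" .
    qed (use \<sigma>c Pc in auto)
  qed
  show "supp \<sigma> \<subseteq> proj_space P" if eq: "P * \<sigma> = \<sigma>"
    unfolding supp
  proof (rule span_is_subset)
    show "{v. \<exists>k. k \<noteq> 0 \<and> eigenvector \<sigma> v k} \<subseteq> proj_space P"
    proof clarify
      fix v k assume k: "k \<noteq> 0" and v: "eigenvector \<sigma> v k"
      have vc: "v \<in> carrier_vec d" by (rule eig_c[OF v])
      have \<sigma>v: "\<sigma> *\<^sub>v v = k \<cdot>\<^sub>v v" using v unfolding eigenvector_def by blast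
      have "k \<cdot>\<^sub>v (P *\<^sub>v v) = P *\<^sub>v (\<sigma> *\<^sub>v v)" unfolding \<sigma>v by (rule mult_mat_vec[OF Pc vc, symmetric])
      also have "\<dots> = k \<cdot>\<^sub>v v" using assoc_mult_mat_vec[OF Pc \<sigma>c vc] eq \<sigma>v by simp
      finally have "inverse k \<cdot>\<^sub>v (k \<cdot>\<^sub>v (P *\<^sub>v v)) = inverse k \<cdot>\<^sub>v (k \<cdot>\<^sub>v v)" by simp
      then have "P *\<^sub>v v = v" using k by (simp add: smult_smult_assoc)
      then show "v \<in> proj_space P" unfolding space using vc by simp
    qed
    show "submodule class_ring (proj_space P) V"
    proof (rule submodule.intro)
      show "Module.module class_ring V" by (rule vec_module)
      show "proj_space P \<subseteq> carrier V" unfolding space by auto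
      show "v \<oplus>\<^bsub>V\<^esub> w \<in> proj_space P" if "v \<in> proj_space P" "w \<in> proj_space P" for v w
        using that Pc unfolding space by (auto simp: mult_add_distrib_mat_vec[of _ d d])
      show "\<zero>\<^bsub>V\<^esub> \<in> proj_space P" unfolding space using Pc by auto
      show "c \<odot>\<^bsub>V\<^esub> v \<in> proj_space P" if "c \<in> carrier class_ring" "v \<in> proj_space P" for c v
        using that Pc unfolding space by (auto simp: mult_mat_vec[of _ d d])
    qed
  qed
qed

section \<open>Quantum automata as linear systems\<close>

lemma super_operator_carrier:
  "tp_super_operator d \<E> \<Longrightarrow> X \<in> carrier_mat d d \<Longrightarrow> \<E> X \<in> carrier_mat d d"
  unfolding tp_super_operator_def linear_mat_map_def by blast

text \<open>Complete positivity with a single block.\<close>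

lemma super_operator_positive:
  assumes E: "tp_super_operator d \<E>" and X: "positive_mat d X"
  shows "positive_mat d (\<E> X)"
proof -
  have Xc: "X \<in> carrier_mat d d" using X unfolding positive_mat_def by blast
  have "block d X 0 0 = X" unfolding block_def using Xc by (intro eq_matI) auto
  then have "ampliate 1 d \<E> X = \<E> X"
    unfolding ampliate_def using super_operator_carrier[OF E Xc] by (intro eq_matI) auto
  moreover have "positive_mat (1 * d) X" using X by simp
  then have "positive_mat (1 * d) (ampliate 1 d \<E> X)"
    using E unfolding tp_super_operator_def completely_positive_def by blast
  ultimately show ?thesis by simp
qed

lemma linear_mat_map_expand:
  assumes E: "linear_mat_map d \<E>" and X: "X \<in> carrier_mat d d" and ij: "i < d" "j < d"
  shows "\<E> X $$ (i, j) =
    (\<Sum>b<d * d. \<E> (matrix_unit d (b div d) (b mod d)) $$ (i, j) * X $$ (b div d, b mod d))"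
proof -
  have Ec: "\<E> Y \<in> carrier_mat d d" if "Y \<in> carrier_mat d d" for Y
    using E that unfolding linear_mat_map_def by blast
  \<comment> \<open>The first \<open>N\<close> entries in row-major order: additivity is then
    applied to one matrix unit at a time, without sums of matrices.\<close>
  define Y where "Y = (\<lambda>N. mat d d (\<lambda>(r, c). if r * d + c < N then X $$ (r, c) else 0))"
  have Yc: "Y N \<in> carrier_mat d d" for N by (simp add: Y_def)
  have part: "\<E> (Y N) $$ (i, j) =
      (\<Sum>b<N. \<E> (matrix_unit d (b div d) (b mod d)) $$ (i, j) * X $$ (b div d, b mod d))"
    if "N \<le> d * d" for N
    using that
  proof (induction N)
    case 0
    have "Y 0 = 0 \<cdot>\<^sub>m Y 0" unfolding Y_def by (intro eq_matI) auto
    then have "\<E> (Y 0) = 0 \<cdot>\<^sub>m \<E> (Y 0)" using E Yc unfolding linear_mat_map_def by metis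
    then have "\<E> (Y 0) $$ (i, j) = (0 \<cdot>\<^sub>m \<E> (Y 0)) $$ (i, j)" by simp
    then show ?case using Ec[OF Yc[of 0]] ij by simp
  next
    case (Suc N)
    let ?U = "matrix_unit d (N div d) (N mod d)"
    let ?x = "X $$ (N div d, N mod d)"
    have U: "?U \<in> carrier_mat d d" by (simp add: matrix_unit_def)
    have "Y (Suc N) = Y N + ?x \<cdot>\<^sub>m ?U"
    proof (rule eq_matI)
      fix r c assume "r < dim_row (Y N + ?x \<cdot>\<^sub>m ?U)" "c < dim_col (Y N + ?x \<cdot>\<^sub>m ?U)"
      then have r: "r < d" and c: "c < d" by (auto simp: matrix_unit_def)
      have "r * d + c = N \<longleftrightarrow> r = N div d \<and> c = N mod d" using c by auto
      then show "Y (Suc N) $$ (r, c) = (Y N + ?x \<cdot>\<^sub>m ?U) $$ (r, c)"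
        using r c by (auto simp: Y_def matrix_unit_def less_Suc_eq)
    qed (auto simp: Y_def matrix_unit_def)
    then have "\<E> (Y (Suc N)) = \<E> (Y N) + ?x \<cdot>\<^sub>m \<E> ?U"
      using E Yc[of N] U smult_carrier_mat[OF U] unfolding linear_mat_map_def by metis
    then have "\<E> (Y (Suc N)) $$ (i, j) = \<E> (Y N) $$ (i, j) + ?x * \<E> ?U $$ (i, j)"
      using Ec[OF Yc[of N]] Ec[OF U] ij by simp
    then show ?case using Suc by simp
  qed
  have "Y (d * d) = X"
  proof (rule eq_matI)
    fix r c assume "r < dim_row X" "c < dim_col X"
    then have r: "r < d" and c: "c < d" using X by auto
    have "r * d + c < Suc r * d" using c by simp
    also have "\<dots> \<le> d * d" using r by (intro mult_right_mono) auto
    finally show "Y (d * d) $$ (r, c) = X $$ (r, c)" using r c by (simp add: Y_def)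
  qed (use X in \<open>auto simp: Y_def\<close>)
  then show ?thesis using part[of "d * d"] by simp
qed

section \<open>The linear system of a rational automaton\<close>

locale rational_instance =
  fixes \<A> :: qautomaton and \<phi> :: "complex mat list"
  assumes automaton: "quantum_automaton \<A>" and rational: "rational_automaton \<A>"
    and several_actions: "card (qact \<A>) > 1"
    and projections: "\<And>P. P \<in> set \<phi> \<Longrightarrow> projection_mat (qdim \<A>) P \<and> rational_mat P"
begin

abbreviation "d \<equiv> qdim \<A>"
abbreviation "acts \<equiv> sorted_list_of_set (qact \<A>)"

text \<open>Row-major. Beyond \<open>d * d\<close> the row index is out of range and the value
  unspecified, so states are compared below \<open>d * d\<close> only.\<close>

definition flat :: "complex mat \<Rightarrow> nat \<Rightarrow> complex" where
  "flat X a = X $$ (a div d, a mod d)"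

definition step :: "nat \<Rightarrow> (nat \<Rightarrow> complex) \<Rightarrow> nat \<Rightarrow> complex" where
  "step \<alpha> x a =
    (\<Sum>b<d * d. flat (qop \<A> (acts ! \<alpha>) (matrix_unit d (b div d) (b mod d))) a * x b)"

text \<open>\<open>defect i q\<close> is the \<open>q\<close>-th entry of \<open>P \<sigma> - \<sigma>\<close> as a functional of \<open>\<sigma>\<close>, for \<open>P = \<phi> ! i\<close>.\<close>

definition defect :: "nat \<Rightarrow> nat \<Rightarrow> (nat \<Rightarrow> complex) \<Rightarrow> complex" where
  "defect i q x = (\<Sum>b<d * d. ((if b mod d = q mod d then \<phi> ! i $$ (q div d, b div d) else 0)
    - (if b = q then 1 else 0)) * x b)"

text \<open>Letters are positions in the sorted list of actions, and each disjunct has one test per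
  matrix entry.\<close>

sublocale linear_system "d * d" "length acts" "length \<phi>" "d * d" step defect "flat (qinit \<A>)"
proof
  show "linear_endo (d * d) (step a)" for a
    unfolding linear_endo_def step_def
    by (rule exI[of _ "\<lambda>c b. flat (qop \<A> (acts ! a) (matrix_unit d (b div d) (b mod d))) c"]) simp
  show "linear_form (d * d) (defect i q)" for i q
    unfolding linear_form_def defect_def
    by (rule exI[of _ "\<lambda>b. (if b mod d = q mod d then \<phi> ! i $$ (q div d, b div d) else 0)
      - (if b = q then 1 else 0)"]) simp
qed

lemma finite_acts: "finite (qact \<A>)"
  using automaton unfolding quantum_automaton_def by blast

lemma acts_nth: "i < length acts \<Longrightarrow> acts ! i \<in> qact \<A>"
  using nth_mem[of i acts] finite_acts by simp

lemma flat_index: "a < d * d \<Longrightarrow> a div d < d" "a < d * d \<Longrightarrow> a mod d < d"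
  by (simp add: less_mult_imp_div_less) (cases "d = 0", auto)

lemma step_cong: "(\<And>b. b < d * d \<Longrightarrow> x b = y b) \<Longrightarrow> step \<alpha> x a = step \<alpha> y a"
  unfolding step_def by simp

lemma bad_cong: "(\<And>a. a < d * d \<Longrightarrow> x a = y a) \<Longrightarrow> bad x \<longleftrightarrow> bad y"
  unfolding bad_def defect_def by simp

lemma admissible_seq_positive:
  assumes "w \<in> infinite_words \<A>"
  shows "positive_mat d (admissible_seq \<A> w j)"
proof (induction j)
  case 0
  then show ?case using automaton unfolding quantum_automaton_def density_mat_def by simp
next
  case (Suc j)
  then show ?case
    using assms automaton super_operator_positive unfolding quantum_automaton_def infinite_words_def
    by simp
qed

lemma state_flat:
  assumes w: "\<And>i. w i < length acts" and a: "a < d * d"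
  shows "state w j a = flat (admissible_seq \<A> (\<lambda>i. acts ! w i) j) a"
  using a
proof (induction j arbitrary: a)
  case (Suc j)
  let ?v = "\<lambda>i. acts ! w i"
  let ?\<sigma> = "admissible_seq \<A> ?v j"
  have v: "?v \<in> infinite_words \<A>" using w acts_nth unfolding infinite_words_def by simp
  have "linear_mat_map d (qop \<A> (?v j))"
    using v automaton unfolding infinite_words_def quantum_automaton_def tp_super_operator_def by simp
  moreover have "?\<sigma> \<in> carrier_mat d d"
    using admissible_seq_positive[OF v] unfolding positive_mat_def by blast
  ultimately have "flat (admissible_seq \<A> ?v (Suc j)) a = step (w j) (flat ?\<sigma>) a"
    unfolding flat_def step_def using linear_mat_map_expand flat_index[OF Suc.prems] by simp
  also have "\<dots> = step (w j) (state w j) a"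
    by (rule step_cong) (simp add: Suc.IH)
  finally show ?case by simp
qed simp

lemma bad_flat_iff:
  assumes "positive_mat d \<sigma>"
  shows "bad (flat \<sigma>) \<longleftrightarrow> \<not> satisfies \<sigma> \<phi>"
proof -
  have \<sigma>: "hermitian d \<sigma>" by (rule positive_mat_hermitian[OF assms])
  then have \<sigma>c: "\<sigma> \<in> carrier_mat d d" unfolding hermitian_def by blast
  have "(\<exists>q<d * d. defect i q (flat \<sigma>) \<noteq> 0) \<longleftrightarrow> \<not> supp \<sigma> \<subseteq> proj_space (\<phi> ! i)"
    if i: "i < length \<phi>" for i
  proof -
    let ?P = "\<phi> ! i"
    have P: "projection_mat d ?P" using projections i by simp
    then have Pc: "?P \<in> carrier_mat d d" unfolding projection_mat_def by blast
    have val: "defect i q (flat \<sigma>) = (?P * \<sigma>) $$ (q div d, q mod d) - \<sigma> $$ (q div d, q mod d)"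
      if q: "q < d * d" for q
    proof -
      have "defect i q (flat \<sigma>) =
          (\<Sum>b<d * d. (if b mod d = q mod d then ?P $$ (q div d, b div d) * flat \<sigma> b else 0)
            - (if b = q then flat \<sigma> b else 0))"
        unfolding defect_def by (intro sum.cong) (auto simp: algebra_simps)
      also have "\<dots> = (\<Sum>k<d. ?P $$ (q div d, k) * \<sigma> $$ (k, q mod d)) - flat \<sigma> q"
        unfolding sum_subtractf
        using sum_residue_class[OF flat_index(2)[OF q], of "\<lambda>b. ?P $$ (q div d, b div d) * flat \<sigma> b" d] q
          flat_index(2)[OF q]
        by (simp add: flat_def)
      also have "(\<Sum>k<d. ?P $$ (q div d, k) * \<sigma> $$ (k, q mod d)) = (?P * \<sigma>) $$ (q div d, q mod d)"
        using Pc \<sigma>c flat_index[OF q] by (simp add: scalar_prod_def atLeast0LessThan)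
      finally show ?thesis unfolding flat_def[of \<sigma> q] .
    qed
    have "?P * \<sigma> = \<sigma>" if zero: "\<And>q. q < d * d \<Longrightarrow> defect i q (flat \<sigma>) = 0"
    proof (rule eq_matI)
      fix r c assume "r < dim_row \<sigma>" "c < dim_col \<sigma>"
      then have r: "r < d" and c: "c < d" using \<sigma>c by auto
      have "r * d + c < Suc r * d" using c by simp
      also have "\<dots> \<le> d * d" using r by (intro mult_right_mono) auto
      finally have "r * d + c < d * d" .
      from val[OF this] zero[OF this] show "(?P * \<sigma>) $$ (r, c) = \<sigma> $$ (r, c)" using c by simp
    qed (use Pc \<sigma>c in auto)
    then have "?P * \<sigma> = \<sigma> \<longleftrightarrow> (\<forall>q<d * d. defect i q (flat \<sigma>) = 0)" using val by auto
    then show ?thesis using supp_subset_iff[OF \<sigma> P] by blast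
  qed
  then show ?thesis unfolding bad_def satisfies_def by (metis in_set_conv_nth)
qed

lemma valid_iff:
  "eventually_always_valid \<A> \<phi> \<longleftrightarrow>
    \<not> (\<exists>w. (\<forall>i. w i < length acts) \<and> (\<forall>J. \<exists>j\<ge>J. bad (state w j)))"
proof -
  have bad: "bad (state w j) \<longleftrightarrow> \<not> satisfies (admissible_seq \<A> (\<lambda>i. acts ! w i) j) \<phi>"
    if w: "\<And>i. w i < length acts" for w j
  proof -
    have v: "(\<lambda>i. acts ! w i) \<in> infinite_words \<A>"
      using w acts_nth unfolding infinite_words_def by simp
    have "bad (state w j) \<longleftrightarrow> bad (flat (admissible_seq \<A> (\<lambda>i. acts ! w i) j))"
      by (rule bad_cong) (rule state_flat[OF w])
    also have "\<dots> \<longleftrightarrow> \<not> satisfies (admissible_seq \<A> (\<lambda>i. acts ! w i) j) \<phi>"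
      by (rule bad_flat_iff[OF admissible_seq_positive[OF v]])
    finally show ?thesis .
  qed
  show ?thesis
  proof
    assume valid: "eventually_always_valid \<A> \<phi>"
    show "\<not> (\<exists>w. (\<forall>i. w i < length acts) \<and> (\<forall>J. \<exists>j\<ge>J. bad (state w j)))"
    proof
      assume "\<exists>w. (\<forall>i. w i < length acts) \<and> (\<forall>J. \<exists>j\<ge>J. bad (state w j))"
      then obtain w where w: "\<And>i. w i < length acts" and inf: "\<And>J. \<exists>j\<ge>J. bad (state w j)" by blast
      have "(\<lambda>i. acts ! w i) \<in> infinite_words \<A>" using w acts_nth unfolding infinite_words_def by simp
      then obtain i where "\<forall>j\<ge>i. satisfies (admissible_seq \<A> (\<lambda>i. acts ! w i) j) \<phi>"
        using valid unfolding eventually_always_valid_def by blast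
      then show False using inf[of i] bad[of w, OF w] by blast
    qed
  next
    assume no: "\<not> (\<exists>w. (\<forall>i. w i < length acts) \<and> (\<forall>J. \<exists>j\<ge>J. bad (state w j)))"
    show "eventually_always_valid \<A> \<phi>" unfolding eventually_always_valid_def
    proof
      fix v assume "v \<in> infinite_words \<A>"
      then have "\<forall>i. v i \<in> set acts" using finite_acts unfolding infinite_words_def by simp
      then have "\<forall>i. \<exists>k<length acts. acts ! k = v i" unfolding in_set_conv_nth by blast
      then obtain w where w: "\<And>i. w i < length acts" and v: "\<And>i. acts ! w i = v i" by metis
      from no w obtain J where "\<forall>j\<ge>J. \<not> bad (state w j)" by blast
      then have "\<forall>j\<ge>J. satisfies (admissible_seq \<A> v j) \<phi>" using bad[of w, OF w] v by simp
      then show "\<exists>i. \<forall>j\<ge>i. satisfies (admissible_seq \<A> v j) \<phi>" by blast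
    qed
  qed
qed

end

section \<open>A calculus of recursive functions\<close>

text \<open>\<open>recursive\<close> speaks of one function on lists of every length; agreement on
  length \<open>n\<close> frees the closure rules from the irrelevant values.\<close>

definition computable :: "nat \<Rightarrow> (nat list \<Rightarrow> nat) \<Rightarrow> bool" where
  "computable n F \<longleftrightarrow> (\<exists>f. recursive n f \<and> (\<forall>xs. length xs = n \<longrightarrow> f xs = F xs))"

lemma computable_cong:
  "computable n F \<Longrightarrow> (\<And>xs. length xs = n \<Longrightarrow> F xs = G xs) \<Longrightarrow> computable n G"
  unfolding computable_def by force

lemma computable_recursive: "recursive n f \<Longrightarrow> computable n f"
  unfolding computable_def by blast

lemma computable_proj: "i < n \<Longrightarrow> computable n (\<lambda>xs. xs ! i)"
  by (intro computable_recursive recursive.proj)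

lemma computable_comp:
  assumes "computable (length Gs) F" "\<And>G. G \<in> set Gs \<Longrightarrow> computable n G"
  shows "computable n (\<lambda>xs. F (map (\<lambda>G. G xs) Gs))"
proof -
  from assms(1) obtain f where f: "recursive (length Gs) f" "\<And>xs. length xs = length Gs \<Longrightarrow> f xs = F xs"
    unfolding computable_def by blast
  from assms(2) obtain c where c: "\<And>G. G \<in> set Gs \<Longrightarrow> recursive n (c G)"
    "\<And>G xs. G \<in> set Gs \<Longrightarrow> length xs = n \<Longrightarrow> c G xs = G xs"
    unfolding computable_def by metis
  have "recursive n (\<lambda>xs. f (map (\<lambda>g. g xs) (map c Gs)))"
    by (rule recursive.comp) (use f c in auto)
  moreover have "f (map (\<lambda>g. g xs) (map c Gs)) = F (map (\<lambda>G. G xs) Gs)" if "length xs = n" for xs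
  proof -
    have "map (\<lambda>g. g xs) (map c Gs) = map (\<lambda>G. G xs) Gs" using c(2) that by auto
    then show ?thesis by (simp only: f(2) length_map)
  qed
  ultimately show ?thesis unfolding computable_def by blast
qed

lemma computable_Suc:
  assumes "computable n F"
  shows "computable n (\<lambda>xs. Suc (F xs))"
  using computable_comp[of "[F]" "\<lambda>xs. Suc (hd xs)"] assms computable_recursive[OF recursive.succ]
  by simp

lemma computable_const: "computable n (\<lambda>xs. c)"
proof (induction c)
  case 0
  show ?case by (intro computable_recursive recursive.zero)
qed (rule computable_Suc)

text \<open>Weakening for the step function of a recursion, whose arguments begin with the counter
  and the previous value.\<close>

lemma computable_drop:
  assumes "computable n F"
  shows "computable (n + 2) (\<lambda>ys. F (drop 2 ys))"
proof -
  have "computable (n + 2) (\<lambda>ys. F (map (\<lambda>G. G ys) (map (\<lambda>i ys. ys ! (i + 2)) [0..<n])))"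
    by (rule computable_comp) (use assms computable_proj in auto)
  then show ?thesis
    by (rule computable_cong) (auto intro!: arg_cong[where f = F] nth_equalityI simp: add.commute)
qed

text \<open>The scheme \<open>prim_rec\<close> recurses on the head of the list; composition puts
  the computed argument \<open>H xs\<close> in front of the unchanged parameters.\<close>

lemma computable_rec_nat:
  assumes B: "computable n B" and H: "computable n H"
    and S: "computable (n + 2) (\<lambda>ys. S (drop 2 ys) (ys ! 0) (ys ! 1))"
  shows "computable n (\<lambda>xs. rec_nat (B xs) (S xs) (H xs))"
proof -
  from B obtain b where b: "recursive n b" "\<And>xs. length xs = n \<Longrightarrow> b xs = B xs"
    unfolding computable_def by blast
  from S obtain s where s: "recursive (n + 2) s"
    "\<And>ys. length ys = n + 2 \<Longrightarrow> s ys = S (drop 2 ys) (ys ! 0) (ys ! 1)"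
    unfolding computable_def by blast
  let ?R = "\<lambda>xs. rec_nat (b (tl xs)) (\<lambda>k r. s (k # r # tl xs)) (hd xs)"
  have "recursive (n + 1) ?R" by (rule recursive.prim_rec[OF b(1) s(1)])
  then have R: "computable (n + 1) ?R" by (rule computable_recursive)
  let ?Gs = "H # map (\<lambda>i xs. xs ! i) [0..<n]"
  have "computable n (\<lambda>xs. ?R (map (\<lambda>G. G xs) ?Gs))"
    by (rule computable_comp) (use R H computable_proj in auto)
  then show ?thesis
  proof (rule computable_cong)
    fix xs :: "nat list" assume len: "length xs = n"
    have map: "map (\<lambda>G. G xs) ?Gs = H xs # xs" using len by (auto intro: nth_equalityI)
    show "?R (map (\<lambda>G. G xs) ?Gs) = rec_nat (B xs) (S xs) (H xs)"
      unfolding map by (simp add: b(2) s(2) len)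
  qed
qed

lemma computable_add:
  assumes "computable n F" "computable n G"
  shows "computable n (\<lambda>xs. F xs + G xs)"
proof -
  have "computable n (\<lambda>xs. rec_nat (F xs) (\<lambda>k r. Suc r) (G xs))"
    by (intro computable_rec_nat assms computable_Suc computable_proj) simp
  moreover have "rec_nat a (\<lambda>k r. Suc r) b = a + b" for a b by (induction b) auto
  ultimately show ?thesis by simp
qed

lemma computable_mult:
  assumes "computable n F" "computable n G"
  shows "computable n (\<lambda>xs. F xs * G xs)"
proof -
  have "computable n (\<lambda>xs. rec_nat 0 (\<lambda>k r. r + F xs) (G xs))"
    by (intro computable_rec_nat computable_add computable_const computable_drop assms computable_proj) simp
  moreover have "rec_nat 0 (\<lambda>k r. r + a) b = a * b" for a b :: nat by (induction b) auto
  ultimately show ?thesis by simp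
qed

lemma computable_diff:
  assumes "computable n F" "computable n G"
  shows "computable n (\<lambda>xs. F xs - G xs)"
proof -
  have pred: "computable k (\<lambda>xs. H xs - 1)" if "computable k H" for k H
  proof -
    have "computable k (\<lambda>xs. rec_nat 0 (\<lambda>k r. k) (H xs))"
      by (intro computable_rec_nat computable_const computable_proj that) simp
    moreover have "rec_nat 0 (\<lambda>k r. k) b = b - 1" for b :: nat by (induction b) auto
    ultimately show ?thesis by simp
  qed
  have "computable n (\<lambda>xs. rec_nat (F xs) (\<lambda>k r. r - 1) (G xs))"
    by (intro computable_rec_nat pred computable_proj assms) simp
  moreover have "rec_nat a (\<lambda>k r. r - 1) b = a - b" for a b :: nat by (induction b) auto
  ultimately show ?thesis by simp
qed

lemma computable_triangle:
  assumes "computable n F"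
  shows "computable n (\<lambda>xs. triangle (F xs))"
proof -
  have "computable n (\<lambda>xs. rec_nat 0 (\<lambda>k r. r + Suc k) (F xs))"
    by (intro computable_rec_nat computable_add computable_Suc computable_const computable_proj assms)
      simp_all
  moreover have "rec_nat 0 (\<lambda>k r. r + Suc k) b = triangle b" for b by (induction b) auto
  ultimately show ?thesis by simp
qed

section \<open>Computable projections of the pairing function\<close>

definition pfst :: "nat \<Rightarrow> nat" where "pfst z = fst (prod_decode z)"

definition psnd :: "nat \<Rightarrow> nat" where "psnd z = snd (prod_decode z)"

lemma pfst_encode [simp]: "pfst (prod_encode (a, b)) = a"
  and psnd_encode [simp]: "psnd (prod_encode (a, b)) = b"
  by (simp_all add: pfst_def psnd_def)

lemma prod_encode_pfst_psnd: "prod_encode (pfst z, psnd z) = z"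
  by (simp add: pfst_def psnd_def)

lemma triangle_mono: "a \<le> b \<Longrightarrow> triangle a \<le> triangle b"
  by (induction rule: dec_induct) auto

text \<open>The diagonal of a pair code is the largest \<open>s\<close> with \<^term>\<open>triangle s \<le> z\<close>, found by counting.\<close>

lemma pair_diagonal:
  "pfst z + psnd z = (\<Sum>k<z. 1 - (triangle (Suc k) - z))"
proof -
  let ?s = "pfst z + psnd z"
  have z: "z = triangle ?s + pfst z"
    using prod_encode_pfst_psnd[of z] by (simp add: prod_encode_def)
  have k_le: "k \<le> triangle k" for k by (induction k) auto
  have "(\<Sum>k<z. 1 - (triangle (Suc k) - z)) = (\<Sum>k<z. if k < ?s then 1 else 0)"
  proof (intro sum.cong refl)
    fix k
    show "1 - (triangle (Suc k) - z) = (if k < ?s then 1 else 0)"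
    proof (cases "k < ?s")
      case True
      then have "triangle (Suc k) \<le> z" using triangle_mono[of "Suc k" ?s] z by linarith
      then show ?thesis using True by simp
    next
      case False
      then have "triangle (Suc ?s) \<le> triangle (Suc k)" by (intro triangle_mono) auto
      moreover have "triangle (Suc ?s) = triangle ?s + Suc ?s" by simp
      ultimately have "z < triangle (Suc k)" using z by linarith
      then show ?thesis using False by simp
    qed
  qed
  also have "\<dots> = card ({..<z} \<inter> {k. k < ?s})" by (simp add: sum.If_cases)
  also have "{..<z} \<inter> {k. k < ?s} = {..<?s}" using k_le[of ?s] z by auto
  finally show ?thesis by simp
qed

lemma computable_pair_sum:
  assumes "computable n F"
  shows "computable n (\<lambda>xs. pfst (F xs) + psnd (F xs))"
proof -
  have "computable n (\<lambda>xs. rec_nat 0 (\<lambda>k r. r + (1 - (triangle (Suc k) - F xs))) (F xs))"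
    by (intro computable_rec_nat computable_add computable_diff computable_triangle computable_Suc
        computable_const computable_drop assms computable_proj) simp_all
  moreover have "rec_nat 0 (\<lambda>k r. r + f k) b = (\<Sum>k<b. f k)" for f :: "nat \<Rightarrow> nat" and b
    by (induction b) auto
  ultimately show ?thesis unfolding pair_diagonal by simp
qed

text \<open>A pair code is \<open>triangle (a + b) + a\<close>, so \<open>a\<close> remains after
  subtraction of the triangle of the diagonal.\<close>

lemma computable_pfst:
  assumes "computable n F"
  shows "computable n (\<lambda>xs. pfst (F xs))"
proof -
  have "pfst z = z - triangle (pfst z + psnd z)" for z
    using prod_encode_pfst_psnd[of z] by (simp add: prod_encode_def)
  moreover have "computable n (\<lambda>xs. F xs - triangle (pfst (F xs) + psnd (F xs)))"
    by (intro computable_diff computable_triangle computable_pair_sum assms)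
  ultimately show ?thesis by simp
qed

lemma computable_psnd:
  assumes "computable n F"
  shows "computable n (\<lambda>xs. psnd (F xs))"
proof -
  have "computable n (\<lambda>xs. (pfst (F xs) + psnd (F xs)) - pfst (F xs))"
    by (intro computable_diff computable_pair_sum computable_pfst assms)
  then show ?thesis by simp
qed

lemma computable_prod_encode:
  assumes "computable n F" "computable n G"
  shows "computable n (\<lambda>xs. prod_encode (F xs, G xs))"
  unfolding prod_encode_def prod.case
  by (intro computable_add computable_triangle assms)

definition unary_computable :: "(nat \<Rightarrow> nat) \<Rightarrow> bool" where
  "unary_computable F \<longleftrightarrow> computable 1 (\<lambda>xs. F (xs ! 0))"

named_theorems computable_intros

text \<open>The variable bound in \<^term>\<open>unary_computable (\<lambda>e. f e)\<close> plays the role of an environment;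
  rules for binders extend it by pairing.\<close>

lemma unary_computable_comp:
  assumes "unary_computable F" "unary_computable G"
  shows "unary_computable (\<lambda>e. F (G e))"
  using computable_comp[of "[\<lambda>xs. G (xs ! 0)]" "\<lambda>xs. F (xs ! 0)" 1] assms
  unfolding unary_computable_def by simp

lemma unary_computable_id [computable_intros]: "unary_computable (\<lambda>e. e)"
  unfolding unary_computable_def by (intro computable_proj) simp

lemma unary_computable_const [computable_intros]: "unary_computable (\<lambda>e. c)"
  unfolding unary_computable_def by (rule computable_const)

lemma unary_computable_arith [computable_intros]:
  assumes "unary_computable F" "unary_computable G"
  shows "unary_computable (\<lambda>e. F e + G e)" "unary_computable (\<lambda>e. F e * G e)"
    "unary_computable (\<lambda>e. F e - G e)" "unary_computable (\<lambda>e. prod_encode (F e, G e))"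
  using assms unfolding unary_computable_def
  by (auto intro: computable_add computable_mult computable_diff computable_prod_encode)

lemma unary_computable_Suc [computable_intros]:
  "unary_computable F \<Longrightarrow> unary_computable (\<lambda>e. Suc (F e))"
  unfolding unary_computable_def by (rule computable_Suc)

lemma unary_computable_pfst [computable_intros]:
  "unary_computable F \<Longrightarrow> unary_computable (\<lambda>e. pfst (F e))"
  unfolding unary_computable_def by (rule computable_pfst)

lemma unary_computable_psnd [computable_intros]:
  "unary_computable F \<Longrightarrow> unary_computable (\<lambda>e. psnd (F e))"
  unfolding unary_computable_def by (rule computable_psnd)

text \<open>Environment \<open>e\<close>, counter \<open>k\<close> and previous value
  \<open>r\<close> are packed as \<open>prod_encode (e, prod_encode (k, r))\<close>.\<close>

lemma unary_computable_rec_nat [computable_intros]: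
  assumes "unary_computable B" "unary_computable H"
    and S: "unary_computable (\<lambda>z. S (pfst z) (pfst (psnd z)) (psnd (psnd z)))"
  shows "unary_computable (\<lambda>e. rec_nat (B e) (S e) (H e))"
proof -
  let ?S = "\<lambda>z. S (pfst z) (pfst (psnd z)) (psnd (psnd z))"
  let ?G = "\<lambda>ys :: nat list. prod_encode (ys ! 2, prod_encode (ys ! 0, ys ! 1))"
  have "computable 3 ?G" by (intro computable_prod_encode computable_proj) simp_all
  then have "computable 3 (\<lambda>ys. ?S (?G ys))"
    using computable_comp[of "[?G]" "\<lambda>xs. ?S (xs ! 0)" 3] S
    unfolding unary_computable_def by simp
  then have "computable (1 + 2) (\<lambda>ys. S (drop 2 ys ! 0) (ys ! 0) (ys ! 1))"
    by (simp add: numeral_3_eq_3) (erule computable_cong, simp add: numeral_2_eq_2)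
  then show ?thesis using assms computable_rec_nat[of 1 _ _ "\<lambda>xs. S (xs ! 0)"]
    unfolding unary_computable_def by blast
qed

lemma unary_computable_sum [computable_intros]:
  assumes "unary_computable H" "unary_computable (\<lambda>z. G (pfst z) (psnd z))"
  shows "unary_computable (\<lambda>e. \<Sum>k<H e. G e k)"
proof -
  \<comment> \<open>The assumption concerns the environment extended by \<open>k\<close>; inside the
    recursion the previous value is packed too and has to be dropped first.\<close>
  have "unary_computable (\<lambda>z. (\<lambda>z. G (pfst z) (psnd z)) (prod_encode (pfst z, pfst (psnd z))))"
    by (rule unary_computable_comp[OF assms(2)]) (intro computable_intros)
  then have "unary_computable (\<lambda>z. G (pfst z) (pfst (psnd z)))" by simp
  then have "unary_computable (\<lambda>e. rec_nat 0 (\<lambda>k r. r + G e k) (H e))"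
    by (intro computable_intros assms)
  moreover have "rec_nat 0 (\<lambda>k r. r + f k) b = (\<Sum>k<b. f k)" for f :: "nat \<Rightarrow> nat" and b
    by (induction b) auto
  ultimately show ?thesis by simp
qed

lemma unary_computable_prod [computable_intros]:
  assumes "unary_computable H" "unary_computable (\<lambda>z. G (pfst z) (psnd z))"
  shows "unary_computable (\<lambda>e. \<Prod>k<H e. G e k)"
proof -
  have "unary_computable (\<lambda>z. (\<lambda>z. G (pfst z) (psnd z)) (prod_encode (pfst z, pfst (psnd z))))"
    by (rule unary_computable_comp[OF assms(2)]) (intro computable_intros)
  then have "unary_computable (\<lambda>z. G (pfst z) (pfst (psnd z)))" by simp
  then have "unary_computable (\<lambda>e. rec_nat 1 (\<lambda>k r. r * G e k) (H e))"
    by (intro computable_intros assms)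
  moreover have "rec_nat 1 (\<lambda>k r. r * f k) b = (\<Prod>k<b. f k)" for f :: "nat \<Rightarrow> nat" and b
    by (induction b) auto
  ultimately show ?thesis by simp
qed

lemma unary_computable_power [computable_intros]:
  assumes "unary_computable F" "unary_computable G"
  shows "unary_computable (\<lambda>e. F e ^ G e)"
proof -
  \<comment> \<open>Inside the recursion \<open>F\<close> is applied to the environment component of
    the packed argument, hence the extra composition rule.\<close>
  have "unary_computable (\<lambda>e. rec_nat 1 (\<lambda>k r. r * F e) (G e))"
    by (intro computable_intros assms unary_computable_comp[OF assms(1)])
  moreover have "rec_nat 1 (\<lambda>k r. r * a) b = a ^ b" for a b :: nat by (induction b) auto
  ultimately show ?thesis by simp
qed

lemma unary_computable_fact [computable_intros]:
  assumes "unary_computable F"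
  shows "unary_computable (\<lambda>e. fact (F e))"
proof -
  have "unary_computable (\<lambda>e. rec_nat 1 (\<lambda>k r. Suc k * r) (F e))"
    by (intro computable_intros assms)
  moreover have "rec_nat 1 (\<lambda>k r. Suc k * r) b = fact b" for b :: nat by (induction b) auto
  ultimately show ?thesis by simp
qed

section \<open>Decidable predicates as 0-1 functions, division\<close>

lemma unary_computable_less [computable_intros]:
  assumes "unary_computable F" "unary_computable G"
  shows "unary_computable (\<lambda>e. of_bool (F e < G e))"
proof -
  have "unary_computable (\<lambda>e. 1 - (1 - (G e - F e)))" by (intro computable_intros assms)
  moreover have "1 - (1 - (b - a)) = of_bool (a < b)" for a b :: nat by auto
  ultimately show ?thesis by simp
qed

lemma unary_computable_le [computable_intros]:
  assumes "unary_computable F" "unary_computable G"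
  shows "unary_computable (\<lambda>e. of_bool (F e \<le> G e))"
proof -
  have "unary_computable (\<lambda>e. 1 - (F e - G e))" by (intro computable_intros assms)
  moreover have "1 - (a - b) = of_bool (a \<le> b)" for a b :: nat by auto
  ultimately show ?thesis by simp
qed

lemma unary_computable_conj [computable_intros]:
  assumes "unary_computable (\<lambda>e. of_bool (P e))" "unary_computable (\<lambda>e. of_bool (Q e))"
  shows "unary_computable (\<lambda>e. of_bool (P e \<and> Q e))"
proof -
  have "unary_computable (\<lambda>e. of_bool (P e) * of_bool (Q e))" by (intro computable_intros assms)
  moreover have "of_bool p * of_bool q = (of_bool (p \<and> q) :: nat)" for p q by auto
  ultimately show ?thesis by simp
qed

lemma unary_computable_not [computable_intros]:
  assumes "unary_computable (\<lambda>e. of_bool (P e))"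
  shows "unary_computable (\<lambda>e. of_bool (\<not> P e))"
proof -
  have "unary_computable (\<lambda>e. 1 - of_bool (P e))" by (intro computable_intros assms)
  moreover have "1 - of_bool p = (of_bool (\<not> p) :: nat)" for p by auto
  ultimately show ?thesis by simp
qed

lemma unary_computable_eq [computable_intros]:
  assumes "unary_computable F" "unary_computable G"
  shows "unary_computable (\<lambda>e. of_bool (F e = G e))"
proof -
  have "unary_computable (\<lambda>e. of_bool (F e \<le> G e \<and> G e \<le> F e))" by (intro computable_intros assms)
  moreover have "a \<le> b \<and> b \<le> a \<longleftrightarrow> a = b" for a b :: nat by auto
  ultimately show ?thesis by simp
qed

lemma unary_computable_all [computable_intros]:
  assumes "unary_computable H" "unary_computable (\<lambda>z. of_bool (P (pfst z) (psnd z)))"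
  shows "unary_computable (\<lambda>e. of_bool (\<forall>k<H e. P e k))"
proof -
  have "unary_computable (\<lambda>e. \<Prod>k<H e. of_bool (P e k))" by (intro computable_intros assms)
  moreover have "(\<Prod>k<h. of_bool (p k)) = (of_bool (\<forall>k<h. p k) :: nat)" for h and p :: "nat \<Rightarrow> bool"
    by (induction h) (auto simp: less_Suc_eq)
  ultimately show ?thesis by simp
qed

lemma unary_computable_ex [computable_intros]:
  assumes "unary_computable H" "unary_computable (\<lambda>z. of_bool (P (pfst z) (psnd z)))"
  shows "unary_computable (\<lambda>e. of_bool (\<exists>k<H e. P e k))"
proof -
  have "unary_computable (\<lambda>e. of_bool (\<not> (\<forall>k<H e. \<not> P e k)))" by (intro computable_intros assms)
  then show ?thesis by simp
qed

lemma unary_computable_if [computable_intros]: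
  assumes "unary_computable (\<lambda>e. of_bool (P e))" "unary_computable F" "unary_computable G"
  shows "unary_computable (\<lambda>e. if P e then F e else G e)"
proof -
  have "unary_computable (\<lambda>e. of_bool (P e) * F e + (1 - of_bool (P e)) * G e)"
    by (intro computable_intros assms)
  moreover have "of_bool p * a + (1 - of_bool p) * b = (if p then a else b)" for p and a b :: nat
    by auto
  ultimately show ?thesis by simp
qed

text \<open>The quotient is the number of positive multiples of the divisor up to the dividend; the
  guard makes the count 0 for divisor 0, in accordance with \<open>div\<close>.\<close>

lemma unary_computable_div [computable_intros]:
  assumes "unary_computable F" "unary_computable G"
  shows "unary_computable (\<lambda>e. F e div G e)"
proof -
  have "unary_computable (\<lambda>e. \<Sum>k<F e. of_bool (0 < G e \<and> Suc k * G e \<le> F e))"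
    by (intro computable_intros assms unary_computable_comp[OF assms(1)] unary_computable_comp[OF assms(2)])
  moreover have "(\<Sum>k<a. of_bool (0 < b \<and> Suc k * b \<le> a)) = a div b" for a b :: nat
  proof (cases "b = 0")
    case False
    have "(\<Sum>k<a. of_bool (0 < b \<and> Suc k * b \<le> a)) = card ({..<a} \<inter> {k. 0 < b \<and> Suc k * b \<le> a})"
      by (simp add: of_bool_def sum.If_cases)
    also have "{..<a} \<inter> {k. 0 < b \<and> Suc k * b \<le> a} = {..<a div b}"
    proof -
      have iff: "Suc k * b \<le> a \<longleftrightarrow> k < a div b" for k
        using False less_eq_div_iff_mult_less_eq[of b "Suc k" a] by (simp add: Suc_le_eq)
      have "k < a" if "k < a div b" for k using that div_le_dividend[of a b] by linarith
      then show ?thesis unfolding iff using False by blast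
    qed
    finally show ?thesis by simp
  qed simp
  ultimately show ?thesis by simp
qed

lemma unary_computable_mod [computable_intros]:
  assumes "unary_computable F" "unary_computable G"
  shows "unary_computable (\<lambda>e. F e mod G e)"
proof -
  have "unary_computable (\<lambda>e. F e - F e div G e * G e)" by (intro computable_intros assms)
  then show ?thesis by (simp add: minus_div_mult_eq_mod)
qed

subsection \<open>Coded lists\<close>

text \<open>\<open>list_encode (x # xs)\<close> is
  \<open>Suc (prod_encode (x, list_encode xs))\<close>, hence the predecessor. The empty list has
  code 0, which is a fixed point because \<open>psnd 0 = 0\<close>.\<close>

definition code_drop :: "nat \<Rightarrow> nat \<Rightarrow> nat" where
  "code_drop c i = rec_nat c (\<lambda>k r. psnd (r - 1)) i"

definition code_nth :: "nat \<Rightarrow> nat \<Rightarrow> nat" where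
  "code_nth c i = pfst (code_drop c i - 1)"

text \<open>Counts nonempty suffixes; the code itself bounds their number.\<close>

definition code_length :: "nat \<Rightarrow> nat" where
  "code_length c = (\<Sum>i<c. of_bool (code_drop c i \<noteq> 0))"

lemma code_drop_encode: "code_drop (list_encode xs) i = list_encode (drop i xs)"
proof (induction i)
  case (Suc i)
  have "psnd (list_encode ys - 1) = list_encode (tl ys)" for ys
  proof (cases ys)
    case Nil
    have "prod_encode (0, 0) = 0" by (simp add: prod_encode_def)
    then have "psnd 0 = 0" by (metis psnd_encode)
    then show ?thesis using Nil by simp
  qed simp
  then show ?case using Suc by (simp add: code_drop_def tl_drop drop_Suc)
qed (simp add: code_drop_def)

lemma code_nth_encode: "i < length xs \<Longrightarrow> code_nth (list_encode xs) i = xs ! i"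
  by (simp add: code_nth_def code_drop_encode Cons_nth_drop_Suc[symmetric])

lemma length_le_list_encode: "length xs \<le> list_encode xs"
proof (induction xs)
  case (Cons x xs)
  then show ?case using le_prod_encode_2[of "list_encode xs" x] by simp
qed simp

lemma code_length_encode: "code_length (list_encode xs) = length xs"
proof -
  have "list_encode ys = 0 \<longleftrightarrow> ys = []" for ys by (cases ys) auto
  then have "code_length (list_encode xs) = (\<Sum>i<list_encode xs. if i < length xs then 1 else 0)"
    unfolding code_length_def code_drop_encode by (intro sum.cong) auto
  also have "\<dots> = card ({..<list_encode xs} \<inter> {i. i < length xs})" by (simp add: sum.If_cases)
  also have "{..<list_encode xs} \<inter> {i. i < length xs} = {..<length xs}"
    using length_le_list_encode[of xs] by auto
  finally show ?thesis by simp
qed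

text \<open>Makes the nested list of \<open>super_operator_encode\<close> accessible by one
  row-major index.\<close>

lemma concat_map_upt:
  "concat (map (\<lambda>k. map (f k) [0..<d]) [0..<n]) = map (\<lambda>b. f (b div d) (b mod d)) [0..<n * d]"
proof (induction n)
  case (Suc n)
  have "[0..<Suc n * d] = [0..<n * d] @ map (\<lambda>l. n * d + l) [0..<d]"
    using upt_add_eq_append[of 0 "n * d" d] map_add_upt[of "n * d" d] by (simp add: add.commute)
  then show ?case using Suc by simp
qed simp

lemma unary_computable_code_drop [computable_intros]:
  assumes "unary_computable C" "unary_computable I"
  shows "unary_computable (\<lambda>e. code_drop (C e) (I e))"
  unfolding code_drop_def by (intro computable_intros assms)

lemma unary_computable_code_nth [computable_intros]:
  assumes "unary_computable C" "unary_computable I"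
  shows "unary_computable (\<lambda>e. code_nth (C e) (I e))"
  unfolding code_nth_def by (intro computable_intros assms)

lemma unary_computable_code_length [computable_intros]:
  assumes "unary_computable C"
  shows "unary_computable (\<lambda>e. code_length (C e))"
  unfolding code_length_def by (intro computable_intros assms unary_computable_comp[OF assms])

text \<open>The list grows from its last element, so step \<open>k\<close> prepends the entry with
  index \<open>H e - Suc k\<close>.\<close>

lemma unary_computable_tabulate [computable_intros]:
  assumes "unary_computable H" "unary_computable (\<lambda>z. G (pfst z) (psnd z))"
  shows "unary_computable (\<lambda>e. list_encode (map (G e) [0..<H e]))"
proof -
  let ?I = "\<lambda>z. prod_encode (pfst z, H (pfst z) - Suc (pfst (psnd z)))"
  have "unary_computable (\<lambda>z. (\<lambda>z. G (pfst z) (psnd z)) (?I z))"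
    by (rule unary_computable_comp[OF assms(2)])
      (intro computable_intros unary_computable_comp[OF assms(1)])
  then have "unary_computable (\<lambda>z. G (pfst z) (H (pfst z) - Suc (pfst (psnd z))))" by simp
  then have "unary_computable
      (\<lambda>e. rec_nat 0 (\<lambda>k r. Suc (prod_encode (G e (H e - Suc k), r))) (H e))"
    by (intro computable_intros assms)
  moreover have "rec_nat 0 (\<lambda>k r. Suc (prod_encode (f (h - Suc k), r))) j
      = list_encode (map f [h - j..<h])" if "j \<le> h" for f h j
    using that
  proof (induction j)
    case (Suc j)
    have "[h - Suc j..<h] = (h - Suc j) # [h - j..<h]"
      using Suc.prems by (subst upt_conv_Cons) (auto simp: Suc_diff_Suc)
    then show ?case using Suc by simp
  qed simp
  ultimately show ?thesis by simp
qed

section \<open>Gaussian integers as quadruples\<close>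

text \<open>A quadruple \<open>F\<close> of natural numbers stands for the Gaussian integer \<open>\<Sum>k<4. F k * \<i> ^ k\<close>.
  Multiplication is then cyclic convolution, without signs.\<close>

definition gauss_value :: "(nat \<Rightarrow> nat) \<Rightarrow> complex" where
  "gauss_value F = (\<Sum>k<4. of_nat (F k) * \<i> ^ k)"

lemma sum_less_4: "(\<Sum>k<4. f k) = f 0 + f 1 + f 2 + f (3::nat)"
  for f :: "nat \<Rightarrow> 'a::comm_monoid_add"
  by (simp add: eval_nat_numeral add.assoc)

lemma gauss_value_expand:
  "gauss_value F = of_nat (F 0) + of_nat (F 1) * \<i> - of_nat (F 2) - of_nat (F 3) * \<i>"
  unfolding gauss_value_def sum_less_4 by (simp add: power3_eq_cube)

lemma gauss_value_zero_iff: "gauss_value F = 0 \<longleftrightarrow> F 0 = F 2 \<and> F 1 = F 3"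
  unfolding gauss_value_expand by (auto simp: complex_eq_iff)

text \<open>For \<open>k < 4\<close> the index \<open>(m + 4 - k) mod 4\<close> is
  \<open>m - k\<close> modulo 4, protected against truncated subtraction.\<close>

lemma gauss_value_conv:
  "gauss_value (\<lambda>m. \<Sum>k<4. F k * G ((m + 4 - k) mod 4)) = gauss_value F * gauss_value G"
  unfolding gauss_value_expand sum_less_4 
  by (simp add: complex_eq_iff algebra_simps) (simp add: eval_nat_numeral)

lemma gauss_value_sum: "gauss_value (\<lambda>m. \<Sum>b<n. F b m) = (\<Sum>b<n. gauss_value (F b))"
  unfolding gauss_value_def of_nat_sum sum_distrib_right by (rule sum.swap)

lemma gauss_value_sum_conv:
  "gauss_value (\<lambda>m. \<Sum>b<n. \<Sum>k<4. F b k * G b ((m + 4 - k) mod 4)) =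
    (\<Sum>b<n. gauss_value (F b) * gauss_value (G b))"
  by (subst gauss_value_sum, rule sum.cong[OF refl], rule gauss_value_conv)

lemma gauss_value_cong: "(\<And>k. k < 4 \<Longrightarrow> F k = G k) \<Longrightarrow> gauss_value F = gauss_value G"
  unfolding gauss_value_def by simp

text \<open>The positive or negative part of \<open>B\<close> times the rational with code
  \<open>r\<close>. \<open>int_encode\<close> maps \<open>a \<ge> 0\<close> to \<open>2 * a\<close>
  and \<open>a < 0\<close> to the odd number \<open>2 * (- a - 1) + 1\<close>, and the positive
  denominator is half its code. The division is exact if the denominator divides
  \<open>B\<close>.\<close>

definition rat_part :: "nat \<Rightarrow> nat \<Rightarrow> bool \<Rightarrow> nat" where
  "rat_part B r neg = B div (psnd r div 2) *
    (if pfst r mod 2 = 0 then if neg then 0 else pfst r div 2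
     else if neg then Suc (pfst r div 2) else 0)"

text \<open>Components 0 to 3 are the positive real, positive imaginary, negative real and negative
  imaginary part.\<close>

definition gauss_part :: "nat \<Rightarrow> nat \<Rightarrow> nat \<Rightarrow> nat" where
  "gauss_part B c k = rat_part B (if k mod 2 = 0 then pfst c else psnd c) (2 \<le> k)"

lemma pfst_le: "pfst z \<le> z"
  using le_prod_encode_1[of "pfst z" "psnd z"] unfolding prod_encode_pfst_psnd .

lemma psnd_le: "psnd z \<le> z"
  using le_prod_encode_2[of "psnd z" "pfst z"] unfolding prod_encode_pfst_psnd .

text \<open>Together with \<open>pfst_le\<close> and \<open>psnd_le\<close>: whatever is decoded
  from a code is at most that code.\<close>

lemma code_nth_le: "code_nth c i \<le> c"
proof -
  have "code_drop c i \<le> c"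
  proof (induction i)
    case (Suc i)
    have "code_drop c (Suc i) = psnd (code_drop c i - 1)" by (simp add: code_drop_def)
    then show ?case using psnd_le[of "code_drop c i - 1"] Suc by linarith
  qed (simp add: code_drop_def)
  then show ?thesis unfolding code_nth_def using pfst_le[of "code_drop c i - 1"] by linarith
qed

text \<open>The denominator is at most \<open>e\<close>, being part of a code that is at most
  \<open>e\<close>, and so it divides \<open>fact e\<close>.\<close>

lemma rat_part_value:
  fixes x :: real
  assumes x: "x \<in> \<rat>" and e: "rat_encode (the_inv of_rat x) \<le> e"
  shows "real (rat_part (fact e) (rat_encode (the_inv of_rat x)) False)
    - real (rat_part (fact e) (rat_encode (the_inv of_rat x)) True) = fact e * x"
proof -
  from x obtain q where q: "x = of_rat q" by (auto elim: Rats_cases)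
  have inj: "inj (of_rat :: rat \<Rightarrow> real)" by (simp add: inj_def)
  then have inv: "the_inv of_rat x = q" unfolding q by (rule the_inv_f_f)
  obtain a b where ab: "quotient_of q = (a, b)" by (cases "quotient_of q") auto
  have b: "b > 0" using quotient_of_denom_pos[OF ab] .
  have "q = of_int a / of_int b" by (rule quotient_of_div[OF ab])
  then have x_ab: "x = of_int a / of_int b" unfolding q by (simp add: of_rat_divide)
  let ?r = "rat_encode (the_inv of_rat x)"
  have r: "?r = prod_encode (int_encode a, int_encode b)" unfolding inv rat_encode_def ab by simp
  have den: "psnd ?r div 2 = nat b"
    unfolding r using b by (simp add: int_encode_def sum_encode_def)
  have "nat b \<le> e" using den psnd_le[of ?r] e by linarith
  then have dvd: "nat b dvd fact e" using b by (intro dvd_fact) auto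
  have quot: "real (fact e div nat b) = fact e / of_int b"
    using real_of_nat_div[OF dvd] b by simp
  show ?thesis
  proof (cases "0 \<le> a")
    case True
    then have "pfst ?r = 2 * nat a" unfolding r by (simp add: int_encode_def sum_encode_def)
    then show ?thesis unfolding rat_part_def den using True quot x_ab by simp
  next
    case False
    then have "pfst ?r = Suc (2 * nat (- a - 1))" unfolding r
      by (simp add: int_encode_def sum_encode_def)
    then have "pfst ?r mod 2 = 1" "Suc (pfst ?r div 2) = nat (- a)" using False by auto
    then show ?thesis unfolding rat_part_def den using False quot x_ab by simp
  qed
qed

lemma gauss_part_value:
  assumes z: "rational_complex z" and e: "complex_encode z \<le> e"
  shows "gauss_value (gauss_part (fact e) (complex_encode z)) = fact e * z"
proof -
  have c: "pfst (complex_encode z) = rat_encode (the_inv of_rat (Re z))"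
    "psnd (complex_encode z) = rat_encode (the_inv of_rat (Im z))"
    unfolding complex_encode_def by simp_all
  have le: "rat_encode (the_inv of_rat (Re z)) \<le> e" "rat_encode (the_inv of_rat (Im z)) \<le> e"
    using c pfst_le[of "complex_encode z"] psnd_le[of "complex_encode z"] e by linarith+
  have "Re z \<in> \<rat>" "Im z \<in> \<rat>" using z unfolding rational_complex_def by auto
  note rat_part_value[OF this(1) le(1)] rat_part_value[OF this(2) le(2)]
  then show ?thesis unfolding gauss_value_expand gauss_part_def c
    by (simp add: complex_eq_iff)
qed

section \<open>The decision procedure\<close>

definition entry_code :: "nat \<Rightarrow> nat \<Rightarrow> nat \<Rightarrow> nat" where
  "entry_code c i j = code_nth (code_nth c i) j"

text \<open>Throughout, \<open>e\<close> is the code of the instance, with the automaton in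
  \<open>pfst e\<close> and the disjuncts in \<open>psnd e\<close>; \<open>fact e\<close> is the
  common denominator.\<close>

definition prog_dim :: "nat \<Rightarrow> nat" where "prog_dim e = code_nth (pfst e) 0"

definition prog_size :: "nat \<Rightarrow> nat" where "prog_size e = prog_dim e * prog_dim e"

definition prog_letters :: "nat \<Rightarrow> nat" where "prog_letters e = code_length (code_nth (pfst e) 1)"

definition prog_disjuncts :: "nat \<Rightarrow> nat" where "prog_disjuncts e = code_length (psnd e)"

definition prog_init :: "nat \<Rightarrow> nat \<Rightarrow> nat \<Rightarrow> nat" where
  "prog_init e a k =
    gauss_part (fact e) (entry_code (code_nth (pfst e) 2) (a div prog_dim e) (a mod prog_dim e)) k"

definition prog_step :: "nat \<Rightarrow> nat \<Rightarrow> nat \<Rightarrow> nat \<Rightarrow> nat \<Rightarrow> nat" where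
  "prog_step e \<alpha> a b k = gauss_part (fact e)
    (entry_code (code_nth (psnd (code_nth (code_nth (pfst e) 1) \<alpha>)) b)
      (a div prog_dim e) (a mod prog_dim e)) k"

text \<open>The subtracted identity goes into component 2, the negative real one, with the same
  scaling \<open>fact e\<close>.\<close>

definition prog_defect :: "nat \<Rightarrow> nat \<Rightarrow> nat \<Rightarrow> nat \<Rightarrow> nat \<Rightarrow> nat" where
  "prog_defect e i q b k =
    (if b mod prog_dim e = q mod prog_dim e
     then gauss_part (fact e) (entry_code (code_nth (psnd e) i) (q div prog_dim e) (b div prog_dim e)) k
     else 0) + (if b = q \<and> k = 2 then fact e else 0)"

text \<open>Finite words are numbers in base \<open>prog_letters e\<close>, lowest digit
  first.\<close>

definition prog_digit :: "nat \<Rightarrow> nat \<Rightarrow> nat \<Rightarrow> nat" where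
  "prog_digit e w j = w div prog_letters e ^ j mod prog_letters e"

text \<open>A vector is one coded list, with component \<open>k\<close> of coordinate
  \<open>b\<close> at position \<open>4 * b + k\<close>. Nothing is ever divided: after
  \<open>j\<close> steps the vector carries the factor \<open>fact e ^ Suc j\<close>.\<close>

definition prog_state :: "nat \<Rightarrow> nat \<Rightarrow> nat \<Rightarrow> nat" where
  "prog_state e w j = rec_nat
    (list_encode (map (\<lambda>i. prog_init e (i div 4) (i mod 4)) [0..<4 * prog_size e]))
    (\<lambda>j X. list_encode (map (\<lambda>i. \<Sum>b<prog_size e. \<Sum>k<4.
        prog_step e (prog_digit e w j) (i div 4) b k * code_nth X (4 * b + (i mod 4 + 4 - k) mod 4))
      [0..<4 * prog_size e])) j"

definition prog_value :: "nat \<Rightarrow> nat \<Rightarrow> nat \<Rightarrow> nat \<Rightarrow> nat \<Rightarrow> nat" where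
  "prog_value e X i q m =
    (\<Sum>b<prog_size e. \<Sum>k<4. prog_defect e i q b k * code_nth X (4 * b + (m + 4 - k) mod 4))"

text \<open>The equations between components express that the scaled defect is zero, as in
  \<open>gauss_value_zero_iff\<close>.\<close>

definition prog_bad :: "nat \<Rightarrow> nat \<Rightarrow> bool" where
  "prog_bad e X \<longleftrightarrow> (\<forall>i<prog_disjuncts e. \<exists>q<prog_size e.
    \<not> (prog_value e X i q 0 = prog_value e X i q 2 \<and> prog_value e X i q 1 = prog_value e X i q 3))"

text \<open>\<open>bad_count_bound\<close> of the linear system, as an expression in the instance
  code.\<close>

definition prog_count_bound :: "nat \<Rightarrow> nat" where
  "prog_count_bound e = ((prog_size e * prog_size e) ^ prog_size e + 2) ^ prog_size e + 1"

definition prog_length_bound :: "nat \<Rightarrow> nat" where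
  "prog_length_bound e =
    prog_count_bound e * Suc (prog_size e) ^ (prog_disjuncts e * prog_count_bound e)"

text \<open>Exhaustive search for a refuting word; positions start at 1, as in
  \<open>infinitely_bad_iff\<close>.\<close>

definition prog_decide :: "nat \<Rightarrow> nat" where
  "prog_decide e = of_bool (\<not> (\<exists>w<prog_letters e ^ prog_length_bound e. prog_count_bound e
    \<le> (\<Sum>j<prog_length_bound e. of_bool (prog_bad e (prog_state e w (Suc j))))))"

section \<open>Computability of the procedure\<close>

lemma unary_computable_rat_part [computable_intros]:
  assumes "unary_computable B" "unary_computable R" "unary_computable (\<lambda>e. of_bool (N e))"
  shows "unary_computable (\<lambda>e. rat_part (B e) (R e) (N e))"
  unfolding rat_part_def by (intro computable_intros assms)

lemma unary_computable_gauss_part [computable_intros]: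
  assumes "unary_computable B" "unary_computable C" "unary_computable K"
  shows "unary_computable (\<lambda>e. gauss_part (B e) (C e) (K e))"
  unfolding gauss_part_def by (intro computable_intros assms)

lemma unary_computable_entry_code [computable_intros]:
  assumes "unary_computable C" "unary_computable I" "unary_computable J"
  shows "unary_computable (\<lambda>e. entry_code (C e) (I e) (J e))"
  unfolding entry_code_def by (intro computable_intros assms)

lemma unary_computable_prog_params [computable_intros]:
  assumes "unary_computable E"
  shows "unary_computable (\<lambda>e. prog_dim (E e))" "unary_computable (\<lambda>e. prog_size (E e))"
    "unary_computable (\<lambda>e. prog_letters (E e))" "unary_computable (\<lambda>e. prog_disjuncts (E e))"
  unfolding prog_size_def prog_dim_def prog_letters_def prog_disjuncts_def
  by (intro computable_intros assms)+

lemma unary_computable_prog_bounds [computable_intros]: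
  assumes "unary_computable E"
  shows "unary_computable (\<lambda>e. prog_count_bound (E e))" "unary_computable (\<lambda>e. prog_length_bound (E e))"
  unfolding prog_length_bound_def prog_count_bound_def by (intro computable_intros assms)+

lemma unary_computable_prog_init [computable_intros]:
  assumes "unary_computable E" "unary_computable A" "unary_computable K"
  shows "unary_computable (\<lambda>e. prog_init (E e) (A e) (K e))"
  unfolding prog_init_def by (intro computable_intros assms)

lemma unary_computable_prog_step [computable_intros]:
  assumes "unary_computable E" "unary_computable L" "unary_computable A" "unary_computable B"
    "unary_computable K"
  shows "unary_computable (\<lambda>e. prog_step (E e) (L e) (A e) (B e) (K e))"
  unfolding prog_step_def by (intro computable_intros assms)

lemma unary_computable_prog_defect [computable_intros]:
  assumes "unary_computable E" "unary_computable I" "unary_computable Q" "unary_computable B"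
    "unary_computable K"
  shows "unary_computable (\<lambda>e. prog_defect (E e) (I e) (Q e) (B e) (K e))"
  unfolding prog_defect_def by (intro computable_intros assms)

lemma unary_computable_prog_digit [computable_intros]:
  assumes "unary_computable E" "unary_computable W" "unary_computable J"
  shows "unary_computable (\<lambda>e. prog_digit (E e) (W e) (J e))"
  unfolding prog_digit_def by (intro computable_intros assms)

lemma unary_computable_prog_state [computable_intros]:
  assumes "unary_computable E" "unary_computable W" "unary_computable J"
  shows "unary_computable (\<lambda>e. prog_state (E e) (W e) (J e))"
  unfolding prog_state_def
  by (intro computable_intros assms unary_computable_comp[OF assms(1)] unary_computable_comp[OF assms(2)])

lemma unary_computable_prog_value [computable_intros]:
  assumes "unary_computable E" "unary_computable X" "unary_computable I" "unary_computable Q"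
    "unary_computable K"
  shows "unary_computable (\<lambda>e. prog_value (E e) (X e) (I e) (Q e) (K e))"
  unfolding prog_value_def by (intro computable_intros assms assms[THEN unary_computable_comp])

lemma unary_computable_prog_bad [computable_intros]:
  assumes "unary_computable E" "unary_computable X"
  shows "unary_computable (\<lambda>e. of_bool (prog_bad (E e) (X e)))"
  unfolding prog_bad_def by (intro computable_intros assms assms[THEN unary_computable_comp])

lemma unary_computable_prog_decide: "unary_computable prog_decide"
proof -
  have "unary_computable (\<lambda>e. prog_decide e)"
    unfolding prog_decide_def by (intro computable_intros)
  then show ?thesis by simp
qed

section \<open>Correctness of the procedure on codes of instances\<close>

text \<open>If \<open>c\<close> codes the shifted word, then \<open>w 0 + m * c\<close> codes the
  word itself.\<close>

lemma digits_exist: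
  assumes "\<And>i. w i < (m::nat)"
  shows "\<exists>c<m ^ L. \<forall>j<L. c div m ^ j mod m = w j"
  using assms
proof (induction L arbitrary: w)
  case (Suc L)
  from Suc.IH[of "\<lambda>i. w (Suc i)"] Suc.prems obtain c where
    c: "c < m ^ L" "\<And>j. j < L \<Longrightarrow> c div m ^ j mod m = w (Suc j)" by auto
  let ?c = "w 0 + m * c"
  have w0: "w 0 < m" by (rule Suc.prems)
  have "?c < m * Suc c" using w0 by simp
  also have "\<dots> \<le> m ^ Suc L" using c(1) by (simp only: power_Suc) (intro mult_left_mono, auto)
  finally have "?c < m ^ Suc L" .
  moreover have "?c div m ^ j mod m = w j" if "j < Suc L" for j
  proof (cases j)
    case 0
    then show ?thesis using w0 by simp
  next
    case (Suc j')
    have "?c div m ^ j = ?c div m div m ^ j'" unfolding Suc by (simp add: div_mult2_eq)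
    also have "?c div m = c" using w0 by simp
    finally show ?thesis using c(2) that Suc by simp
  qed
  ultimately show ?case by blast
qed simp

lemma sum_of_bool_Suc:
  "(\<Sum>j<L. of_bool (p (Suc j))) = card {j. 0 < j \<and> j \<le> L \<and> p j}"
proof -
  have "{j. 0 < j \<and> j \<le> L \<and> p j} = Suc ` {j \<in> {..<L}. p (Suc j)}"
  proof (intro equalityI subsetI)
    fix j assume "j \<in> {j. 0 < j \<and> j \<le> L \<and> p j}"
    then show "j \<in> Suc ` {j \<in> {..<L}. p (Suc j)}" by (intro image_eqI[of _ _ "j - 1"]) auto
  qed auto
  then have "card {j. 0 < j \<and> j \<le> L \<and> p j} = card {j \<in> {..<L}. p (Suc j)}"
    by (simp add: card_image)
  also have "\<dots> = (\<Sum>j<L. of_bool (p (Suc j)))"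
    by (simp add: of_bool_def sum.If_cases Int_def)
  finally show ?thesis by simp
qed

context rational_instance
begin

abbreviation "code \<equiv> instance_encode (\<A>, \<phi>)"

lemma code_parts:
  "pfst code = automaton_encode \<A>" "psnd code = list_encode (map mat_encode \<phi>)"
  by (simp_all add: instance_encode_def)

lemma automaton_parts:
  "code_nth (pfst code) 0 = d"
  "code_nth (pfst code) 1 =
    list_encode (map (\<lambda>\<alpha>. prod_encode (\<alpha>, super_operator_encode d (qop \<A> \<alpha>))) acts)"
  "code_nth (pfst code) 2 = mat_encode (qinit \<A>)"
  unfolding code_parts automaton_encode_def by (subst code_nth_encode, simp, simp)+

lemma prog_params:
  "prog_dim code = d" "prog_size code = d * d" "prog_letters code = length acts"
  "prog_disjuncts code = length \<phi>"
  unfolding prog_size_def prog_dim_def prog_letters_def prog_disjuncts_def automaton_parts code_parts(2)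
  by (simp_all add: code_length_encode)

lemma prog_bounds:
  "prog_count_bound code = bad_count_bound" "prog_length_bound code = word_length_bound"
  unfolding prog_length_bound_def prog_count_bound_def word_length_bound_def bad_count_bound_def
    factor_bound_def prog_params by simp_all

lemma entry_value:
  assumes X: "X \<in> carrier_mat d d" "rational_mat X" and le: "mat_encode X \<le> code"
    and ij: "i < d" "j < d"
  shows "gauss_value (gauss_part (fact code) (entry_code (mat_encode X) i j)) = fact code * X $$ (i, j)"
proof -
  have entry: "entry_code (mat_encode X) i j = complex_encode (X $$ (i, j))"
    unfolding entry_code_def mat_encode_def mat_to_list_def using X(1) ij by (simp add: code_nth_encode)
  have "complex_encode (X $$ (i, j)) \<le> code"
    using code_nth_le[of "code_nth (mat_encode X) i" j] code_nth_le[of "mat_encode X" i] le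
    unfolding entry[symmetric] entry_code_def by linarith
  moreover have "rational_complex (X $$ (i, j))" using X ij unfolding rational_mat_def by simp
  ultimately show ?thesis unfolding entry by (rule gauss_part_value[rotated])
qed

lemma prog_init_value:
  assumes "a < d * d"
  shows "gauss_value (prog_init code a) = fact code * flat (qinit \<A>) a"
proof -
  have "mat_encode (qinit \<A>) \<le> code"
    using code_nth_le[of "pfst code" 2] pfst_le[of code] unfolding automaton_parts by linarith
  moreover have "qinit \<A> \<in> carrier_mat d d" "rational_mat (qinit \<A>)"
    using automaton rational
    unfolding quantum_automaton_def density_mat_def positive_mat_def rational_automaton_def by auto
  ultimately show ?thesis
    unfolding prog_init_def automaton_parts prog_params flat_def
    using entry_value flat_index[OF assms] by simp
qed

lemma prog_step_value:
  assumes \<alpha>: "\<alpha> < length acts" and a: "a < d * d" and b: "b < d * d"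
  shows "gauss_value (prog_step code \<alpha> a b) =
    fact code * flat (qop \<A> (acts ! \<alpha>) (matrix_unit d (b div d) (b mod d))) a"
proof -
  let ?c = "code_nth (code_nth (pfst code) 1) \<alpha>"
  let ?X = "qop \<A> (acts ! \<alpha>) (matrix_unit d (b div d) (b mod d))"
  have op: "psnd ?c = super_operator_encode d (qop \<A> (acts ! \<alpha>))"
    unfolding automaton_parts using \<alpha> by (simp add: code_nth_encode)
  have X: "code_nth (psnd ?c) b = mat_encode ?X"
    unfolding op super_operator_encode_def concat_map_upt using b by (simp add: code_nth_encode)
  have "mat_encode ?X \<le> code"
    unfolding X[symmetric]
    using code_nth_le[of "psnd ?c" b] psnd_le[of ?c] code_nth_le[of "code_nth (pfst code) 1" \<alpha>]
      code_nth_le[of "pfst code" 1] pfst_le[of code] by linarith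
  moreover have "?X \<in> carrier_mat d d"
    using automaton acts_nth[OF \<alpha>] super_operator_carrier
    unfolding quantum_automaton_def by (simp add: matrix_unit_def)
  moreover have "rational_mat ?X"
    using rational acts_nth[OF \<alpha>] flat_index[OF b]
    unfolding rational_automaton_def rational_super_operator_def by simp
  ultimately show ?thesis
    unfolding prog_step_def X prog_params flat_def using entry_value flat_index[OF a] by simp
qed

lemma prog_defect_value:
  assumes i: "i < length \<phi>" and q: "q < d * d" and b: "b < d * d"
  shows "gauss_value (prog_defect code i q b) =
    fact code * ((if b mod d = q mod d then \<phi> ! i $$ (q div d, b div d) else 0) - (if b = q then 1 else 0))"
proof -
  let ?P = "\<phi> ! i"
  have P: "code_nth (psnd code) i = mat_encode ?P"
    unfolding code_parts using i by (simp add: code_nth_encode)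
  have "mat_encode ?P \<le> code"
    using code_nth_le[of "psnd code" i] psnd_le[of code] unfolding P by linarith
  moreover have "?P \<in> carrier_mat d d" "rational_mat ?P"
    using projections[of ?P] i unfolding projection_mat_def by auto
  ultimately have val: "gauss_value (gauss_part (fact code) (entry_code (mat_encode ?P) (q div d) (b div d)))
      = fact code * ?P $$ (q div d, b div d)"
    using entry_value flat_index[OF q] flat_index[OF b] by blast
  have add: "gauss_value (\<lambda>k. F k + G k) = gauss_value F + gauss_value G" for F G
    unfolding gauss_value_expand by (simp add: algebra_simps)
  have neg: "gauss_value (\<lambda>k. if b = q \<and> k = 2 then fact code else 0) = (if b = q then - fact code else 0)"
    unfolding gauss_value_expand by simp
  have sel: "gauss_value (\<lambda>k. if b mod d = q mod d
      then gauss_part (fact code) (entry_code (mat_encode ?P) (q div d) (b div d)) k else 0) =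
      (if b mod d = q mod d then fact code * ?P $$ (q div d, b div d) else 0)"
    using val by (cases "b mod d = q mod d") (simp_all add: gauss_value_expand)
  have "prog_defect code i q b = (\<lambda>k. (if b mod d = q mod d
      then gauss_part (fact code) (entry_code (mat_encode ?P) (q div d) (b div d)) k else 0)
      + (if b = q \<and> k = 2 then fact code else 0))"
    unfolding prog_defect_def prog_params P by (rule ext) simp
  then have "gauss_value (prog_defect code i q b) =
      (if b mod d = q mod d then fact code * ?P $$ (q div d, b div d) else 0)
      + (if b = q then - fact code else 0)"
    by (simp only: add sel neg)
  then show ?thesis by (simp add: algebra_simps)
qed

text \<open>The assumption on the number of actions enters here: reduction modulo the number of
  letters yields a letter because that number is positive.\<close>

lemma prog_digit_less: "prog_digit code w j < length acts"
  using several_actions finite_acts unfolding prog_digit_def prog_params by simp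

text \<open>The initial state contributes one factor \<open>fact code\<close>, and by linearity so
  does each transition matrix.\<close>

lemma prog_state_value:
  assumes "a < d * d"
  shows "gauss_value (\<lambda>k. code_nth (prog_state code w j) (4 * a + k)) =
    fact code ^ Suc j * state (prog_digit code w) j a"
  using assms
proof (induction j arbitrary: a)
  case 0
  have "gauss_value (\<lambda>k. code_nth (prog_state code w 0) (4 * a + k)) = gauss_value (prog_init code a)"
  proof (rule gauss_value_cong)
    fix k :: nat assume "k < 4"
    then show "code_nth (prog_state code w 0) (4 * a + k) = prog_init code a k"
      using 0 unfolding prog_state_def prog_params by (simp add: code_nth_encode)
  qed
  then show ?case using prog_init_value[OF 0] by simp
next
  case (Suc j)
  let ?X = "prog_state code w j"
  let ?\<alpha> = "prog_digit code w j"
  let ?U = "\<lambda>b. flat (qop \<A> (acts ! ?\<alpha>) (matrix_unit d (b div d) (b mod d))) a"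
  have "gauss_value (\<lambda>k. code_nth (prog_state code w (Suc j)) (4 * a + k)) =
    gauss_value (\<lambda>m. \<Sum>b<d * d. \<Sum>k<4. prog_step code ?\<alpha> a b k * code_nth ?X (4 * b + (m + 4 - k) mod 4))"
  proof (rule gauss_value_cong)
    fix k :: nat assume "k < 4"
    then show "code_nth (prog_state code w (Suc j)) (4 * a + k) =
        (\<Sum>b<d * d. \<Sum>k'<4. prog_step code ?\<alpha> a b k' * code_nth ?X (4 * b + (k + 4 - k') mod 4))"
      using Suc.prems unfolding prog_state_def prog_params by (simp add: code_nth_encode)
  qed
  also have "\<dots> = (\<Sum>b<d * d. gauss_value (prog_step code ?\<alpha> a b) * gauss_value (\<lambda>k. code_nth ?X (4 * b + k)))"
    by (rule gauss_value_sum_conv)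
  also have "\<dots> = (\<Sum>b<d * d. fact code * ?U b * (fact code ^ Suc j * state (prog_digit code w) j b))"
    by (intro sum.cong refl) (simp only: lessThan_iff Suc.IH prog_step_value[OF prog_digit_less Suc.prems])
  also have "\<dots> = fact code ^ Suc (Suc j) * step ?\<alpha> (state (prog_digit code w) j) a"
    unfolding step_def sum_distrib_left by (simp add: mult_ac)
  finally show ?case by simp
qed

text \<open>The coefficients of the defect contribute one more factor \<open>fact code\<close>; the
  total factor is nonzero and leaves the zeros unchanged.\<close>

lemma prog_bad_iff:
  "prog_bad code (prog_state code w j) \<longleftrightarrow> bad (state (prog_digit code w) j)"
proof -
  let ?X = "prog_state code w j"
  let ?x = "state (prog_digit code w) j"
  have "prog_value code ?X i q 0 = prog_value code ?X i q 2 \<and>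
      prog_value code ?X i q 1 = prog_value code ?X i q 3 \<longleftrightarrow> defect i q ?x = 0"
    if i: "i < length \<phi>" and q: "q < d * d" for i q
  proof -
    let ?C = "\<lambda>b. (if b mod d = q mod d then \<phi> ! i $$ (q div d, b div d) else 0) - (if b = q then 1 else 0)"
    have "gauss_value (prog_value code ?X i q) =
        (\<Sum>b<d * d. gauss_value (prog_defect code i q b) * gauss_value (\<lambda>k. code_nth ?X (4 * b + k)))"
      unfolding prog_value_def prog_params by (rule gauss_value_sum_conv)
    also have "\<dots> = (\<Sum>b<d * d. fact code * ?C b * (fact code ^ Suc j * ?x b))"
      by (intro sum.cong refl) (simp only: lessThan_iff prog_state_value prog_defect_value[OF i q])
    also have "\<dots> = fact code ^ Suc (Suc j) * defect i q ?x"
      unfolding defect_def sum_distrib_left by (simp add: mult_ac)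
    finally have "gauss_value (prog_value code ?X i q) = fact code ^ Suc (Suc j) * defect i q ?x" .
    then show ?thesis using gauss_value_zero_iff[of "prog_value code ?X i q"] by simp
  qed
  then show ?thesis unfolding prog_bad_def bad_def prog_params by blast
qed

text \<open>The digits of a number form an infinite word of letters; conversely, only the first
  \<open>word_length_bound\<close> letters of a word affect the count, and some number in the search
  range has them as its digits.\<close>

lemma prog_decide_correct:
  "prog_decide code = (if eventually_always_valid \<A> \<phi> then 1 else 0)"
proof -
  let ?L = word_length_bound
  let ?N = bad_count_bound
  have count: "(\<Sum>j<?L. of_bool (bad (state w (Suc j)))) = card {j. 0 < j \<and> j \<le> ?L \<and> bad (state w j)}"
    for w
    by (rule sum_of_bool_Suc)
  have "(\<exists>w<length acts ^ ?L. ?N \<le> (\<Sum>j<?L. of_bool (bad (state (prog_digit code w) (Suc j))))) \<longleftrightarrow>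
      (\<exists>w. (\<forall>i. w i < length acts) \<and> ?N \<le> card {j. 0 < j \<and> j \<le> ?L \<and> bad (state w j)})"
  proof
    assume "\<exists>w<length acts ^ ?L. ?N \<le> (\<Sum>j<?L. of_bool (bad (state (prog_digit code w) (Suc j))))"
    then show "\<exists>w. (\<forall>i. w i < length acts) \<and> ?N \<le> card {j. 0 < j \<and> j \<le> ?L \<and> bad (state w j)}"
      unfolding count using prog_digit_less by blast
  next
    assume "\<exists>w. (\<forall>i. w i < length acts) \<and> ?N \<le> card {j. 0 < j \<and> j \<le> ?L \<and> bad (state w j)}"
    then obtain w where w: "\<And>i. w i < length acts"
      and N: "?N \<le> (\<Sum>j<?L. of_bool (bad (state w (Suc j))))" unfolding count by blast
    from digits_exist[of w, OF w] obtain c where c: "c < length acts ^ ?L"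
      "\<And>j. j < ?L \<Longrightarrow> prog_digit code c j = w j" unfolding prog_digit_def prog_params by blast
    have "state (prog_digit code c) (Suc j) = state w (Suc j)" if "j < ?L" for j
      using that c(2) by (intro state_cong) auto
    then have "(\<Sum>j<?L. of_bool (bad (state (prog_digit code c) (Suc j)))) =
        (\<Sum>j<?L. of_bool (bad (state w (Suc j))) :: nat)"
      by (intro sum.cong refl) (simp only: lessThan_iff)
    with N have "?N \<le> (\<Sum>j<?L. of_bool (bad (state (prog_digit code c) (Suc j))))" by (simp only:)
    with c(1) show "\<exists>w<length acts ^ ?L.
        ?N \<le> (\<Sum>j<?L. of_bool (bad (state (prog_digit code w) (Suc j))))" by blast
  qed
  then show ?thesis
    unfolding prog_decide_def prog_bad_iff prog_bounds prog_params valid_iff infinitely_bad_iff by simp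
qed

end

theorem theorem10:
  shows "decidable_problem
    {(\<A>, \<phi>). quantum_automaton \<A> \<and> rational_automaton \<A> \<and> card (qact \<A>) > 1 \<and>
      (\<forall>P \<in> set \<phi>. projection_mat (qdim \<A>) P \<and> rational_mat P)}
    instance_encode
    (\<lambda>(\<A>, \<phi>). eventually_always_valid \<A> \<phi>)"
proof -
  \<comment> \<open>One function for all instances is fixed here; only its correctness is argued
    instance by instance.\<close>
  from unary_computable_prog_decide obtain f where f: "recursive 1 f" "\<And>x. f [x] = prog_decide x"
    unfolding unary_computable_def computable_def by (metis length_Cons list.size(3) nth_Cons_0 One_nat_def)
  have "f [instance_encode (\<A>, \<phi>)] = (if eventually_always_valid \<A> \<phi> then 1 else 0)"
    if "quantum_automaton \<A>" "rational_automaton \<A>" "card (qact \<A>) > 1"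
      "\<forall>P \<in> set \<phi>. projection_mat (qdim \<A>) P \<and> rational_mat P" for \<A> \<phi>
  proof -
    interpret rational_instance \<A> \<phi> using that by unfold_locales auto
    show ?thesis unfolding f(2) by (rule prog_decide_correct)
  qed
  with f(1) show ?thesis unfolding decidable_problem_def by (intro exI[of _ f]) auto
qed

end
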